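(* Let $\Delta_0$ be a compact subset of $L_2$, the Hilbert space of square integrable functions on the unit interval. For each $n$, let $U_1\le\cdots\le U_n$ be the order statistics of a sample of size $n$ from a distribution on $[0,1]$, put $U_0=0$, $U_{n+1}=1$, and let $D=(D_1,\ldots,D_{n+1})$ with $D_i=U_i-U_{i-1}$ be the sample spacings. Let $\mathcal{T}=\mathcal{T}_n$ be the family of test functions $T(D)$ invariant under permutations of the entries of $D$. Let $\mathrm{E}_h$ denote expectation when the sample is drawn from the density $1+h(x)/n^{1/2}$ on $[0,1]$, so that $\mathrm{E}_0$ corresponds to the uniform distribution. Then, as $n\to\infty$, $$\sup\{|\mathrm{E}_h(T)-\mathrm{E}_0(T)| : T\in\mathcal{T},\ h\in\Delta_0\}\to 0,$$ where the supremum is over those $h\in\Delta_0$ for which $1+h/n^{1/2}$ is a probability density on $[0,1]$.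
   Context: A test function is a measurable function of the data with values in $[0,1]$. $\mathrm{E}_h(T)$ means $\mathrm{E}_h(T(D))$. The sample consists of $n$ independent observations from the stated density. *)

theory Defs
  imports "HOL-Probability.Probability" "HOL-Combinatorics.Permutations"
begin

definition unit_lborel :: "real measure" where
  "unit_lborel = restrict_space lborel {0..1}"

definition square_integrable :: "(real \<Rightarrow> real) \<Rightarrow> bool" where
  "square_integrable f \<longleftrightarrow>
     f \<in> borel_measurable unit_lborel \<and> integrable unit_lborel (\<lambda>x. (f x)\<^sup>2)"

lemma square_integrable_measurable [measurable_dest]:
  "square_integrable f \<Longrightarrow> f \<in> borel_measurable unit_lborel"
  by (simp add: square_integrable_def)

lemma square_integrable_0: "square_integrable (\<lambda>x. 0)"
  by (simp add: square_integrable_def)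

lemma square_integrable_mult_integrable:
  assumes "square_integrable f" "square_integrable g"
  shows "integrable unit_lborel (\<lambda>x. f x * g x)"
proof (rule Bochner_Integration.integrable_bound)
  show "integrable unit_lborel (\<lambda>x. (f x)\<^sup>2 + (g x)\<^sup>2)"
    using assms by (simp add: square_integrable_def)
  show "(\<lambda>x. f x * g x) \<in> borel_measurable unit_lborel"
    using assms by measurable
  have "\<bar>a * b\<bar> \<le> a\<^sup>2 + b\<^sup>2" for a b :: real
  proof -
    have "2 * (\<bar>a\<bar> * \<bar>b\<bar>) \<le> a\<^sup>2 + b\<^sup>2"
      using sum_squares_bound[of "\<bar>a\<bar>" "\<bar>b\<bar>"] by simp
    moreover have "0 \<le> \<bar>a\<bar> * \<bar>b\<bar>" by simp
    ultimately show ?thesis unfolding abs_mult by linarith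
  qed
  then show "AE x in unit_lborel. norm (f x * g x) \<le> norm ((f x)\<^sup>2 + (g x)\<^sup>2)"
    by simp
qed

lemma square_integrable_add:
  assumes "square_integrable f" "square_integrable g"
  shows "square_integrable (\<lambda>x. f x + g x)"
  unfolding square_integrable_def
proof
  show "(\<lambda>x. f x + g x) \<in> borel_measurable unit_lborel"
    using assms by measurable
  have "integrable unit_lborel (\<lambda>x. (f x)\<^sup>2 + (g x)\<^sup>2 + 2 * (f x * g x))"
    using assms square_integrable_mult_integrable[OF assms]
    by (simp add: square_integrable_def)
  then show "integrable unit_lborel (\<lambda>x. (f x + g x)\<^sup>2)"
    by (simp add: power2_sum mult.assoc)
qed

lemma square_integrable_scale:
  "square_integrable f \<Longrightarrow> square_integrable (\<lambda>x. c * f x)"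
  by (auto simp: square_integrable_def power_mult_distrib)

quotient_type l2 = "real \<Rightarrow> real" / partial:
  "\<lambda>f g. square_integrable f \<and> square_integrable g \<and> (AE x in unit_lborel. f x = g x)"
proof (rule part_equivpI)
  show "\<exists>f. square_integrable f \<and> square_integrable f \<and> (AE x in unit_lborel. f x = f x)"
    using square_integrable_0 by auto
  show "symp (\<lambda>f g. square_integrable f \<and> square_integrable g \<and> (AE x in unit_lborel. f x = g x))"
    by (auto simp: symp_def eq_commute)
  show "transp (\<lambda>f g. square_integrable f \<and> square_integrable g \<and> (AE x in unit_lborel. f x = g x))"
    unfolding transp_def by (auto elim: eventually_elim2)
qed

instantiation l2 :: real_inner
begin

lift_definition zero_l2 :: l2 is "\<lambda>x. 0"
  by (simp add: square_integrable_0)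

lift_definition plus_l2 :: "l2 \<Rightarrow> l2 \<Rightarrow> l2" is "\<lambda>f g x. f x + g x"
  by (auto simp: square_integrable_add elim: eventually_elim2)

lift_definition scaleR_l2 :: "real \<Rightarrow> l2 \<Rightarrow> l2" is "\<lambda>c f x. c * f x"
  by (auto simp: square_integrable_scale elim: eventually_mono)

lift_definition inner_l2 :: "l2 \<Rightarrow> l2 \<Rightarrow> real"
  is "\<lambda>f g. \<integral>x. f x * g x \<partial>unit_lborel"
proof -
  fix f f' g g' :: "real \<Rightarrow> real"
  assume f: "square_integrable f \<and> square_integrable f' \<and> (AE x in unit_lborel. f x = f' x)"
    and g: "square_integrable g \<and> square_integrable g' \<and> (AE x in unit_lborel. g x = g' x)"
  have "AE x in unit_lborel. f x * g x = f' x * g' x"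
    using f g by (auto elim: eventually_elim2)
  then show "(\<integral>x. f x * g x \<partial>unit_lborel) = (\<integral>x. f' x * g' x \<partial>unit_lborel)"
    using f g by (intro integral_cong_AE) (auto simp: square_integrable_def)
qed

definition uminus_l2 :: "l2 \<Rightarrow> l2" where "uminus_l2 f = (-1) *\<^sub>R f"
definition minus_l2 :: "l2 \<Rightarrow> l2 \<Rightarrow> l2" where "minus_l2 f g = f + - g"
definition norm_l2 :: "l2 \<Rightarrow> real" where "norm_l2 f = sqrt (f \<bullet> f)"
definition sgn_l2 :: "l2 \<Rightarrow> l2" where "sgn_l2 f = inverse (norm f) *\<^sub>R f"
definition dist_l2 :: "l2 \<Rightarrow> l2 \<Rightarrow> real" where "dist_l2 f g = norm (f - g)"
definition uniformity_l2 :: "(l2 \<times> l2) filter" where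
  "uniformity_l2 = (INF e\<in>{0<..}. principal {(x, y). dist x y < e})"
definition open_l2 :: "l2 set \<Rightarrow> bool" where
  "open_l2 U \<longleftrightarrow> (\<forall>x\<in>U. eventually (\<lambda>(x', y). x' = x \<longrightarrow> y \<in> U) uniformity)"

instance
proof
  fix f g h :: l2 and a b :: real and U :: "l2 set"
  show "f + g + h = f + (g + h)"
    by transfer (simp add: square_integrable_add add.assoc)
  show "f + g = g + f"
    by transfer (simp add: square_integrable_add add.commute)
  show "0 + f = f"
    by transfer simp
  show "- f + f = 0"
    unfolding uminus_l2_def
    by transfer (simp add: square_integrable_0 square_integrable_add square_integrable_scale)
  show "f - g = f + - g"
    by (fact minus_l2_def)
  show "a *\<^sub>R (f + g) = a *\<^sub>R f + a *\<^sub>R g"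
    by transfer (simp add: square_integrable_add square_integrable_scale distrib_left)
  show "(a + b) *\<^sub>R f = a *\<^sub>R f + b *\<^sub>R f"
    by transfer (simp add: square_integrable_add square_integrable_scale distrib_right)
  show "a *\<^sub>R b *\<^sub>R f = (a * b) *\<^sub>R f"
    by transfer (simp add: square_integrable_scale mult.assoc)
  show "1 *\<^sub>R f = f"
    by transfer simp
  show "dist f g = norm (f - g)"
    by (fact dist_l2_def)
  show "sgn f = inverse (norm f) *\<^sub>R f"
    by (fact sgn_l2_def)
  show "uniformity = (INF e\<in>{0<..}. principal {(x, y). dist x (y :: l2) < e})"
    by (fact uniformity_l2_def)
  show "open U \<longleftrightarrow> (\<forall>x\<in>U. eventually (\<lambda>(x', y). x' = x \<longrightarrow> y \<in> U) uniformity)"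
    by (fact open_l2_def)
  show "f \<bullet> g = g \<bullet> f"
    by transfer (simp add: mult.commute)
  show "(f + g) \<bullet> h = f \<bullet> h + g \<bullet> h"
    by transfer (simp add: square_integrable_mult_integrable distrib_right)
  show "a *\<^sub>R f \<bullet> g = a * (f \<bullet> g)"
    by transfer (simp add: mult.assoc)
  show "0 \<le> f \<bullet> f"
    by transfer simp
  show "f \<bullet> f = 0 \<longleftrightarrow> f = 0"
  proof transfer
    fix f :: "real \<Rightarrow> real"
    assume "square_integrable f \<and> square_integrable f \<and> (AE x in unit_lborel. f x = f x)"
    then have f: "square_integrable f" by simp
    have "(\<integral>x. f x * f x \<partial>unit_lborel) = 0 \<longleftrightarrow> (AE x in unit_lborel. f x * f x = 0)"
      using f by (intro integral_nonneg_eq_0_iff_AE square_integrable_mult_integrable) auto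
    then show "(\<integral>x. f x * f x \<partial>unit_lborel) = 0 \<longleftrightarrow>
        square_integrable f \<and> square_integrable (\<lambda>x. 0) \<and> (AE x in unit_lborel. f x = 0)"
      using f by (simp add: square_integrable_0)
  qed
  show "norm f = sqrt (f \<bullet> f)"
    by (fact norm_l2_def)
qed

end

lift_definition is_perturbed_density :: "nat \<Rightarrow> l2 \<Rightarrow> bool"
  is "\<lambda>n h. (AE x in unit_lborel. 0 \<le> 1 + h x / sqrt (real n)) \<and>
            (\<integral>x. 1 + h x / sqrt (real n) \<partial>unit_lborel) = 1"
proof -
  fix n :: nat and f g :: "real \<Rightarrow> real"
  assume fg: "square_integrable f \<and> square_integrable g \<and> (AE x in unit_lborel. f x = g x)"
  then have ae: "AE x in unit_lborel. f x = g x" by simp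
  have "(AE x in unit_lborel. 0 \<le> 1 + f x / sqrt (real n)) \<longleftrightarrow>
        (AE x in unit_lborel. 0 \<le> 1 + g x / sqrt (real n))"
    using ae by (intro eventually_subst) (auto elim: eventually_mono)
  moreover have "(\<integral>x. 1 + f x / sqrt (real n) \<partial>unit_lborel) =
                 (\<integral>x. 1 + g x / sqrt (real n) \<partial>unit_lborel)"
    using fg by (intro integral_cong_AE) (auto simp: square_integrable_def elim: eventually_mono)
  ultimately show "((AE x in unit_lborel. 0 \<le> 1 + f x / sqrt (real n)) \<and>
                    (\<integral>x. 1 + f x / sqrt (real n) \<partial>unit_lborel) = 1) =
                   ((AE x in unit_lborel. 0 \<le> 1 + g x / sqrt (real n)) \<and>
                    (\<integral>x. 1 + g x / sqrt (real n) \<partial>unit_lborel) = 1)"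
    by simp
qed

(* Only meaningful under is_perturbed_density: ennreal cuts off negative values. *)
lift_definition perturbed_dist :: "nat \<Rightarrow> l2 \<Rightarrow> real measure"
  is "\<lambda>n h. density unit_lborel (\<lambda>x. ennreal (1 + h x / sqrt (real n)))"
proof -
  fix n :: nat and f g :: "real \<Rightarrow> real"
  assume "square_integrable f \<and> square_integrable g \<and> (AE x in unit_lborel. f x = g x)"
  then show "density unit_lborel (\<lambda>x. ennreal (1 + f x / sqrt (real n))) =
             density unit_lborel (\<lambda>x. ennreal (1 + g x / sqrt (real n)))"
    by (intro density_cong) (auto simp: square_integrable_def elim: eventually_mono)
qed

(* The observations are X 1, ..., X n; list indexing starts at 0. *)
definition order_stat :: "nat \<Rightarrow> (nat \<Rightarrow> real) \<Rightarrow> nat \<Rightarrow> real" where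
  "order_stat n X i =
     (if i = 0 then 0
      else if i = n + 1 then 1
      else sort (map X [1..<n + 1]) ! (i - 1))"

definition spacings :: "nat \<Rightarrow> (nat \<Rightarrow> real) \<Rightarrow> nat \<Rightarrow> real" where
  "spacings n X = (\<lambda>i\<in>{1..n + 1}. order_stat n X i - order_stat n X (i - 1))"

definition spacing_space :: "nat \<Rightarrow> (nat \<Rightarrow> real) measure" where
  "spacing_space n =
     restrict_space (\<Pi>\<^sub>M i\<in>{1..n + 1}. borel)
       {d. (\<forall>i\<in>{1..n + 1}. 0 \<le> d i) \<and> (\<Sum>i\<in>{1..n + 1}. d i) = 1}"

definition invariant_tests :: "nat \<Rightarrow> ((nat \<Rightarrow> real) \<Rightarrow> real) set" where
  "invariant_tests n =
     {T \<in> borel_measurable (spacing_space n).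
        (\<forall>d\<in>space (spacing_space n). 0 \<le> T d \<and> T d \<le> 1) \<and>
        (\<forall>d\<in>space (spacing_space n). \<forall>\<pi>. \<pi> permutes {1..n + 1} \<longrightarrow> T (d \<circ> \<pi>) = T d)}"

definition expect :: "nat \<Rightarrow> l2 \<Rightarrow> ((nat \<Rightarrow> real) \<Rightarrow> real) \<Rightarrow> real" where
  "expect n h T = (\<integral>X. T (spacings n X) \<partial>(\<Pi>\<^sub>M i\<in>{1..n}. perturbed_dist n h))"

end

theory Submission
  imports Defs
begin

text \<open>
  Why symmetric tests based on spacings see nothing at distance \<open>1 / sqrt n\<close>: under the uniform
  distribution the \<open>n + 1\<close> spacings are independent exponentials \<open>x\<close> divided by their total.
  Under the density \<open>1 + g / sqrt n\<close>, the spacings near a point \<open>u\<close> look like exponentials of rate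
  \<open>1 + g u / sqrt n\<close>. A symmetric test sees only the multiset of spacings, that is, essentially a sample
  from the mixture of these exponentials. As \<open>g\<close> has mean zero, the first order terms of the mixture
  cancel, and what remains is too small to be detected by \<open>n\<close> observations.

  The representation by exponentials is \<open>distr_spacings_eq_distr_normalize\<close>. It is proved by induction on
  \<open>n\<close>, by removing the largest observation from the sample and the last exponential from the vector.

  The cancellation is made precise in \<open>symmetric_test_exp_tilt\<close>. For independent exponentials with rates
  \<open>1 + a j\<close>, a symmetric test does not notice if the likelihood ratio is averaged over all permutations of
  the rates. The second moment of the average is the mean over permutations \<open>\<rho>\<close> of the product of the
  factors \<open>1 + x y / (1 + x + y)\<close> with \<open>x = a j\<close> and \<open>y = a (\<rho> j)\<close>. If the \<open>a j\<close> sum to zero and are of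
  order \<open>1 / sqrt n\<close>, it tends to one, so the averaged ratio tends to one in mean square.

  To reach that model, a general \<open>h\<close> is replaced by a polynomial \<open>g\<close> that is close to it in mean
  square, and the density by one proportional to \<open>exp (g / sqrt n)\<close>. The cost in total variation is bounded
  through the chi-square distance, which is multiplicative over the sample (\<open>expect_close_to_tilted\<close>). For
  smooth \<open>g\<close> the log-likelihood of the sample is linear in the exponentials up to a constant and a
  vanishing error (\<open>gap_likelihood_linearization\<close>), which makes it that of an exponential tilt. The constant
  takes care of itself: two densities that are nearly proportional are close, since both have integral one
  (\<open>integral_abs_diff_le_of_proportional\<close>).

  All bounds hold for every test at once. A compact set of \<open>h\<close> is covered by finitely many small balls, each
  served by one polynomial.
\<close>

section \<open>Smooth approximation in mean square\<close>

lemma prob_space_unit_lborel: "prob_space unit_lborel"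
  by (rule prob_spaceI) (simp add: unit_lborel_def space_restrict_space emeasure_restrict_space)

lemma space_unit_lborel: "space unit_lborel = {0..1}"
  by (simp add: unit_lborel_def space_restrict_space)

lemma borel_imp_measurable_unit_lborel [measurable (raw)]:
  "f \<in> borel_measurable borel \<Longrightarrow> f \<in> borel_measurable unit_lborel"
  unfolding unit_lborel_def by (rule measurable_restrict_space1) simp

lemma AE_unit_lborel_mem: "AE x in unit_lborel. x \<in> {0..1}"
  by (rule AE_I2) (simp add: space_unit_lborel)

lemma integrable_unit_lborel_bounded:
  fixes f :: "real \<Rightarrow> real"
  assumes "f \<in> borel_measurable unit_lborel" "\<And>x. x \<in> {0..1} \<Longrightarrow> \<bar>f x\<bar> \<le> B"
  shows "integrable unit_lborel f"
proof -
  interpret prob_space unit_lborel by (rule prob_space_unit_lborel)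
  show ?thesis
    using assms by (intro integrable_const_bound[where B = B] AE_I2) (auto simp: space_unit_lborel)
qed

lemma square_integrable_bounded:
  assumes "f \<in> borel_measurable unit_lborel" "\<And>x. x \<in> {0..1} \<Longrightarrow> \<bar>f x\<bar> \<le> B"
  shows "square_integrable f"
  unfolding square_integrable_def
proof
  show "integrable unit_lborel (\<lambda>x. (f x)\<^sup>2)"
  proof (rule integrable_unit_lborel_bounded[where B = "B\<^sup>2"])
    fix x :: real assume "x \<in> {0..1}"
    then show "\<bar>(f x)\<^sup>2\<bar> \<le> B\<^sup>2"
      using power_mono[OF assms(2) abs_ge_zero, of x 2] by simp
  qed (use assms in measurable)
qed fact

lemma square_integrable_integrable: "square_integrable f \<Longrightarrow> integrable unit_lborel f"
  using square_integrable_mult_integrable[OF _ square_integrable_bounded[of "\<lambda>_. 1" 1], of f]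
  by simp

lemma square_integrable_diff:
  "square_integrable f \<Longrightarrow> square_integrable g \<Longrightarrow> square_integrable (\<lambda>x. f x - g x)"
  using square_integrable_add[of f "\<lambda>x. -1 * g x"] square_integrable_scale[of g "-1"] by simp

lemma integral_square_add_le:
  assumes "square_integrable f" "square_integrable g"
  shows "(\<integral>x. (f x + g x)\<^sup>2 \<partial>unit_lborel)
         \<le> 2 * (\<integral>x. (f x)\<^sup>2 \<partial>unit_lborel) + 2 * (\<integral>x. (g x)\<^sup>2 \<partial>unit_lborel)"
proof -
  have i: "integrable unit_lborel (\<lambda>x. (f x)\<^sup>2)" "integrable unit_lborel (\<lambda>x. (g x)\<^sup>2)"
    using assms by (auto simp: square_integrable_def)
  have "(\<integral>x. (f x + g x)\<^sup>2 \<partial>unit_lborel) \<le> (\<integral>x. 2 * (f x)\<^sup>2 + 2 * (g x)\<^sup>2 \<partial>unit_lborel)"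
  proof (rule integral_mono)
    show "integrable unit_lborel (\<lambda>x. (f x + g x)\<^sup>2)"
      using square_integrable_add[OF assms] by (simp add: square_integrable_def)
    show "(f x + g x)\<^sup>2 \<le> 2 * (f x)\<^sup>2 + 2 * (g x)\<^sup>2" for x
      using zero_le_power2[of "f x - g x"] by (simp add: power2_eq_square algebra_simps)
  qed (use i in simp)
  also have "\<dots> = 2 * (\<integral>x. (f x)\<^sup>2 \<partial>unit_lborel) + 2 * (\<integral>x. (g x)\<^sup>2 \<partial>unit_lborel)"
    using i by simp
  finally show ?thesis .
qed

text \<open>
  Differentiability enters the proof only through a quadratic bound on the first order Taylor
  remainder, with \<open>g'\<close> in the role of the derivative. In this form it is stable under sums and products and can be
  proved by induction on polynomials.
\<close>
definition C11_bound :: "real \<Rightarrow> (real \<Rightarrow> real) \<Rightarrow> (real \<Rightarrow> real) \<Rightarrow> bool" where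
  "C11_bound K g g' \<longleftrightarrow>
     (\<forall>x\<in>{0..1}. \<bar>g x\<bar> \<le> K \<and> \<bar>g' x\<bar> \<le> K) \<and>
     (\<forall>x\<in>{0..1}. \<forall>y\<in>{0..1}. \<bar>g y - g x - g' x * (y - x)\<bar> \<le> K * (y - x)\<^sup>2)"

lemma C11_bound_nonneg: "C11_bound K g g' \<Longrightarrow> 0 \<le> K"
  unfolding C11_bound_def by (auto dest!: bspec[of _ _ 0])

lemma C11_bound_add:
  assumes "C11_bound K f f'" "C11_bound L g g'"
  shows "C11_bound (K + L) (\<lambda>x. f x + g x) (\<lambda>x. f' x + g' x)"
  unfolding C11_bound_def
proof (intro conjI ballI)
  fix x y :: real assume x: "x \<in> {0..1}" and y: "y \<in> {0..1}"
  have "\<bar>(f y - f x - f' x * (y - x)) + (g y - g x - g' x * (y - x))\<bar> \<le> K * (y - x)\<^sup>2 + L * (y - x)\<^sup>2"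
    using assms x y unfolding C11_bound_def by (intro order_trans[OF abs_triangle_ineq] add_mono) auto
  then show "\<bar>f y + g y - (f x + g x) - (f' x + g' x) * (y - x)\<bar> \<le> (K + L) * (y - x)\<^sup>2"
    by (simp add: algebra_simps)
next
  fix x :: real assume x: "x \<in> {0..1}"
  show "\<bar>f x + g x\<bar> \<le> K + L" "\<bar>f' x + g' x\<bar> \<le> K + L"
    using assms x unfolding C11_bound_def by (auto intro!: order_trans[OF abs_triangle_ineq] add_mono)
qed

lemma C11_bound_mult:
  assumes f: "C11_bound K f f'" and g: "C11_bound L g g'"
  shows "C11_bound (6 * K * L) (\<lambda>x. f x * g x) (\<lambda>x. f' x * g x + f x * g' x)"
proof -
  have K: "0 \<le> K" and L: "0 \<le> L" using assms C11_bound_nonneg by auto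
  show ?thesis
    unfolding C11_bound_def
  proof (intro conjI ballI)
    fix x y :: real assume x: "x \<in> {0..1}" and y: "y \<in> {0..1}"
    define d where "d = y - x"
    have d: "\<bar>d\<bar> \<le> 1" using x y by (auto simp: d_def abs_if)
    have bf: "\<bar>f x\<bar> \<le> K" "\<bar>f' x\<bar> \<le> K" "\<bar>f y - f x - f' x * d\<bar> \<le> K * d\<^sup>2" "\<bar>f y\<bar> \<le> K"
      using f x y by (auto simp: C11_bound_def d_def)
    have bg: "\<bar>g x\<bar> \<le> L" "\<bar>g' x\<bar> \<le> L" "\<bar>g y - g x - g' x * d\<bar> \<le> L * d\<^sup>2"
      using g x y by (auto simp: C11_bound_def d_def)
    have "\<bar>f' x * d\<bar> \<le> K * \<bar>d\<bar>" using bf by (simp add: abs_mult mult_right_mono)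
    moreover have "d\<^sup>2 \<le> \<bar>d\<bar>" using mult_right_mono[OF d, of "\<bar>d\<bar>"] by (simp add: power2_eq_square)
    then have "K * d\<^sup>2 \<le> K * \<bar>d\<bar>" using K by (rule mult_left_mono)
    ultimately have lip: "\<bar>f y - f x\<bar> \<le> 2 * K * \<bar>d\<bar>" using bf(3) by linarith
    have "f y * g y - f x * g x - (f' x * g x + f x * g' x) * d
        = f y * (g y - g x - g' x * d) + (f y - f x) * (g' x * d) + g x * (f y - f x - f' x * d)"
      by (simp add: algebra_simps)
    also have "\<bar>\<dots>\<bar> \<le> \<bar>f y\<bar> * \<bar>g y - g x - g' x * d\<bar> + \<bar>f y - f x\<bar> * (\<bar>g' x\<bar> * \<bar>d\<bar>)
        + \<bar>g x\<bar> * \<bar>f y - f x - f' x * d\<bar>"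
      by (intro order_trans[OF abs_triangle_ineq] add_mono) (simp_all add: abs_mult)
    also have "\<dots> \<le> K * (L * d\<^sup>2) + (2 * K * \<bar>d\<bar>) * (L * \<bar>d\<bar>) + L * (K * d\<^sup>2)"
      by (intro add_mono mult_mono bf bg lip K L mult_nonneg_nonneg abs_ge_zero order_refl zero_le_numeral)
    also have "\<dots> = 4 * K * L * d\<^sup>2" by (simp add: algebra_simps power2_eq_square)
    also have "\<dots> \<le> 6 * K * L * d\<^sup>2" using K L by (intro mult_right_mono) auto
    finally show "\<bar>f y * g y - f x * g x - (f' x * g x + f x * g' x) * (y - x)\<bar> \<le> 6 * K * L * (y - x)\<^sup>2"
      by (simp add: d_def)
    have "\<bar>f x * g x\<bar> \<le> K * L" using bf bg K by (simp add: abs_mult mult_mono)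
    moreover have KL: "0 \<le> K * L" using K L by simp
    ultimately show "\<bar>f x * g x\<bar> \<le> 6 * K * L" by linarith
    have "\<bar>f' x * g x\<bar> \<le> K * L" "\<bar>f x * g' x\<bar> \<le> K * L"
      using bf bg K by (auto simp: abs_mult intro!: mult_mono)
    then show "\<bar>f' x * g x + f x * g' x\<bar> \<le> 6 * K * L" using KL by linarith
  qed
qed

lemma real_polynomial_function_C11_bound:
  assumes "real_polynomial_function g"
  shows "\<exists>g' K. C11_bound K g g'"
  using assms
proof (induction g)
  case (linear f)
  then obtain c where "f = (\<lambda>x. x * c)" by (metis real_bounded_linear)
  then show ?case
    by (intro exI[of _ "\<lambda>_. c"] exI[of _ "\<bar>c\<bar>"])
       (auto simp: C11_bound_def abs_mult mult_left_le_one_le algebra_simps)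
next
  case (const c)
  then show ?case
    by (intro exI[of _ "\<lambda>_. 0"] exI[of _ "\<bar>c\<bar>"]) (auto simp: C11_bound_def)
next
  case (add f g)
  then show ?case using C11_bound_add by blast
next
  case (mult f g)
  then show ?case using C11_bound_mult by blast
qed

lemma square_integrable_approx_bounded:
  assumes f: "square_integrable f" and e: "0 < e"
  shows "\<exists>B>0. (\<integral>x. (f x - max (-B) (min B (f x)))\<^sup>2 \<partial>unit_lborel) < e"
proof -
  have fm [measurable]: "f \<in> borel_measurable unit_lborel" using f by measurable
  have "(\<lambda>k. \<integral>x. (f x - max (- real k) (min (real k) (f x)))\<^sup>2 \<partial>unit_lborel)
        \<longlonglongrightarrow> (\<integral>x. 0 \<partial>unit_lborel)"
  proof (rule integral_dominated_convergence[where w = "\<lambda>x. (f x)\<^sup>2"])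
    show "integrable unit_lborel (\<lambda>x. (f x)\<^sup>2)" using f by (simp add: square_integrable_def)
    show "AE x in unit_lborel. (\<lambda>k. (f x - max (- real k) (min (real k) (f x)))\<^sup>2) \<longlonglongrightarrow> 0"
    proof (rule AE_I2, rule tendsto_eventually)
      fix x
      show "\<forall>\<^sub>F k in sequentially. (f x - max (- real k) (min (real k) (f x)))\<^sup>2 = 0"
        using eventually_ge_at_top[of "nat \<lceil>\<bar>f x\<bar>\<rceil>"]
      proof eventually_elim
        fix k assume "nat \<lceil>\<bar>f x\<bar>\<rceil> \<le> k"
        then have "\<bar>f x\<bar> \<le> real k" by linarith
        then show "(f x - max (- real k) (min (real k) (f x)))\<^sup>2 = 0" by auto
      qed
    qed
    fix k
    have "\<bar>f x - max (- real k) (min (real k) (f x))\<bar> \<le> \<bar>f x\<bar>" for x by linarith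
    then have "norm ((f x - max (- real k) (min (real k) (f x)))\<^sup>2) \<le> (f x)\<^sup>2" for x
      by (simp add: abs_le_square_iff)
    then show "AE x in unit_lborel. norm ((f x - max (- real k) (min (real k) (f x)))\<^sup>2) \<le> (f x)\<^sup>2"
      by simp
  qed measurable
  then have "\<forall>\<^sub>F k in sequentially. (\<integral>x. (f x - max (- real k) (min (real k) (f x)))\<^sup>2 \<partial>unit_lborel) < e"
    using e by (intro order_tendstoD) auto
  then have "\<forall>\<^sub>F k in sequentially. 0 < real k \<and>
      (\<integral>x. (f x - max (- real k) (min (real k) (f x)))\<^sup>2 \<partial>unit_lborel) < e"
    using eventually_gt_at_top[of 0] by eventually_elim simp
  from eventually_happens'[OF sequentially_bot this] show ?thesis by blast
qed

text \<open>
  A measurable function is an almost everywhere limit of continuous functions. Clamping these to the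
  range of \<open>f\<close> makes dominated convergence applicable.
\<close>
lemma bounded_approx_continuous:
  fixes f :: "real \<Rightarrow> real"
  assumes f [measurable]: "f \<in> borel_measurable unit_lborel" and B: "\<And>x. \<bar>f x\<bar> \<le> B" and e: "0 < e"
  shows "\<exists>g. continuous_on UNIV g \<and> (\<integral>x. (f x - g x)\<^sup>2 \<partial>unit_lborel) < e"
proof -
  have "f \<in> borel_measurable (lebesgue_on {0..1})"
  proof -
    have "(\<lambda>x. indicat_real {0..1} x *\<^sub>R f x) \<in> borel_measurable lborel"
      using f by (simp add: unit_lborel_def borel_measurable_restrict_space_iff)
    then have "(\<lambda>x. indicat_real {0..1} x *\<^sub>R f x) \<in> borel_measurable lebesgue"
      by (rule measurable_completion)
    then show ?thesis by (simp add: borel_measurable_restrict_space_iff)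
  qed
  then have "f measurable_on {0..1}"
    by (simp add: measurable_on_iff_borel_measurable)
  then obtain N g where N: "negligible N" and g: "\<And>n. continuous_on UNIV (g n)"
    and lim: "\<And>x. x \<notin> N \<Longrightarrow> (\<lambda>n. g n x) \<longlonglongrightarrow> (if x \<in> {0..1} then f x else 0)"
    unfolding measurable_on_def by metis
  define G where "G n x = max (-B) (min B (g n x))" for n x
  have G: "continuous_on UNIV (G n)" for n
    unfolding G_def by (intro continuous_intros g)
  have [measurable]: "G n \<in> borel_measurable borel" for n
    using G by (rule borel_measurable_continuous_onI)
  have "AE x in lebesgue. x \<notin> N"
    using N by (simp add: AE_not_in negligible_iff_null_sets)
  then have "AE x in lborel. x \<notin> N" by (simp add: AE_completion_iff)
  then have AE: "AE x in unit_lborel. x \<notin> N"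
    unfolding unit_lborel_def by (subst AE_restrict_space_iff) auto
  have GB: "\<bar>G n x\<bar> \<le> B" for n x using B[of x] by (auto simp: G_def)
  have "(\<lambda>n. \<integral>x. (f x - G n x)\<^sup>2 \<partial>unit_lborel) \<longlonglongrightarrow> (\<integral>x. 0 \<partial>unit_lborel)"
  proof (rule integral_dominated_convergence[where w = "\<lambda>x. (2 * B)\<^sup>2"])
    show "AE x in unit_lborel. (\<lambda>n. (f x - G n x)\<^sup>2) \<longlonglongrightarrow> 0"
      using AE AE_unit_lborel_mem
    proof eventually_elim
      case (elim x)
      then have "(\<lambda>n. G n x) \<longlonglongrightarrow> max (-B) (min B (f x))"
        unfolding G_def using lim[of x] by (intro tendsto_intros) auto
      also have "max (-B) (min B (f x)) = f x" using B[of x] by auto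
      finally show ?case by (auto intro!: tendsto_eq_intros)
    qed
    show "AE x in unit_lborel. norm ((f x - G n x)\<^sup>2) \<le> (2 * B)\<^sup>2" for n
    proof (rule AE_I2)
      fix x
      have "\<bar>f x - G n x\<bar> \<le> 2 * B" using B[of x] GB[of n x] by linarith
      then show "norm ((f x - G n x)\<^sup>2) \<le> (2 * B)\<^sup>2" 
        using power_mono[of "\<bar>f x - G n x\<bar>" "2 * B" 2] by simp
    qed
    show "integrable unit_lborel (\<lambda>x. (2 * B)\<^sup>2)"
      by (rule integrable_unit_lborel_bounded[where B = "(2 * B)\<^sup>2"]) auto
  qed measurable
  then have "\<forall>\<^sub>F n in sequentially. (\<integral>x. (f x - G n x)\<^sup>2 \<partial>unit_lborel) < e"
    using e by (intro order_tendstoD) auto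
  from eventually_happens'[OF sequentially_bot this] show ?thesis using G by blast
qed

text \<open>
  Truncate, pass to a continuous function, and then to a polynomial by the Weierstrass theorem. The
  three errors are chosen to survive the factors in \<open>(x + y)\<^sup>2 \<le> 2 x\<^sup>2 + 2 y\<^sup>2\<close>.
\<close>
lemma C11_dense_L2:
  assumes f: "square_integrable f" and e: "0 < e"
  shows "\<exists>g g' K. g \<in> borel_measurable borel \<and> C11_bound K g g' \<and>
           (\<integral>x. (f x - g x)\<^sup>2 \<partial>unit_lborel) < e"
proof -
  have [measurable]: "f \<in> borel_measurable unit_lborel" using f by measurable
  obtain B where "B > 0" and B: "(\<integral>x. (f x - max (-B) (min B (f x)))\<^sup>2 \<partial>unit_lborel) < e / 8"
    using square_integrable_approx_bounded[OF f, of "e / 8"] e by auto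
  define u where "u x = max (-B) (min B (f x))" for x
  have u: "\<bar>u x\<bar> \<le> B" for x using \<open>B > 0\<close> by (auto simp: u_def)
  have [measurable]: "u \<in> borel_measurable unit_lborel" unfolding u_def by measurable
  obtain v where v: "continuous_on UNIV v" and uv: "(\<integral>x. (u x - v x)\<^sup>2 \<partial>unit_lborel) < e / 16"
    using bounded_approx_continuous[of u B "e / 16"] u e by auto
  have v01: "continuous_on {0..1} v" using v continuous_on_subset by blast
  obtain g where g: "real_polynomial_function g" and vg: "\<And>x. x \<in> {0..1} \<Longrightarrow> \<bar>v x - g x\<bar> < sqrt (e / 16)"
    using Stone_Weierstrass_real_polynomial_function[OF _ v01, of "sqrt (e / 16)"] e by auto
  obtain g' K where gK: "C11_bound K g g'" using real_polynomial_function_C11_bound[OF g] by auto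
  have gb [measurable]: "g \<in> borel_measurable borel"
    using g by (intro borel_measurable_continuous_onI continuous_on_polymonial_function)
       (simp add: real_polynomial_function_eq)
  have vb [measurable]: "v \<in> borel_measurable borel"
    using v by (rule borel_measurable_continuous_onI)
  obtain Bv where Bv: "\<forall>x\<in>{0..1}. \<bar>v x\<bar> \<le> Bv"
    using compact_imp_bounded[OF compact_continuous_image[OF v01 compact_Icc]]
    by (auto simp: bounded_iff)
  have su: "square_integrable u" using u by (intro square_integrable_bounded) auto
  have sv: "square_integrable v" using Bv by (intro square_integrable_bounded[where B = Bv]) auto
  have sg: "square_integrable g" using gK by (intro square_integrable_bounded[where B = K]) (auto simp: C11_bound_def)
  have "(\<integral>x. (v x - g x)\<^sup>2 \<partial>unit_lborel) \<le> (\<integral>x. e / 16 \<partial>unit_lborel)"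
  proof (rule integral_mono_AE)
    show "integrable unit_lborel (\<lambda>x. (v x - g x)\<^sup>2)"
      using square_integrable_diff[OF sv sg] by (simp add: square_integrable_def)
    show "integrable unit_lborel (\<lambda>x. e / 16)"
      by (rule integrable_unit_lborel_bounded[where B = "\<bar>e / 16\<bar>"]) auto
    show "AE x in unit_lborel. (v x - g x)\<^sup>2 \<le> e / 16"
    proof (rule AE_I2)
      fix x assume "x \<in> space unit_lborel"
      then have "\<bar>v x - g x\<bar> < sqrt (e / 16)" using vg by (auto simp: space_unit_lborel)
      then show "(v x - g x)\<^sup>2 \<le> e / 16"
        using power_mono[of "\<bar>v x - g x\<bar>" "sqrt (e / 16)" 2] e by simp
    qed
  qed
  also have "\<dots> = e / 16" using prob_space.prob_space[OF prob_space_unit_lborel] by simp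
  finally have vg': "(\<integral>x. (v x - g x)\<^sup>2 \<partial>unit_lborel) \<le> e / 16" .
  have "(\<integral>x. (u x - g x)\<^sup>2 \<partial>unit_lborel) = (\<integral>x. ((u x - v x) + (v x - g x))\<^sup>2 \<partial>unit_lborel)" by simp
  also have "\<dots> < e / 4"
    using integral_square_add_le[OF square_integrable_diff[OF su sv] square_integrable_diff[OF sv sg]] uv vg' by linarith
  finally have ug: "(\<integral>x. (u x - g x)\<^sup>2 \<partial>unit_lborel) < e / 4" .
  have "(\<integral>x. (f x - g x)\<^sup>2 \<partial>unit_lborel) = (\<integral>x. ((f x - u x) + (u x - g x))\<^sup>2 \<partial>unit_lborel)" by simp
  also have "\<dots> < e"
    using integral_square_add_le[OF square_integrable_diff[OF f su] square_integrable_diff[OF su sg]] ug B e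
    unfolding u_def by linarith
  finally show ?thesis using gb gK by blast
qed

section \<open>Order statistics and spacings\<close>

abbreviation borel_PiM :: "'i set \<Rightarrow> ('i \<Rightarrow> real) measure" where
  "borel_PiM I \<equiv> Pi\<^sub>M I (\<lambda>_. borel)"

abbreviation uniform_PiM :: "'i set \<Rightarrow> ('i \<Rightarrow> real) measure" where
  "uniform_PiM I \<equiv> Pi\<^sub>M I (\<lambda>_. unit_lborel)"

lemma sorted_nth_le_iff:
  fixes c :: "'a :: linorder"
  assumes "sorted ys" "k < length ys"
  shows "ys ! k \<le> c \<longleftrightarrow> k < length (filter (\<lambda>y. y \<le> c) ys)"
  using assms
proof (induction ys arbitrary: k)
  case (Cons y ys)
  show ?case
  proof (cases "y \<le> c")
    case True
    then show ?thesis using Cons by (cases k) auto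
  next
    case False
    then have *: "\<forall>z\<in>set (y # ys). \<not> z \<le> c" using Cons.prems by auto
    then have "filter (\<lambda>y. y \<le> c) (y # ys) = []" by (simp only: filter_empty_conv)
    moreover have "\<not> (y # ys) ! k \<le> c" using * Cons.prems(2) nth_mem by blast
    ultimately show ?thesis by simp
  qed
qed simp

text \<open>
  An order statistic is at most \<open>c\<close> when enough observations are. Counting makes order statistics
  measurable without any reference to the sorting algorithm.
\<close>
lemma order_stat_le_iff:
  assumes "1 \<le> k" "k \<le> n"
  shows "order_stat n X k \<le> c \<longleftrightarrow> real k \<le> (\<Sum>i\<in>{1..n}. indicator {..c} (X i))"
proof -
  let ?xs = "map X [1..<n + 1]"
  have "order_stat n X k \<le> c \<longleftrightarrow> k - 1 < length (filter (\<lambda>y. y \<le> c) (sort ?xs))"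
    using assms by (subst sorted_nth_le_iff[symmetric]) (auto simp: order_stat_def)
  also have "length (filter (\<lambda>y. y \<le> c) (sort ?xs)) = length (filter (\<lambda>i. X i \<le> c) [1..<n + 1])"
    by (simp add: filter_sort filter_map o_def del: upt_Suc)
  also have "\<dots> = card {i\<in>{1..n}. X i \<le> c}"
    by (subst distinct_card[symmetric]) (auto simp del: upt_Suc intro!: arg_cong[where f = card])
  also have "k - 1 < \<dots> \<longleftrightarrow> real k \<le> real (card {i\<in>{1..n}. X i \<le> c})"
    using assms by auto
  also have "real (card {i\<in>{1..n}. X i \<le> c}) = (\<Sum>i\<in>{1..n}. indicator {..c} (X i))"
    by (simp add: indicator_def sum.If_cases Int_def)
  finally show ?thesis .
qed

lemma measurable_order_stat:
  assumes "\<And>i. i \<in> {1..n} \<Longrightarrow> (\<lambda>\<omega>. X \<omega> i) \<in> borel_measurable M" "k \<le> n + 1"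
  shows "(\<lambda>\<omega>. order_stat n (X \<omega>) k) \<in> borel_measurable M"
proof (cases "k = 0 \<or> k = n + 1")
  case True
  then show ?thesis by (auto simp: order_stat_def)
next
  case False
  then have k: "1 \<le> k" "k \<le> n" using assms by auto
  show ?thesis
  proof (subst borel_measurable_iff_le, intro allI)
    fix c
    have [measurable]: "(\<lambda>\<omega>. \<Sum>i\<in>{1..n}. indicator {..c} (X \<omega> i) :: real) \<in> borel_measurable M"
      using assms(1) by (intro borel_measurable_sum borel_measurable_indicator') auto
    have "{\<omega> \<in> space M. order_stat n (X \<omega>) k \<le> c}
        = {\<omega> \<in> space M. real k \<le> (\<Sum>i\<in>{1..n}. indicator {..c} (X \<omega> i))}"
      using order_stat_le_iff[OF k] by auto
    also have "\<dots> \<in> sets M" by measurable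
    finally show "{\<omega> \<in> space M. order_stat n (X \<omega>) k \<le> c} \<in> sets M" .
  qed
qed

lemma measurable_PiM_unit_borel:
  "(\<lambda>X. X) \<in> uniform_PiM I \<rightarrow>\<^sub>M borel_PiM I"
proof (rule measurable_PiM_single')
  fix i assume "i \<in> I"
  then have "(\<lambda>X. X i) \<in> uniform_PiM I \<rightarrow>\<^sub>M unit_lborel" by measurable
  moreover have "(\<lambda>x. x) \<in> borel_measurable unit_lborel"
    unfolding unit_lborel_def by (rule measurable_restrict_space1) simp
  ultimately show "(\<lambda>X. X i) \<in> borel_measurable (uniform_PiM I)"
    by (rule measurable_compose)
qed (auto simp: space_PiM)

lemma measurable_spacings:
  "spacings n \<in> borel_PiM {1..n} \<rightarrow>\<^sub>M borel_PiM {1..n + 1}"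
  unfolding spacings_def
  by (intro measurable_restrict borel_measurable_diff measurable_order_stat) auto

lemma measurable_spacings_unit [measurable]:
  "spacings n \<in> uniform_PiM {1..n} \<rightarrow>\<^sub>M borel_PiM {1..n + 1}"
  using measurable_comp[OF measurable_PiM_unit_borel measurable_spacings] by (simp add: o_def)

lemma order_stat_mem_unit:
  assumes "X \<in> {1..n} \<rightarrow> {0..1}" "k \<le> n + 1"
  shows "order_stat n X k \<in> {0..1}"
proof (cases "k = 0 \<or> k = n + 1")
  case False
  then have "sort (map X [1..<n + 1]) ! (k - 1) \<in> set (sort (map X [1..<n + 1]))"
    using assms by (intro nth_mem) auto
  then have "order_stat n X k \<in> set (sort (map X [1..<n + 1]))"
    using False by (simp add: order_stat_def)
  also have "\<dots> \<subseteq> {0..1}" using assms by auto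
  finally show ?thesis .
qed (auto simp: order_stat_def)

lemma order_stat_mono:
  assumes "X \<in> {1..n} \<rightarrow> {0..1}" "k \<le> n"
  shows "order_stat n X k \<le> order_stat n X (k + 1)"
proof -
  consider "k = 0" | "k = n" | "1 \<le> k" "k < n" using assms by linarith
  then show ?thesis
  proof cases
    case 1
    then show ?thesis using order_stat_mem_unit[OF assms(1), of 1] by (simp add: order_stat_def)
  next
    case 2
    then show ?thesis using order_stat_mem_unit[OF assms(1), of n] by (simp add: order_stat_def)
  next
    case 3
    then show ?thesis
      by (auto simp: order_stat_def simp del: upt_Suc intro!: sorted_nth_mono)
  qed
qed

lemma sum_spacings:
  assumes "k \<le> n + 1"
  shows "(\<Sum>i\<in>{1..k}. spacings n X i) = order_stat n X k"
  using assms
proof (induction k)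
  case (Suc k)
  then show ?case by (simp add: spacings_def)
qed (simp add: order_stat_def)

lemma sum_all_spacings: "(\<Sum>i\<in>{1..n + 1}. spacings n X i) = 1"
  by (subst sum_spacings) (auto simp: order_stat_def)

lemma spacings_nonneg:
  assumes "X \<in> {1..n} \<rightarrow> {0..1}" "i \<in> {1..n + 1}"
  shows "0 \<le> spacings n X i"
  using order_stat_mono[OF assms(1), of "i - 1"] assms(2) by (auto simp: spacings_def)

lemma order_stat_symmetric:
  assumes "bij_betw \<tau> {1..n} {1..n}"
  shows "order_stat n (\<lambda>i\<in>{1..n}. X (\<tau> i)) = order_stat n X"
proof -
  have upt: "mset [1..<n + 1] = mset_set {1..n}"
    by (simp add: atLeastLessThanSuc_atLeastAtMost del: upt_Suc)
  have "mset (map (\<lambda>i\<in>{1..n}. X (\<tau> i)) [1..<n + 1]) = image_mset (\<lambda>i. X (\<tau> i)) (mset_set {1..n})"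
    unfolding mset_map upt by (intro image_mset_cong) auto
  also have "\<dots> = image_mset X (image_mset \<tau> (mset_set {1..n}))"
    by (simp add: image_mset.compositionality o_def)
  also have "image_mset \<tau> (mset_set {1..n}) = mset_set {1..n}"
    using assms by (simp add: image_mset_mset_set bij_betw_def)
  also have "image_mset X (mset_set {1..n}) = mset (map X [1..<n + 1])"
    unfolding mset_map upt ..
  finally have "sort (map (\<lambda>i\<in>{1..n}. X (\<tau> i)) [1..<n + 1]) = sort (map X [1..<n + 1])"
    by (metis properties_for_sort mset_sort sorted_sort)
  then show ?thesis by (simp add: order_stat_def fun_eq_iff del: upt_Suc)
qed

lemma spacings_symmetric:
  assumes "bij_betw \<tau> {1..n} {1..n}"
  shows "spacings n (\<lambda>i\<in>{1..n}. X (\<tau> i)) = spacings n X"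
  by (simp only: spacings_def order_stat_symmetric[OF assms])

lemma sort_map_scale:
  fixes t :: real
  assumes "0 \<le> t"
  shows "sort (map (\<lambda>x. t * x) xs) = map (\<lambda>x. t * x) (sort xs)"
proof (rule properties_for_sort)
  have "sorted_wrt (\<lambda>x y. t * x \<le> t * y) (sort xs)"
    using sorted_sort[of xs] by (rule sorted_wrt_mono_rel[rotated]) (use assms mult_left_mono in auto)
  then show "sorted (map (\<lambda>x. t * x) (sort xs))" by (simp add: sorted_map)
qed simp

text \<open>
  Given its maximum \<open>t\<close>, a uniform sample is \<open>t\<close> times a uniform sample with one observation less.
  This is the recursion by which the law of the spacings is computed.
\<close>
lemma spacings_insert_maximum:
  assumes t: "0 < t" and X: "X \<in> {1..n} \<rightarrow> {0..1}"
  shows "spacings (Suc n) ((\<lambda>i\<in>{1..n}. t * X i)(Suc n := t))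
       = (\<lambda>i\<in>{1..n + 1}. t * spacings n X i)(n + 2 := 1 - t)"
proof -
  define Y where "Y = (\<lambda>i\<in>{1..n}. t * X i)(Suc n := t)"
  have m: "map Y [1..<Suc n + 1] = map (\<lambda>x. t * x) (map X [1..<n + 1]) @ [t]"
    by (simp add: o_def) (auto simp: Y_def simp del: upt_Suc)
  have "sort (map Y [1..<Suc n + 1]) = sort (map (\<lambda>x. t * x) (map X [1..<n + 1])) @ [t]"
  proof (rule properties_for_sort)
    show "sorted (sort (map (\<lambda>x. t * x) (map X [1..<n + 1])) @ [t])"
      using t X by (auto simp: sorted_append simp del: upt_Suc intro!: mult_left_le)
  qed (simp only: m mset_append mset_sort)
  also have "\<dots> = map (\<lambda>x. t * x) (sort (map X [1..<n + 1])) @ [t]"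
    using t by (simp only: sort_map_scale less_imp_le)
  finally have s: "sort (map Y [1..<Suc n + 1]) = map (\<lambda>x. t * x) (sort (map X [1..<n + 1])) @ [t]" .
  then have s': "sort (map Y [Suc 0..<Suc (Suc n)]) = map (\<lambda>x. t * x) (sort (map X [Suc 0..<Suc n])) @ [t]"
    by (simp del: upt_Suc)
  have os: "order_stat (Suc n) Y i = t * order_stat n X i" if "i \<le> n + 1" for i
    using that by (auto simp: order_stat_def s' nth_append simp del: upt_Suc)
  show ?thesis
    unfolding Y_def[symmetric]
  proof (rule ext)
    fix i
    consider "i \<in> {1..n + 1}" | "i = n + 2" | "i \<notin> {1..n + 2}" by force
    then show "spacings (Suc n) Y i = ((\<lambda>i\<in>{1..n + 1}. t * spacings n X i)(n + 2 := 1 - t)) i"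
    proof cases
      case 1
      then show ?thesis using os[of i] os[of "i - 1"] by (auto simp: spacings_def algebra_simps)
    next
      case 2
      then show ?thesis using os[of "n + 1"] by (auto simp: spacings_def order_stat_def)
    next
      case 3
      then show ?thesis by (auto simp: spacings_def)
    qed
  qed
qed


section \<open>The largest observation of a uniform sample\<close>

lemma nn_integral_unit_lborel:
  "f \<in> borel_measurable borel \<Longrightarrow>
    (\<integral>\<^sup>+x. f x \<partial>unit_lborel) = (\<integral>\<^sup>+x. f x * indicator {0..1} x \<partial>lborel)"
  unfolding unit_lborel_def by (subst nn_integral_restrict_space) auto

lemma nn_integral_unit_scale:
  fixes f :: "real \<Rightarrow> ennreal"
  assumes [measurable]: "f \<in> borel_measurable borel" and t: "0 < t" "t \<le> 1" and A: "A = {..<t} \<or> A = {..t}"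
  shows "(\<integral>\<^sup>+x. indicator A x * f x \<partial>unit_lborel) = ennreal t * (\<integral>\<^sup>+x. f (t * x) \<partial>unit_lborel)"
proof -
  have [measurable]: "A \<in> sets borel" using A by auto
  have "(\<integral>\<^sup>+x. indicator A x * f x \<partial>unit_lborel) = (\<integral>\<^sup>+x. indicator A x * f x * indicator {0..1} x \<partial>lborel)"
    by (rule nn_integral_unit_lborel) measurable
  also have "\<dots> = (\<integral>\<^sup>+x. f x * indicator {0..t} x \<partial>lborel)"
    using AE_lborel_singleton[of t] A t
    by (intro nn_integral_cong_AE) (auto simp: indicator_def elim!: eventually_mono)
  also have "\<dots> = ennreal t * (\<integral>\<^sup>+x. f (t * x) * indicator {0..t} (t * x) \<partial>lborel)"
    using t by (subst nn_integral_real_affine[where c = t and t = 0]) auto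
  also have "(\<integral>\<^sup>+x. f (t * x) * indicator {0..t} (t * x) \<partial>lborel) = (\<integral>\<^sup>+x. f (t * x) * indicator {0..1} x \<partial>lborel)"
    using t by (intro nn_integral_cong) (auto simp: indicator_def zero_le_mult_iff)
  also have "\<dots> = (\<integral>\<^sup>+x. f (t * x) \<partial>unit_lborel)"
    by (rule nn_integral_unit_lborel[symmetric]) measurable
  finally show ?thesis .
qed

lemma measurable_PiM_unit_lborel:
  "f \<in> borel_PiM I \<rightarrow>\<^sub>M N \<Longrightarrow> f \<in> uniform_PiM I \<rightarrow>\<^sub>M N"
  using measurable_comp[OF measurable_PiM_unit_borel] by (simp add: o_def)

lemma product_sigma_finite_unit: "product_sigma_finite (\<lambda>_. unit_lborel)"
  using prob_space_unit_lborel by (simp add: product_sigma_finite_def prob_space_imp_sigma_finite)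

text \<open>
  One coordinate at a time by Fubini. Open and closed cuts are both admitted because breaking ties
  between observations produces a mixture of strict and weak inequalities.
\<close>
lemma nn_integral_cube_scale:
  fixes f :: "('i \<Rightarrow> real) \<Rightarrow> ennreal"
  assumes I: "finite I" and f: "f \<in> borel_measurable (borel_PiM I)"
    and t: "0 < t" "t \<le> 1" and A: "\<And>i. i \<in> I \<Longrightarrow> A i = {..<t} \<or> A i = {..t}"
  shows "(\<integral>\<^sup>+X. (\<Prod>i\<in>I. indicator (A i) (X i)) * f X \<partial>uniform_PiM I)
       = ennreal t ^ card I * (\<integral>\<^sup>+X. f (\<lambda>i\<in>I. t * X i) \<partial>uniform_PiM I)"
  using I f A
proof (induction I arbitrary: f)
  case empty
  show ?case by (simp add: PiM_empty nn_integral_count_space_finite restrict_def)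
next
  case (insert j I)
  interpret product_sigma_finite "\<lambda>_::'i. unit_lborel" by (rule product_sigma_finite_unit)
  let ?P = "\<lambda>I. Pi\<^sub>M I (\<lambda>_::'i. unit_lborel)"
  note fm [measurable] = insert.prems(1)
  have Am [measurable]: "A i \<in> sets borel" if "i \<in> insert j I" for i
    using insert.prems(2)[OF that] by (metis atMost_borel lessThan_borel)
  have upd: "(\<lambda>(X, x). X(j := x)) \<in> borel_PiM I \<Otimes>\<^sub>M borel \<rightarrow>\<^sub>M Pi\<^sub>M (insert j I) (\<lambda>_. borel :: real measure)"
    by (rule measurable_add_dim)
  have g [measurable]: "(\<lambda>X. \<integral>\<^sup>+x. f (X(j := t * x)) \<partial>unit_lborel) \<in> borel_measurable (borel_PiM I)"
  proof -
    have "(\<lambda>(X, x). f (X(j := t * x))) \<in> borel_measurable (borel_PiM I \<Otimes>\<^sub>M borel)"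
      using measurable_comp[OF measurable_comp[OF _ upd] fm, of "\<lambda>(X, x). (X, t * x)"] by (simp add: o_def split_beta')
    then have "(\<lambda>(X, x). f (X(j := t * x)) * indicator {0..1} x) \<in> borel_measurable (borel_PiM I \<Otimes>\<^sub>M borel)"
      by (simp add: split_beta')
    then have "(\<lambda>X. \<integral>\<^sup>+x. f (X(j := t * x)) * indicator {0..1} x \<partial>lborel) \<in> borel_measurable (borel_PiM I)"
      by (intro sigma_finite_measure.borel_measurable_nn_integral[OF sigma_finite_lborel]) simp
    moreover have "(\<integral>\<^sup>+x. f (X(j := t * x)) \<partial>unit_lborel) = (\<integral>\<^sup>+x. f (X(j := t * x)) * indicator {0..1} x \<partial>lborel)"
      if "X \<in> space (borel_PiM I)" for X
    proof (rule nn_integral_unit_lborel)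
      show "(\<lambda>x. f (X(j := t * x))) \<in> borel_measurable borel"
        using measurable_comp[OF measurable_comp[OF _ measurable_component_update[OF that \<open>j \<notin> I\<close>]] fm, of "\<lambda>x. t * x"]
        by (simp add: o_def)
    qed
    ultimately show ?thesis by (simp cong: measurable_cong)
  qed
  have "(\<integral>\<^sup>+X. (\<Prod>i\<in>insert j I. indicator (A i) (X i)) * f X \<partial>?P (insert j I))
      = (\<integral>\<^sup>+X. \<integral>\<^sup>+x. (\<Prod>i\<in>insert j I. indicator (A i) ((X(j := x)) i)) * f (X(j := x)) \<partial>unit_lborel \<partial>?P I)"
  proof (rule product_nn_integral_insert)
    show "(\<lambda>X. (\<Prod>i\<in>insert j I. indicator (A i) (X i)) * f X) \<in> borel_measurable (?P (insert j I))"
      by (rule measurable_PiM_unit_lborel) (intro borel_measurable_times_ennreal borel_measurable_prod_ennreal fm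
          measurable_compose[OF measurable_component_singleton borel_measurable_indicator] Am)
  qed (use insert.hyps in auto)
  also have "\<dots> = (\<integral>\<^sup>+X. (\<Prod>i\<in>I. indicator (A i) (X i)) * (ennreal t * (\<integral>\<^sup>+x. f (X(j := t * x)) \<partial>unit_lborel)) \<partial>?P I)"
  proof (rule nn_integral_cong)
    fix X assume X: "X \<in> space (?P I)"
    then have X': "X \<in> space (borel_PiM I)" by (auto simp: space_PiM)
    have m [measurable]: "(\<lambda>x. f (X(j := x))) \<in> borel_measurable borel"
      using measurable_comp[OF measurable_component_update[OF X' \<open>j \<notin> I\<close>] fm] by (simp add: o_def)
    have "(\<Prod>i\<in>insert j I. indicator (A i) ((X(j := x)) i) :: ennreal) = indicator (A j) x * (\<Prod>i\<in>I. indicator (A i) (X i))" for x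
      using insert.hyps by (subst prod.insert) (auto intro!: arg_cong2[where f = "(*)"] prod.cong)
    then have "(\<integral>\<^sup>+x. (\<Prod>i\<in>insert j I. indicator (A i) ((X(j := x)) i)) * f (X(j := x)) \<partial>unit_lborel)
       = (\<integral>\<^sup>+x. (\<Prod>i\<in>I. indicator (A i) (X i)) * (indicator (A j) x * f (X(j := x))) \<partial>unit_lborel)"
      by (simp add: ac_simps)
    also have "\<dots> = (\<Prod>i\<in>I. indicator (A i) (X i)) * (\<integral>\<^sup>+x. indicator (A j) x * f (X(j := x)) \<partial>unit_lborel)"
      by (rule nn_integral_cmult) measurable
    also have "(\<integral>\<^sup>+x. indicator (A j) x * f (X(j := x)) \<partial>unit_lborel) = ennreal t * (\<integral>\<^sup>+x. f (X(j := t * x)) \<partial>unit_lborel)"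
      using insert.prems(2)[of j] by (intro nn_integral_unit_scale t m) auto
    finally show "(\<integral>\<^sup>+x. (\<Prod>i\<in>insert j I. indicator (A i) ((X(j := x)) i)) * f (X(j := x)) \<partial>unit_lborel)
       = (\<Prod>i\<in>I. indicator (A i) (X i)) * (ennreal t * (\<integral>\<^sup>+x. f (X(j := t * x)) \<partial>unit_lborel))" .
  qed
  also have "\<dots> = ennreal t ^ card I *
      (\<integral>\<^sup>+X. ennreal t * (\<integral>\<^sup>+x. f ((\<lambda>i\<in>I. t * X i)(j := t * x)) \<partial>unit_lborel) \<partial>?P I)"
  proof (rule insert.IH)
    show "(\<lambda>X. ennreal t * (\<integral>\<^sup>+x. f (X(j := t * x)) \<partial>unit_lborel)) \<in> borel_measurable (borel_PiM I)"
      by (intro borel_measurable_times_ennreal g borel_measurable_const)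
    show "A i = {..<t} \<or> A i = {..t}" if "i \<in> I" for i
      using insert.prems(2)[of i] that by blast
  qed
  also have "(\<integral>\<^sup>+X. ennreal t * (\<integral>\<^sup>+x. f ((\<lambda>i\<in>I. t * X i)(j := t * x)) \<partial>unit_lborel) \<partial>?P I)
      = ennreal t * (\<integral>\<^sup>+X. (\<integral>\<^sup>+x. f ((\<lambda>i\<in>I. t * X i)(j := t * x)) \<partial>unit_lborel) \<partial>?P I)"
  proof (rule nn_integral_cmult)
    have "(\<lambda>X. \<lambda>i\<in>I. t * X i) \<in> borel_PiM I \<rightarrow>\<^sub>M borel_PiM I" by measurable
    from measurable_comp[OF this g]
    show "(\<lambda>X. \<integral>\<^sup>+x. f ((\<lambda>i\<in>I. t * X i)(j := t * x)) \<partial>unit_lborel) \<in> borel_measurable (?P I)"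
      by (intro measurable_PiM_unit_lborel) (simp add: o_def)
  qed
  also have "(\<integral>\<^sup>+X. (\<integral>\<^sup>+x. f ((\<lambda>i\<in>I. t * X i)(j := t * x)) \<partial>unit_lborel) \<partial>?P I)
      = (\<integral>\<^sup>+X. \<integral>\<^sup>+x. f (\<lambda>i\<in>insert j I. t * (X(j := x)) i) \<partial>unit_lborel \<partial>?P I)"
    using insert.hyps by (intro nn_integral_cong arg_cong[where f = f]) (auto simp: fun_eq_iff)
  also have "\<dots> = (\<integral>\<^sup>+X. f (\<lambda>i\<in>insert j I. t * X i) \<partial>?P (insert j I))"
  proof (rule product_nn_integral_insert[symmetric])
    have "(\<lambda>X. \<lambda>i\<in>insert j I. t * X i) \<in> borel_PiM (insert j I) \<rightarrow>\<^sub>M borel_PiM (insert j I)" by measurable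
    from measurable_comp[OF this fm]
    show "(\<lambda>X. f (\<lambda>i\<in>insert j I. t * X i)) \<in> borel_measurable (?P (insert j I))"
      by (intro measurable_PiM_unit_lborel) (simp add: o_def)
  qed (use insert.hyps in auto)
  finally show ?case
    unfolding card_insert_disjoint[OF insert.hyps] power_Suc by (simp only: mult.assoc mult.left_commute)
qed


lemma nn_integral_PiM_reindex_unit:
  assumes "bij_betw \<tau> I I" and f: "f \<in> borel_measurable (uniform_PiM I)"
  shows "(\<integral>\<^sup>+X. f (\<lambda>i\<in>I. X (\<tau> i)) \<partial>uniform_PiM I) = (\<integral>\<^sup>+X. f X \<partial>uniform_PiM I)"
proof -
  have *: "distr (uniform_PiM I) (uniform_PiM I) (\<lambda>X. \<lambda>i\<in>I. X (\<tau> i)) = uniform_PiM I"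
    using assms(1) by (intro distr_PiM_reindex) (auto simp: prob_space_unit_lborel bij_betw_def)
  have "(\<lambda>X. \<lambda>i\<in>I. X (\<tau> i)) \<in> uniform_PiM I \<rightarrow>\<^sub>M uniform_PiM I"
    using assms(1) by (intro measurable_restrict measurable_component_singleton) (auto simp: bij_betw_def)
  from nn_integral_distr[OF this, of f] f show ?thesis by (simp add: *)
qed

text \<open>
  Taking the first index at which the maximum is attained partitions the cube exactly, so that no null
  set of ties has to be removed.
\<close>
lemma sum_first_maximum_indicator:
  fixes Y :: "nat \<Rightarrow> real"
  shows "(\<Sum>k\<in>{1..Suc n}. indicator {Y. \<forall>j\<in>{1..Suc n} - {k}. if j < k then Y j < Y k else Y j \<le> Y k} Y) = (1 :: ennreal)"
proof -
  define P where "P k \<longleftrightarrow> (\<forall>j\<in>{1..Suc n} - {k}. if j < k then Y j < Y k else Y j \<le> Y k)" for k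
  have fin: "finite (Y ` {1..Suc n})" "Y ` {1..Suc n} \<noteq> {}" by auto
  define k where "k = (LEAST k. k \<in> {1..Suc n} \<and> Y k = Max (Y ` {1..Suc n}))"
  have "Max (Y ` {1..Suc n}) \<in> Y ` {1..Suc n}" using fin by (rule Max_in)
  then have "\<exists>k. k \<in> {1..Suc n} \<and> Y k = Max (Y ` {1..Suc n})" by (metis imageE)
  then have k: "k \<in> {1..Suc n}" "Y k = Max (Y ` {1..Suc n})"
    unfolding k_def by (metis (mono_tags, lifting) LeastI_ex)+
  have le: "Y j \<le> Y k" if "j \<in> {1..Suc n}" for j using k(2) fin that by simp
  have lt: "Y j < Y k" if "j \<in> {1..Suc n}" "j < k" for j
  proof -
    have "Y j \<noteq> Y k"
    proof
      assume "Y j = Y k"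
      then have *: "j \<in> {1..Suc n} \<and> Y j = Max (Y ` {1..Suc n})" using that(1) k(2) by simp
      have "k \<le> j" unfolding k_def by (rule Least_le) (rule *)
      then show False using that(2) by simp
    qed
    then show ?thesis using le[OF that(1)] by simp
  qed
  have Pk: "P k" unfolding P_def using le lt by auto
  have uniq: "i = k" if "i \<in> {1..Suc n}" "P i" for i
  proof (rule ccontr)
    assume "i \<noteq> k"
    then consider "i < k" | "k < i" by linarith
    then show False
    proof cases
      case 1
      then have "Y k \<le> Y i" using that k(1) unfolding P_def by (auto dest!: bspec[of _ _ k])
      then show False using lt[OF that(1) 1] by simp
    next
      case 2
      then have "Y k < Y i" using that k(1) unfolding P_def by (auto dest!: bspec[of _ _ k])
      then show False using le[OF that(1)] by simp
    qed
  qed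
  have "(\<Sum>k\<in>{1..Suc n}. indicator {Y. \<forall>j\<in>{1..Suc n} - {k}. if j < k then Y j < Y k else Y j \<le> Y k} Y)
      = (\<Sum>i\<in>{1..Suc n}. if i = k then 1 else 0 :: ennreal)"
  proof (intro sum.cong refl)
    fix i assume "i \<in> {1..Suc n}"
    then have "P i = (i = k)" using uniq Pk by blast
    then show "indicator {Y. \<forall>j\<in>{1..Suc n} - {i}. if j < i then Y j < Y i else Y j \<le> Y i} Y = (if i = k then 1 else 0 :: ennreal)"
      unfolding P_def by (simp only: indicator_def mem_Collect_eq of_bool_def)
  qed
  also have "\<dots> = 1" using k(1) by simp
  finally show ?thesis .
qed

text \<open>
  Spacings are symmetric in the sample, so it does not matter which observation is the largest:
  exchanging it with the last one turns each of the \<open>n + 1\<close> pieces of the cube into the same integral,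
  in which the remaining observations range over a cube of side \<open>t\<close>.
\<close>
lemma nn_integral_spacings_Suc:
  fixes H :: "(nat \<Rightarrow> real) \<Rightarrow> ennreal"
  assumes H [measurable]: "H \<in> borel_measurable (borel_PiM {1..n + 2})"
  shows "(\<integral>\<^sup>+Y. H (spacings (Suc n) Y) \<partial>uniform_PiM {1..Suc n})
    = of_nat (Suc n) * (\<integral>\<^sup>+t. ennreal t ^ n * (\<integral>\<^sup>+X. H ((\<lambda>i\<in>{1..n + 1}. t * spacings n X i)(n + 2 := 1 - t))
          \<partial>uniform_PiM {1..n}) \<partial>unit_lborel)"
proof -
  interpret product_sigma_finite "\<lambda>_::nat. unit_lborel" by (rule product_sigma_finite_unit)
  let ?U = "\<lambda>n. uniform_PiM {1..n::nat}"
  let ?E = "\<lambda>k. {Y. \<forall>j\<in>{1..Suc n} - {k}. if j < k then Y j < Y k else Y j \<le> (Y k :: real)}"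
  let ?R = "\<integral>\<^sup>+t. ennreal t ^ n * (\<integral>\<^sup>+X. H ((\<lambda>i\<in>{1..n + 1}. t * spacings n X i)(n + 2 := 1 - t)) \<partial>?U n) \<partial>unit_lborel"
  have K [measurable]: "(\<lambda>Y. H (spacings (Suc n) Y)) \<in> borel_measurable (borel_PiM {1..Suc n})"
    using measurable_comp[OF measurable_spacings, of H "Suc n"] H by (simp add: o_def)
  have E: "(\<lambda>Y. indicator (?E k) Y :: ennreal) \<in> borel_measurable (borel_PiM {1..Suc n})"
    if "k \<in> {1..Suc n}" for k
  proof -
    have [measurable]: "(\<lambda>Y. Y k :: real) \<in> borel_measurable (borel_PiM {1..Suc n})" using that by measurable
    have "Measurable.pred (borel_PiM {1..Suc n}) (\<lambda>Y. if j < k then Y j < Y k else Y j \<le> (Y k :: real))"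
      if "j \<in> {1..Suc n} - {k}" for j
    proof -
      have [measurable]: "(\<lambda>Y. Y j :: real) \<in> borel_measurable (borel_PiM {1..Suc n})"
        by (rule measurable_component_singleton) (use that in auto)
      show ?thesis
      proof (cases "j < k")
        case True
        show ?thesis unfolding pred_def by (simp only: True if_True) (rule borel_measurable_less; measurable)
      next
        case False
        show ?thesis unfolding pred_def by (simp only: False if_False) (rule borel_measurable_le; measurable)
      qed
    qed
    then have "Measurable.pred (borel_PiM {1..Suc n}) (\<lambda>Y. Y \<in> ?E k)"
      by (simp only: mem_Collect_eq) (intro pred_intros_finite, auto)
    then show ?thesis by (simp add: pred_def borel_measurable_indicator_iff Int_def conj_commute)
  qed
  have part: "(\<integral>\<^sup>+Y. indicator (?E k) Y * H (spacings (Suc n) Y) \<partial>?U (Suc n)) = ?R" if k: "k \<in> {1..Suc n}" for k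
  proof -
    define \<tau> where "\<tau> = Transposition.transpose k (Suc n)"
    have \<tau>: "bij_betw \<tau> {1..Suc n} {1..Suc n}" using k by (auto simp: \<tau>_def bij_betw_transpose_iff)
    define A where "A t i = (if \<tau> i < k then {..<t} else {..t})" for t :: real and i
    have "(\<integral>\<^sup>+Y. indicator (?E k) Y * H (spacings (Suc n) Y) \<partial>?U (Suc n))
        = (\<integral>\<^sup>+Y. indicator (?E k) (\<lambda>i\<in>{1..Suc n}. Y (\<tau> i)) * H (spacings (Suc n) (\<lambda>i\<in>{1..Suc n}. Y (\<tau> i))) \<partial>?U (Suc n))"
      by (rule nn_integral_PiM_reindex_unit[OF \<tau>, symmetric])
         (intro measurable_PiM_unit_lborel borel_measurable_times_ennreal E k K)
    also have "\<dots> = (\<integral>\<^sup>+Y. (\<Prod>i\<in>{1..n}. indicator (A (Y (Suc n)) i) (Y i)) * H (spacings (Suc n) Y) \<partial>?U (Suc n))"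
    proof -
      have "indicator (?E k) (\<lambda>i\<in>{1..Suc n}. Y (\<tau> i)) = (\<Prod>i\<in>{1..n}. indicator (A (Y (Suc n)) i) (Y i) :: ennreal)" for Y
      proof -
        have "(\<lambda>i\<in>{1..Suc n}. Y (\<tau> i)) \<in> ?E k \<longleftrightarrow> (\<forall>i\<in>{1..n}. Y i \<in> A (Y (Suc n)) i)"
        proof -
          have img: "\<tau> ` {1..n} = {1..Suc n} - {k}"
          proof -
            have "\<tau> ` ({1..Suc n} - {Suc n}) = \<tau> ` {1..Suc n} - \<tau> ` {Suc n}"
              by (intro inj_on_image_set_diff[of \<tau> UNIV]) (auto simp: \<tau>_def)
            also have "\<tau> ` {1..Suc n} = {1..Suc n}" using \<tau> by (simp add: bij_betw_def)
            also have "\<tau> ` {Suc n} = {k}" by (simp add: \<tau>_def)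
            also have "{1..Suc n} - {Suc n} = {1..n}" by auto
            finally show ?thesis .
          qed
          have "(\<lambda>i\<in>{1..Suc n}. Y (\<tau> i)) \<in> ?E k \<longleftrightarrow> (\<forall>j\<in>\<tau> ` {1..n}. if j < k then Y (\<tau> j) < Y (\<tau> k) else Y (\<tau> j) \<le> Y (\<tau> k))"
            unfolding img using k by auto
          also have "\<dots> \<longleftrightarrow> (\<forall>i\<in>{1..n}. Y i \<in> A (Y (Suc n)) i)"
            by (auto simp: A_def \<tau>_def)
          finally show ?thesis .
        qed
        then show ?thesis by (auto simp: indicator_def prod_zero_iff)
      qed
      then show ?thesis by (simp only: spacings_symmetric[OF \<tau>])
    qed
    also have "\<dots> = (\<integral>\<^sup>+t. \<integral>\<^sup>+X. (\<Prod>i\<in>{1..n}. indicator (A ((X(Suc n := t)) (Suc n)) i) ((X(Suc n := t)) i)) *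
        H (spacings (Suc n) (X(Suc n := t))) \<partial>?U n \<partial>unit_lborel)"
    proof -
      have ins: "{1..Suc n} = insert (Suc n) {1..n}" by auto
      have "(\<lambda>Y. indicator (A (Y (Suc n)) i) (Y i) :: ennreal) \<in> borel_measurable (borel_PiM {1..Suc n})"
        if "i \<in> {1..n}" for i
      proof -
        have [measurable]: "(\<lambda>Y. Y i :: real) \<in> borel_measurable (borel_PiM {1..Suc n})" 
          "(\<lambda>Y. Y (Suc n) :: real) \<in> borel_measurable (borel_PiM {1..Suc n})"
          by (rule measurable_component_singleton, use that in auto)+
        have "(\<lambda>Y. indicator (A (Y (Suc n)) i) (Y i) :: ennreal)
           = (\<lambda>Y. if (if \<tau> i < k then Y i < Y (Suc n) else Y i \<le> (Y (Suc n))) then 1 else 0)"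
          by (auto simp: A_def indicator_def fun_eq_iff)
        also have "\<dots> \<in> borel_measurable (borel_PiM {1..Suc n})"
        proof (cases "\<tau> i < k")
          case True
          show ?thesis by (simp only: True if_True) measurable
        next
          case False
          show ?thesis by (simp only: False if_False) measurable
        qed
        finally show ?thesis .
      qed
      then have "(\<lambda>Y. (\<Prod>i\<in>{1..n}. indicator (A (Y (Suc n)) i) (Y i)) * H (spacings (Suc n) Y)) \<in> borel_measurable (?U (Suc n))"
        by (intro measurable_PiM_unit_lborel borel_measurable_times_ennreal borel_measurable_prod_ennreal K)
      then show ?thesis unfolding ins by (intro product_nn_integral_insert_rev) auto
    qed
    also have "\<dots> = ?R"
    proof (rule nn_integral_cong_AE)
      have "AE t in unit_lborel. t \<noteq> 0"
        unfolding unit_lborel_def using AE_lborel_singleton[of "0::real"]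
        by (subst AE_restrict_space_iff) (auto elim: eventually_mono)
      moreover have "AE t in unit_lborel. t \<in> {0..1}" by (rule AE_I2) (simp add: space_unit_lborel)
      ultimately show "AE t in unit_lborel. (\<integral>\<^sup>+X. (\<Prod>i\<in>{1..n}. indicator (A ((X(Suc n := t)) (Suc n)) i) ((X(Suc n := t)) i)) *
        H (spacings (Suc n) (X(Suc n := t))) \<partial>?U n)
        = ennreal t ^ n * (\<integral>\<^sup>+X. H ((\<lambda>i\<in>{1..n + 1}. t * spacings n X i)(n + 2 := 1 - t)) \<partial>?U n)"
      proof eventually_elim
        case (elim t)
        then have t: "0 < t" "t \<le> 1" by auto
        have upd: "(\<lambda>X. X(Suc n := t)) \<in> borel_PiM {1..n} \<rightarrow>\<^sub>M borel_PiM {1..Suc n}"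
          by (intro measurable_fun_upd[where J = "{1..n}"]) auto
        have "(\<integral>\<^sup>+X. (\<Prod>i\<in>{1..n}. indicator (A ((X(Suc n := t)) (Suc n)) i) ((X(Suc n := t)) i)) *
          H (spacings (Suc n) (X(Suc n := t))) \<partial>?U n)
          = (\<integral>\<^sup>+X. (\<Prod>i\<in>{1..n}. indicator (A t i) (X i)) * H (spacings (Suc n) (X(Suc n := t))) \<partial>?U n)"
          by (intro nn_integral_cong arg_cong2[where f = "(*)"] prod.cong) auto
        also have "\<dots> = ennreal t ^ card {1..n} * (\<integral>\<^sup>+X. H (spacings (Suc n) ((\<lambda>i\<in>{1..n}. t * X i)(Suc n := t))) \<partial>?U n)"
          using measurable_comp[OF upd K]
          by (intro nn_integral_cube_scale t) (auto simp: A_def o_def)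
        also have "(\<integral>\<^sup>+X. H (spacings (Suc n) ((\<lambda>i\<in>{1..n}. t * X i)(Suc n := t))) \<partial>?U n)
          = (\<integral>\<^sup>+X. H ((\<lambda>i\<in>{1..n + 1}. t * spacings n X i)(n + 2 := 1 - t)) \<partial>?U n)"
          using t by (intro nn_integral_cong arg_cong[where f = H] spacings_insert_maximum)
             (auto simp: space_PiM space_unit_lborel)
        finally show ?case unfolding card_atLeastAtMost diff_Suc_1 .
      qed
    qed
    finally show ?thesis .
  qed
  have "(\<integral>\<^sup>+Y. H (spacings (Suc n) Y) \<partial>?U (Suc n))
     = (\<integral>\<^sup>+Y. (\<Sum>k\<in>{1..Suc n}. indicator (?E k) Y) * H (spacings (Suc n) Y) \<partial>?U (Suc n))"
    by (simp only: sum_first_maximum_indicator mult_1)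
  also have "\<dots> = (\<integral>\<^sup>+Y. (\<Sum>k\<in>{1..Suc n}. indicator (?E k) Y * H (spacings (Suc n) Y)) \<partial>?U (Suc n))"
    by (simp only: sum_distrib_right)
  also have "\<dots> = (\<Sum>k\<in>{1..Suc n}. \<integral>\<^sup>+Y. indicator (?E k) Y * H (spacings (Suc n) Y) \<partial>?U (Suc n))"
    by (intro nn_integral_sum measurable_PiM_unit_lborel borel_measurable_times_ennreal E K)
  also have "\<dots> = (\<Sum>k\<in>{1..Suc n}. ?R)" by (intro sum.cong refl part)
  also have "\<dots> = of_nat (Suc n) * ?R" by simp
  finally show ?thesis .
qed

section \<open>Uniform spacings as normalized exponentials\<close>

definition std_exponential :: "real measure" where
  "std_exponential = density lborel (exponential_density 1)"

abbreviation exponential_PiM :: "'i set \<Rightarrow> ('i \<Rightarrow> real) measure" where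
  "exponential_PiM I \<equiv> Pi\<^sub>M I (\<lambda>_. std_exponential)"

lemma sets_std_exponential [measurable_cong, simp]: "sets std_exponential = sets borel"
  by (simp add: std_exponential_def)

lemma space_std_exponential [simp]: "space std_exponential = UNIV"
  by (simp add: std_exponential_def)

lemma prob_space_std_exponential: "prob_space std_exponential"
  unfolding std_exponential_def by (rule prob_space_exponential_density) simp

lemma product_sigma_finite_exponential: "product_sigma_finite (\<lambda>_. std_exponential)"
  using prob_space_std_exponential by (simp add: product_sigma_finite_def prob_space_imp_sigma_finite)

lemma nn_integral_std_exponential:
  "f \<in> borel_measurable borel \<Longrightarrow>
    (\<integral>\<^sup>+x. f x \<partial>std_exponential) = (\<integral>\<^sup>+x. ennreal (exponential_density 1 x) * f x \<partial>lborel)"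
  unfolding std_exponential_def by (subst nn_integral_density) auto

lemma measurable_PiM_exponential_iff:
  "f \<in> exponential_PiM I \<rightarrow>\<^sub>M N \<longleftrightarrow> f \<in> borel_PiM I \<rightarrow>\<^sub>M N"
proof -
  have "sets (exponential_PiM I) = sets (borel_PiM I)"
    by (intro sets_PiM_cong) auto
  from measurable_cong_sets[OF this refl] show ?thesis by (rule arg_cong[where f = "\<lambda>A. f \<in> A"])
qed

text \<open>
  The substitution \<open>s = r t\<close>, \<open>y = r (1 - t)\<close>, with Jacobian \<open>r\<close>: the total \<open>r\<close> of an Erlang and an
  independent exponential variable is again Erlang, and independent of the proportion \<open>t\<close>.
\<close>
lemma nn_integral_exponential_erlang_convolution:
  fixes \<Psi> :: "real \<Rightarrow> real \<Rightarrow> ennreal"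
  assumes \<Psi> [measurable]: "(\<lambda>(s, y). \<Psi> s y) \<in> borel_measurable (borel \<Otimes>\<^sub>M borel)"
  shows "(\<integral>\<^sup>+y. ennreal (exponential_density 1 y) * (\<integral>\<^sup>+s. ennreal (erlang_density n 1 s) * \<Psi> s y \<partial>lborel) \<partial>lborel)
    = (\<integral>\<^sup>+r. ennreal (erlang_density (Suc n) 1 r) *
         (of_nat (Suc n) * (\<integral>\<^sup>+t. ennreal t ^ n * \<Psi> (r * t) (r * (1 - t)) \<partial>unit_lborel)) \<partial>lborel)"
proof -
  let ?e = "\<lambda>x. ennreal (exponential_density 1 x)" and ?g = "\<lambda>x. ennreal (erlang_density n 1 x)"
  have [measurable]: "exponential_density 1 \<in> borel_measurable borel"
    by (rule borel_measurable_erlang_density)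
  have "(\<integral>\<^sup>+y. ?e y * (\<integral>\<^sup>+s. ?g s * \<Psi> s y \<partial>lborel) \<partial>lborel) = (\<integral>\<^sup>+y. (\<integral>\<^sup>+s. ?g s * (?e y * \<Psi> s y) \<partial>lborel) \<partial>lborel)"
    by (subst nn_integral_cmult[symmetric]) (auto simp: ac_simps)
  also have "\<dots> = (\<integral>\<^sup>+s. (\<integral>\<^sup>+y. ?g s * (?e y * \<Psi> s y) \<partial>lborel) \<partial>lborel)"
    by (rule lborel_pair.Fubini') measurable
  also have "\<dots> = (\<integral>\<^sup>+s. (\<integral>\<^sup>+r. ?g s * (?e (r - s) * \<Psi> s (r - s)) \<partial>lborel) \<partial>lborel)"
  proof (rule nn_integral_cong)
    fix s :: real
    show "(\<integral>\<^sup>+y. ?g s * (?e y * \<Psi> s y) \<partial>lborel) = (\<integral>\<^sup>+r. ?g s * (?e (r - s) * \<Psi> s (r - s)) \<partial>lborel)"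
      by (subst nn_integral_real_affine[where c = 1 and t = "-s"]) (auto simp: algebra_simps)
  qed
  also have "\<dots> = (\<integral>\<^sup>+r. (\<integral>\<^sup>+s. ?g s * (?e (r - s) * \<Psi> s (r - s)) \<partial>lborel) \<partial>lborel)"
    by (rule lborel_pair.Fubini') measurable
  also have "\<dots> = (\<integral>\<^sup>+r. ennreal (erlang_density (Suc n) 1 r) *
         (of_nat (Suc n) * (\<integral>\<^sup>+t. ennreal t ^ n * \<Psi> (r * t) (r * (1 - t)) \<partial>unit_lborel)) \<partial>lborel)"
  proof (rule nn_integral_cong_AE)
    have "AE r in lborel. r \<noteq> (0::real)" by (rule AE_lborel_singleton)
    then show "AE r in lborel. (\<integral>\<^sup>+s. ?g s * (?e (r - s) * \<Psi> s (r - s)) \<partial>lborel)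
       = ennreal (erlang_density (Suc n) 1 r) *
         (of_nat (Suc n) * (\<integral>\<^sup>+t. ennreal t ^ n * \<Psi> (r * t) (r * (1 - t)) \<partial>unit_lborel))"
    proof eventually_elim
      case (elim r)
      show ?case
      proof (cases "r < 0")
        case True
        have "(\<integral>\<^sup>+s. ?g s * (?e (r - s) * \<Psi> s (r - s)) \<partial>lborel) = (\<integral>\<^sup>+s. 0 \<partial>(lborel :: real measure))"
          using True by (intro nn_integral_cong) (auto simp: erlang_density_def)
        then show ?thesis using True by (simp add: erlang_density_def)
      next
        case False
        then have r: "0 < r" using elim by simp
        have "(\<integral>\<^sup>+s. ?g s * (?e (r - s) * \<Psi> s (r - s)) \<partial>lborel)
           = ennreal r * (\<integral>\<^sup>+t. ?g (r * t) * (?e (r - r * t) * \<Psi> (r * t) (r - r * t)) \<partial>lborel)"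
          using r by (subst nn_integral_real_affine[where c = r and t = 0]) auto
        also have "\<dots> = (\<integral>\<^sup>+t. ennreal r * (?g (r * t) * (?e (r - r * t) * \<Psi> (r * t) (r - r * t))) \<partial>lborel)"
          by (rule nn_integral_cmult[symmetric]) measurable
        also have "\<dots> = (\<integral>\<^sup>+t. (ennreal (erlang_density (Suc n) 1 r) * of_nat (Suc n)) *
             (ennreal t ^ n * \<Psi> (r * t) (r * (1 - t)) * indicator {0..1} t) \<partial>lborel)"
        proof (rule nn_integral_cong)
          fix t :: real
          show "ennreal r * (?g (r * t) * (?e (r - r * t) * \<Psi> (r * t) (r - r * t)))
             = (ennreal (erlang_density (Suc n) 1 r) * of_nat (Suc n)) *
             (ennreal t ^ n * \<Psi> (r * t) (r * (1 - t)) * indicator {0..1} t)"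
          proof (cases "t \<in> {0..1}")
            case True
            have nn: "0 \<le> r * t" "0 \<le> r - r * t" using r True by (auto simp: mult_left_le)
            have "r * (erlang_density n 1 (r * t) * exponential_density 1 (r - r * t))
                = r * ((r * t) ^ n * (exp (- (r * t)) * exp (- (r - r * t))) / fact n)"
              using nn by (simp add: erlang_density_def)
            also have "exp (- (r * t)) * exp (- (r - r * t)) = exp (- r)"
              by (simp add: exp_add[symmetric])
            also have "r * ((r * t) ^ n * exp (- r) / fact n) = erlang_density (Suc n) 1 r * real (Suc n) * t ^ n"
              using r by (simp add: erlang_density_def power_mult_distrib del: of_nat_Suc)
            finally have "ennreal (r * (erlang_density n 1 (r * t) * exponential_density 1 (r - r * t)))
              = ennreal (erlang_density (Suc n) 1 r * real (Suc n) * t ^ n)" by (rule arg_cong)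
            then have "ennreal r * (?g (r * t) * ?e (r - r * t))
                = ennreal (erlang_density (Suc n) 1 r) * of_nat (Suc n) * ennreal t ^ n"
              using r True by (simp add: ennreal_mult' ennreal_power ennreal_of_nat_eq_real_of_nat del: of_nat_Suc)
            then have "ennreal r * (?g (r * t) * ?e (r - r * t)) * \<Psi> (r * t) (r - r * t)
                = ennreal (erlang_density (Suc n) 1 r) * of_nat (Suc n) * ennreal t ^ n * \<Psi> (r * t) (r - r * t)"
              by (rule arg_cong)
            then show ?thesis using True by (simp add: right_diff_distrib mult.assoc)
          next
            case False
            then have "r * t < 0 \<or> r - r * t < 0"
              using r by (auto simp: mult_less_0_iff)
            then show ?thesis using False by (auto simp: erlang_density_def)
          qed
        qed
        also have "\<dots> = (ennreal (erlang_density (Suc n) 1 r) * of_nat (Suc n)) *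
             (\<integral>\<^sup>+t. (ennreal t ^ n * \<Psi> (r * t) (r * (1 - t)) * indicator {0..1} t) \<partial>lborel)"
          by (rule nn_integral_cmult) measurable
        also have "(\<integral>\<^sup>+t. (ennreal t ^ n * \<Psi> (r * t) (r * (1 - t)) * indicator {0..1} t) \<partial>lborel)
            = (\<integral>\<^sup>+t. ennreal t ^ n * \<Psi> (r * t) (r * (1 - t)) \<partial>unit_lborel)"
          by (rule nn_integral_unit_lborel[symmetric]) measurable
        finally show ?thesis by (simp only: mult.assoc)
      qed
    qed
  qed
  finally show ?thesis .
qed

text \<open>
  A vector of \<open>n + 1\<close> independent exponentials is a vector of uniform spacings multiplied by an
  independent Erlang variable. Only the normalized vector matters later, but the induction has to keep
  track of the total: removing the largest observation on the one side corresponds to removing the last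
  exponential on the other.
\<close>
lemma nn_integral_exponential_spacings:
  fixes G :: "(nat \<Rightarrow> real) \<Rightarrow> ennreal"
  assumes "G \<in> borel_measurable (borel_PiM {1..n + 1})"
  shows "(\<integral>\<^sup>+x. G x \<partial>exponential_PiM {1..n + 1})
    = (\<integral>\<^sup>+s. ennreal (erlang_density n 1 s) *
         (\<integral>\<^sup>+X. G (\<lambda>i\<in>{1..n + 1}. s * spacings n X i) \<partial>uniform_PiM {1..n}) \<partial>lborel)"
  using assms
proof (induction n arbitrary: G)
  case 0
  interpret product_sigma_finite "\<lambda>_::nat. std_exponential" by (rule product_sigma_finite_exponential)
  interpret U: product_sigma_finite "\<lambda>_::nat. unit_lborel" by (rule product_sigma_finite_unit)
  have e: "{1..0 + 1} = {1::nat}" by auto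
  have Gm: "G \<in> borel_measurable (borel_PiM {1})" using 0 by (simp only: e)
  have cm: "(\<lambda>s. \<lambda>i\<in>{1::nat}. s) \<in> borel \<rightarrow>\<^sub>M Pi\<^sub>M {1} (\<lambda>_. borel :: real measure)"
    by (intro measurable_restrict) simp
  have Gs [measurable]: "(\<lambda>s. G (\<lambda>i\<in>{1}. s)) \<in> borel_measurable borel"
    using measurable_comp[OF cm Gm] by (simp add: o_def)
  have "(\<integral>\<^sup>+x. G x \<partial>exponential_PiM {1..0 + 1}) = (\<integral>\<^sup>+x. G (\<lambda>i\<in>{1}. x (1::nat)) \<partial>exponential_PiM {1})"
    unfolding e
  proof (rule nn_integral_cong)
    fix x assume "x \<in> space (exponential_PiM {1::nat})"
    then have "x = (\<lambda>i\<in>{1}. x 1)" by (auto simp: space_PiM PiE_iff extensional_def fun_eq_iff)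
    then show "G x = G (\<lambda>i\<in>{1}. x 1)" by (rule arg_cong)
  qed
  also have "\<dots> = (\<integral>\<^sup>+s. G (\<lambda>i\<in>{1}. s) \<partial>std_exponential)"
  proof (rule product_nn_integral_singleton)
    show "(\<lambda>s. G (\<lambda>i\<in>{1}. s)) \<in> borel_measurable std_exponential"
      using Gs measurable_cong_sets[OF sets_std_exponential refl, of borel] by blast
  qed
  also have "\<dots> = (\<integral>\<^sup>+s. ennreal (exponential_density 1 s) * G (\<lambda>i\<in>{1}. s) \<partial>lborel)"
    by (rule nn_integral_std_exponential) measurable
  also have "\<dots> = (\<integral>\<^sup>+s. ennreal (erlang_density 0 1 s) *
         (\<integral>\<^sup>+X. G (\<lambda>i\<in>{1..0 + 1}. s * spacings 0 X i) \<partial>uniform_PiM {1..0}) \<partial>lborel)"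
  proof (intro nn_integral_cong arg_cong2[where f = "(*)"] refl)
    fix s :: real
    have "(\<lambda>i\<in>{1..0 + 1}. s * spacings 0 X i) = (\<lambda>i\<in>{1}. s)" for X
      by (auto simp: spacings_def order_stat_def fun_eq_iff)
    then show "G (\<lambda>i\<in>{1}. s) = (\<integral>\<^sup>+X. G (\<lambda>i\<in>{1..0 + 1}. s * spacings 0 X i) \<partial>uniform_PiM {1..0})"
      by (simp add: PiM_empty nn_integral_count_space_finite)
  qed
  finally show ?case .
next
  case (Suc n)
  interpret product_sigma_finite "\<lambda>_::nat. std_exponential" by (rule product_sigma_finite_exponential)
  interpret U: product_sigma_finite "\<lambda>_::nat. unit_lborel" by (rule product_sigma_finite_unit)
  let ?U = "\<lambda>n. uniform_PiM {1..n::nat}"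
  have ins: "{1..Suc n + 1} = insert (n + 2) {1..n + 1}" by auto
  have Gm: "G \<in> borel_measurable (borel_PiM (insert (n + 2) {1..n + 1}))"
    using Suc.prems unfolding ins .
  have upd: "(\<lambda>(X, y). X(n + 2 := y)) \<in> borel_PiM {1..n + 1} \<Otimes>\<^sub>M borel
      \<rightarrow>\<^sub>M Pi\<^sub>M (insert (n + 2) {1..n + 1}) (\<lambda>_. borel :: real measure)"
    by (rule measurable_add_dim)
  have Gupd: "(\<lambda>x. G (x(n + 2 := y))) \<in> borel_measurable (borel_PiM {1..n + 1})" for y
  proof -
    have "(\<lambda>x. x(n + 2 := y)) \<in> borel_PiM {1..n + 1} \<rightarrow>\<^sub>M borel_PiM (insert (n + 2) {1..n + 1})"
      by (intro measurable_fun_upd[where J = "{1..n + 1}"]) auto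
    from measurable_comp[OF this Gm] show ?thesis by (simp add: o_def)
  qed
  define \<Psi> where "\<Psi> s y = (\<integral>\<^sup>+X. G ((\<lambda>i\<in>{1..n + 1}. s * spacings n X i)(n + 2 := y)) \<partial>?U n)" for s y
  have sp [measurable]: "(\<lambda>X. spacings n X i) \<in> borel_measurable (?U n)" if "i \<in> {1..n + 1}" for i
    by (rule measurable_compose[OF measurable_spacings_unit measurable_component_singleton[OF that]])
  have \<Psi>m: "(\<lambda>(s, y). \<Psi> s y) \<in> borel_measurable (borel \<Otimes>\<^sub>M borel)"
  proof -
    have "(\<lambda>p. \<lambda>i\<in>{1..n + 1}. fst (fst p) * spacings n (snd p) i)
        \<in> (borel \<Otimes>\<^sub>M borel) \<Otimes>\<^sub>M ?U n \<rightarrow>\<^sub>M borel_PiM {1..n + 1}"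
      by (intro measurable_restrict borel_measurable_times measurable_compose[OF measurable_snd sp]) measurable
    then have "(\<lambda>p. ((\<lambda>i\<in>{1..n + 1}. fst (fst p) * spacings n (snd p) i), snd (fst p)))
        \<in> (borel \<Otimes>\<^sub>M borel) \<Otimes>\<^sub>M ?U n \<rightarrow>\<^sub>M borel_PiM {1..n + 1} \<Otimes>\<^sub>M borel"
      by (intro measurable_Pair) measurable
    from measurable_comp[OF measurable_comp[OF this upd] Gm]
    have "(\<lambda>(p, X). G ((\<lambda>i\<in>{1..n + 1}. fst p * spacings n X i)(n + 2 := snd p)))
        \<in> borel_measurable ((borel \<Otimes>\<^sub>M borel) \<Otimes>\<^sub>M ?U n)"
      by (simp add: o_def split_beta')
    then have "(\<lambda>p. \<Psi> (fst p) (snd p)) \<in> borel_measurable (borel \<Otimes>\<^sub>M borel)"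
      unfolding \<Psi>_def by (intro sigma_finite_measure.borel_measurable_nn_integral U.sigma_finite) auto
    then show ?thesis by (simp add: split_beta')
  qed
  have "(\<integral>\<^sup>+x. G x \<partial>exponential_PiM {1..Suc n + 1})
      = (\<integral>\<^sup>+y. \<integral>\<^sup>+x. G (x(n + 2 := y)) \<partial>exponential_PiM {1..n + 1} \<partial>std_exponential)"
    unfolding ins using Gm by (intro product_nn_integral_insert_rev) (auto simp: measurable_PiM_exponential_iff)
  also have "\<dots> = (\<integral>\<^sup>+y. (\<integral>\<^sup>+s. ennreal (erlang_density n 1 s) * \<Psi> s y \<partial>lborel) \<partial>std_exponential)"
    unfolding \<Psi>_def by (intro nn_integral_cong Suc.IH Gupd)
  also have "\<dots> = (\<integral>\<^sup>+y. ennreal (exponential_density 1 y) * (\<integral>\<^sup>+s. ennreal (erlang_density n 1 s) * \<Psi> s y \<partial>lborel) \<partial>lborel)"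
  proof (rule nn_integral_std_exponential)
    have "(\<lambda>(y, s). ennreal (erlang_density n 1 s) * \<Psi> s y) \<in> borel_measurable (borel \<Otimes>\<^sub>M lborel)"
      using measurable_comp[OF measurable_pair_swap' \<Psi>m] by (simp add: o_def split_beta')
    then show "(\<lambda>y. \<integral>\<^sup>+s. ennreal (erlang_density n 1 s) * \<Psi> s y \<partial>lborel) \<in> borel_measurable borel"
      by (intro sigma_finite_measure.borel_measurable_nn_integral[OF sigma_finite_lborel]) 
  qed
  also have "\<dots> = (\<integral>\<^sup>+r. ennreal (erlang_density (Suc n) 1 r) *
         (of_nat (Suc n) * (\<integral>\<^sup>+t. ennreal t ^ n * \<Psi> (r * t) (r * (1 - t)) \<partial>unit_lborel)) \<partial>lborel)"
    by (rule nn_integral_exponential_erlang_convolution[OF \<Psi>m])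
  also have "\<dots> = (\<integral>\<^sup>+r. ennreal (erlang_density (Suc n) 1 r) *
         (\<integral>\<^sup>+X. G (\<lambda>i\<in>{1..Suc n + 1}. r * spacings (Suc n) X i) \<partial>?U (Suc n)) \<partial>lborel)"
  proof (intro nn_integral_cong arg_cong2[where f = "(*)"] refl)
    fix r :: real
    have "(\<lambda>d. \<lambda>i\<in>{1..n + 2}. r * d i) \<in> borel_PiM {1..n + 2} \<rightarrow>\<^sub>M borel_PiM {1..n + 2}"
      by measurable
    then have Gr: "(\<lambda>d. G (\<lambda>i\<in>{1..n + 2}. r * d i)) \<in> borel_measurable (borel_PiM {1..n + 2})"
      using measurable_comp[of _ _ _ G borel] Suc.prems by (simp add: o_def)
    have "(\<lambda>i\<in>{1..n + 1}. (r * t) * spacings n X i)(n + 2 := r * (1 - t))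
        = (\<lambda>i\<in>{1..n + 2}. r * ((\<lambda>i\<in>{1..n + 1}. t * spacings n X i)(n + 2 := 1 - t)) i)" for t X
      by (auto simp: fun_eq_iff)
    then have "\<Psi> (r * t) (r * (1 - t)) = (\<integral>\<^sup>+X. G (\<lambda>i\<in>{1..n + 2}. r * ((\<lambda>i\<in>{1..n + 1}. t * spacings n X i)(n + 2 := 1 - t)) i) \<partial>?U n)" for t
      by (simp only: \<Psi>_def)
    then show "of_nat (Suc n) * (\<integral>\<^sup>+t. ennreal t ^ n * \<Psi> (r * t) (r * (1 - t)) \<partial>unit_lborel)
      = (\<integral>\<^sup>+X. G (\<lambda>i\<in>{1..Suc n + 1}. r * spacings (Suc n) X i) \<partial>?U (Suc n))"
      using nn_integral_spacings_Suc[OF Gr] by (simp only: add_Suc Suc_eq_plus1 add.assoc one_add_one)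
  qed
  finally show ?case .
qed

definition normalize_sum :: "nat \<Rightarrow> (nat \<Rightarrow> real) \<Rightarrow> nat \<Rightarrow> real" where
  "normalize_sum n x = (\<lambda>i\<in>{1..n + 1}. x i / (\<Sum>j\<in>{1..n + 1}. x j))"

lemma measurable_normalize_sum:
  "normalize_sum n \<in> borel_PiM {1..n + 1} \<rightarrow>\<^sub>M borel_PiM {1..n + 1}"
  unfolding normalize_sum_def
  by (intro measurable_restrict borel_measurable_divide borel_measurable_sum measurable_component_singleton)

lemma nn_integral_spacings_normalize:
  fixes F :: "(nat \<Rightarrow> real) \<Rightarrow> ennreal"
  assumes F: "F \<in> borel_measurable (borel_PiM {1..n + 1})"
  shows "(\<integral>\<^sup>+x. F (normalize_sum n x) \<partial>exponential_PiM {1..n + 1})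
    = (\<integral>\<^sup>+X. F (spacings n X) \<partial>uniform_PiM {1..n})"
proof -
  let ?c = "\<integral>\<^sup>+X. F (spacings n X) \<partial>uniform_PiM {1..n}"
  have "(\<lambda>x. F (normalize_sum n x)) \<in> borel_measurable (borel_PiM {1..n + 1})"
    using measurable_comp[OF measurable_normalize_sum F] by (simp add: o_def)
  from nn_integral_exponential_spacings[OF this]
  have "(\<integral>\<^sup>+x. F (normalize_sum n x) \<partial>exponential_PiM {1..n + 1})
    = (\<integral>\<^sup>+s. ennreal (erlang_density n 1 s) *
         (\<integral>\<^sup>+X. F (normalize_sum n (\<lambda>i\<in>{1..n + 1}. s * spacings n X i)) \<partial>uniform_PiM {1..n}) \<partial>lborel)" .
  also have "\<dots> = (\<integral>\<^sup>+s. ennreal (erlang_density n 1 s) * ?c \<partial>lborel)"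
  proof (rule nn_integral_cong_AE)
    have "AE s in lborel. s \<noteq> (0::real)" by (rule AE_lborel_singleton)
    then show "AE s in lborel. ennreal (erlang_density n 1 s) *
         (\<integral>\<^sup>+X. F (normalize_sum n (\<lambda>i\<in>{1..n + 1}. s * spacings n X i)) \<partial>uniform_PiM {1..n})
         = ennreal (erlang_density n 1 s) * ?c"
    proof eventually_elim
      case (elim s)
      have "normalize_sum n (\<lambda>i\<in>{1..n + 1}. s * spacings n X i) = spacings n X" for X
      proof -
        have "(\<Sum>j\<in>{1..n + 1}. (\<lambda>i\<in>{1..n + 1}. s * spacings n X i) j) = s * (\<Sum>j\<in>{1..n + 1}. spacings n X j)"
          unfolding sum_distrib_left by (intro sum.cong) auto
        also have "\<dots> = s" by (simp only: sum_all_spacings mult_1_right)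
        finally show ?thesis using elim
          unfolding normalize_sum_def by (auto simp: fun_eq_iff spacings_def)
      qed
      then show ?case by (simp only:)
    qed
  qed
  also have "\<dots> = (\<integral>\<^sup>+s. ennreal (erlang_density n 1 s) \<partial>lborel) * ?c"
    by (rule nn_integral_multc) measurable
  also have "(\<integral>\<^sup>+s. ennreal (erlang_density n 1 s) \<partial>lborel) = 1"
    using nn_integral_erlang_ith_moment[of 1 n 0] by simp
  finally show ?thesis by simp
qed

lemma distr_spacings_eq_distr_normalize:
  "distr (uniform_PiM {1..n}) (borel_PiM {1..n + 1}) (spacings n)
   = distr (exponential_PiM {1..n + 1}) (borel_PiM {1..n + 1}) (normalize_sum n)"
  (is "?A = ?B")
proof (rule measure_eqI)
  fix S assume S: "S \<in> sets ?A"
  then have S': "S \<in> sets (borel_PiM {1..n + 1})" by simp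
  have nm: "normalize_sum n \<in> exponential_PiM {1..n + 1} \<rightarrow>\<^sub>M borel_PiM {1..n + 1}"
    using measurable_normalize_sum by (simp only: measurable_PiM_exponential_iff)
  have "emeasure ?A S = (\<integral>\<^sup>+d. indicator S d \<partial>?A)" using S by simp
  also have "\<dots> = (\<integral>\<^sup>+X. indicator S (spacings n X) \<partial>uniform_PiM {1..n})"
    using S' by (intro nn_integral_distr measurable_spacings_unit) simp
  also have "\<dots> = (\<integral>\<^sup>+x. indicator S (normalize_sum n x) \<partial>exponential_PiM {1..n + 1})"
    using S' by (intro nn_integral_spacings_normalize[symmetric]) simp
  also have "\<dots> = (\<integral>\<^sup>+d. indicator S d \<partial>?B)"
    using S' by (intro nn_integral_distr[symmetric] nm) simp
  also have "\<dots> = emeasure ?B S" using S' by simp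
  finally show "emeasure ?A S = emeasure ?B S" .
qed simp

section \<open>Moments of exponential variables\<close>

lemma has_bochner_integral_erlang_moment:
  assumes l: "0 < l"
  shows "has_bochner_integral lborel (\<lambda>x. erlang_density k l x * x ^ i) (fact (k + i) / (fact k * l ^ i))"
proof (rule has_bochner_integral_nn_integral)
  show "AE x in lborel. 0 \<le> erlang_density k l x * x ^ i"
    using l by (intro AE_I2) (auto simp: erlang_density_def)
  show "(\<integral>\<^sup>+x. ennreal (erlang_density k l x * x ^ i) \<partial>lborel) = ennreal (fact (k + i) / (fact k * l ^ i))"
    by (rule nn_integral_erlang_ith_moment[OF l])
qed (use l in auto)

lemma integrable_std_exponential_power: "integrable std_exponential (\<lambda>x. x ^ k)"
  and integral_std_exponential_power: "(\<integral>x. x ^ k \<partial>std_exponential) = fact k"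
proof -
  have "has_bochner_integral lborel (\<lambda>x. erlang_density 0 1 x * x ^ k) (fact (0 + k) / (fact 0 * 1 ^ k))"
    by (rule has_bochner_integral_erlang_moment) simp
  then have *: "has_bochner_integral lborel (\<lambda>x. exponential_density 1 x *\<^sub>R x ^ k) (fact k)" by simp
  have "has_bochner_integral std_exponential (\<lambda>x. x ^ k) (fact k)"
    unfolding std_exponential_def
    by (rule has_bochner_integral_density[OF _ _ _ *]) (auto intro: borel_measurable_erlang_density)
  then show "integrable std_exponential (\<lambda>x. x ^ k)" "(\<integral>x. x ^ k \<partial>std_exponential) = fact k"
    by (auto simp: has_bochner_integral_iff)
qed

lemma std_exponential_centered:
  "integrable std_exponential (\<lambda>x. x - 1)" "(\<integral>x. x - 1 \<partial>std_exponential) = 0"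
  "integrable std_exponential (\<lambda>x. (x - 1)\<^sup>2)" "(\<integral>x. (x - 1)\<^sup>2 \<partial>std_exponential) = 1"
proof -
  interpret prob_space std_exponential by (rule prob_space_std_exponential)
  have i1: "integrable std_exponential (\<lambda>x. x)" and v1: "(\<integral>x. x \<partial>std_exponential) = 1"
    using integrable_std_exponential_power[of 1] integral_std_exponential_power[of 1] by auto
  note i2 = integrable_std_exponential_power[of 2] and v2 = integral_std_exponential_power[of 2]
  have e: "(x - 1)\<^sup>2 = x\<^sup>2 - 2 * x + 1" for x :: real by (simp add: power2_eq_square algebra_simps)
  show "integrable std_exponential (\<lambda>x. x - 1)" "(\<integral>x. x - 1 \<partial>std_exponential) = 0"
    using i1 v1 by (simp_all add: prob_space[unfolded space_std_exponential])
  show "integrable std_exponential (\<lambda>x. (x - 1)\<^sup>2)" "(\<integral>x. (x - 1)\<^sup>2 \<partial>std_exponential) = 1"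
    unfolding e using i1 v1 i2 v2 by (simp_all add: prob_space[unfolded space_std_exponential] fact_2)
qed

lemma integral_exp_std_exponential:
  assumes "-1 < c"
  shows "integrable std_exponential (\<lambda>x. exp (- c * x))"
    and "(\<integral>x. exp (- c * x) \<partial>std_exponential) = 1 / (1 + c)"
proof -
  have "has_bochner_integral lborel (\<lambda>x. erlang_density 0 (1 + c) x * x ^ 0) (fact (0 + 0) / (fact 0 * (1 + c) ^ 0))"
    by (rule has_bochner_integral_erlang_moment) (use assms in simp)
  then have "has_bochner_integral lborel (\<lambda>x. (1 / (1 + c)) * erlang_density 0 (1 + c) x) ((1 / (1 + c)) * 1)"
    by (intro has_bochner_integral_mult_right) simp
  also have "(\<lambda>x. (1 / (1 + c)) * erlang_density 0 (1 + c) x) = (\<lambda>x. exponential_density 1 x *\<^sub>R exp (- c * x))"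
    using assms by (auto simp: fun_eq_iff erlang_density_def exp_add[symmetric] algebra_simps divide_eq_eq)
  finally have "has_bochner_integral std_exponential (\<lambda>x. exp (- c * x)) (1 / (1 + c))"
    unfolding std_exponential_def
    by (intro has_bochner_integral_density) (auto intro: borel_measurable_erlang_density)
  then show "integrable std_exponential (\<lambda>x. exp (- c * x))"
    "(\<integral>x. exp (- c * x) \<partial>std_exponential) = 1 / (1 + c)"
    by (auto simp: has_bochner_integral_iff)
qed

lemma second_moment_sum_centered:
  fixes f :: "'a \<Rightarrow> real" and c :: "'i \<Rightarrow> real"
  assumes N: "prob_space N" and I: "finite I"
    and f: "integrable N f" "(\<integral>x. f x \<partial>N) = 0" "integrable N (\<lambda>x. (f x)\<^sup>2)" "(\<integral>x. (f x)\<^sup>2 \<partial>N) = 1"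
  shows "integrable (Pi\<^sub>M I (\<lambda>_. N)) (\<lambda>x. (\<Sum>j\<in>I. c j * f (x j))\<^sup>2)"
    and "(\<integral>x. (\<Sum>j\<in>I. c j * f (x j))\<^sup>2 \<partial>Pi\<^sub>M I (\<lambda>_. N)) = (\<Sum>j\<in>I. (c j)\<^sup>2)"
proof -
  interpret prob_space N by (rule N)
  interpret product_sigma_finite "\<lambda>_. N"
    by (simp add: product_sigma_finite_def sigma_finite_measure_axioms)
  have cross: "integrable (Pi\<^sub>M I (\<lambda>_. N)) (\<lambda>x. f (x i) * f (x j)) \<and>
      (\<integral>x. f (x i) * f (x j) \<partial>Pi\<^sub>M I (\<lambda>_. N)) = (if i = j then 1 else 0)" if "i \<in> I" "j \<in> I" for i j
  proof -
    define F where "F = (\<lambda>k y. (if k = i then f y else 1) * (if k = j then f y else 1))"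
    have F: "integrable N (F k)" "(\<integral>y. F k y \<partial>N) = (if k = i \<longleftrightarrow> k = j then 1 else 0)" for k
      using f by (cases "k = i"; cases "k = j"; simp add: F_def power2_eq_square prob_space)+
    have p: "(\<Prod>k\<in>I. F k (x k)) = f (x i) * f (x j)" for x
      unfolding F_def prod.distrib using I that by simp
    have "integrable (Pi\<^sub>M I (\<lambda>_. N)) (\<lambda>x. \<Prod>k\<in>I. F k (x k))"
      using I F by (intro product_integrable_prod) auto
    moreover have "(\<integral>x. (\<Prod>k\<in>I. F k (x k)) \<partial>Pi\<^sub>M I (\<lambda>_. N)) = (\<Prod>k\<in>I. \<integral>y. F k y \<partial>N)"
      using I F by (intro product_integral_prod) auto
    moreover have "(\<Prod>k\<in>I. \<integral>y. F k y \<partial>N) = (if i = j then 1 else 0)"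
    proof (cases "i = j")
      case False
      then have "(\<integral>y. F i y \<partial>N) = 0" by (simp add: F(2))
      then have "(\<Prod>k\<in>I. \<integral>y. F k y \<partial>N) = 0" using I that(1) by (intro prod_zero) auto
      then show ?thesis using False by simp
    qed (simp add: F(2))
    ultimately show ?thesis by (simp only: p)
  qed
  have sq: "(\<Sum>j\<in>I. c j * f (x j))\<^sup>2 = (\<Sum>i\<in>I. \<Sum>j\<in>I. (c i * c j) * (f (x i) * f (x j)))" for x
    unfolding power2_eq_square sum_product by (intro sum.cong refl) (simp add: ac_simps)
  show "integrable (Pi\<^sub>M I (\<lambda>_. N)) (\<lambda>x. (\<Sum>j\<in>I. c j * f (x j))\<^sup>2)"
    unfolding sq using cross by (intro Bochner_Integration.integrable_sum integrable_mult_right) auto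
  have "(\<integral>x. (\<Sum>j\<in>I. c j * f (x j))\<^sup>2 \<partial>Pi\<^sub>M I (\<lambda>_. N)) = (\<Sum>i\<in>I. \<Sum>j\<in>I. (c i * c j) * (if i = j then 1 else 0))"
  proof -
    have i: "integrable (Pi\<^sub>M I (\<lambda>_. N)) (\<lambda>x. (c i * c j) * (f (x i) * f (x j)))" if "i \<in> I" "j \<in> I" for i j
      using cross[OF that] by (intro integrable_mult_right) simp
    have "(\<integral>x. (\<Sum>i\<in>I. \<Sum>j\<in>I. (c i * c j) * (f (x i) * f (x j))) \<partial>Pi\<^sub>M I (\<lambda>_. N))
        = (\<Sum>i\<in>I. \<integral>x. (\<Sum>j\<in>I. (c i * c j) * (f (x i) * f (x j))) \<partial>Pi\<^sub>M I (\<lambda>_. N))"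
      by (rule Bochner_Integration.integral_sum) (intro Bochner_Integration.integrable_sum i)
    also have "\<dots> = (\<Sum>i\<in>I. \<Sum>j\<in>I. \<integral>x. (c i * c j) * (f (x i) * f (x j)) \<partial>Pi\<^sub>M I (\<lambda>_. N))"
      by (intro sum.cong refl Bochner_Integration.integral_sum i)
    also have "\<dots> = (\<Sum>i\<in>I. \<Sum>j\<in>I. (c i * c j) * (if i = j then 1 else 0))"
      using cross by (intro sum.cong refl) simp
    finally show ?thesis by (simp only: sq)
  qed
  also have "\<dots> = (\<Sum>j\<in>I. (c j)\<^sup>2)"
    using I by (simp add: power2_eq_square if_distrib cong: if_cong)
  finally show "(\<integral>x. (\<Sum>j\<in>I. c j * f (x j))\<^sup>2 \<partial>Pi\<^sub>M I (\<lambda>_. N)) = (\<Sum>j\<in>I. (c j)\<^sup>2)" .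
qed

lemma (in prob_space) integral_abs_le_of_square:
  fixes f :: "'a \<Rightarrow> real"
  assumes f: "f \<in> borel_measurable M" "integrable M (\<lambda>x. (f x)\<^sup>2)" and \<delta>: "(\<integral>x. (f x)\<^sup>2 \<partial>M) \<le> \<delta>\<^sup>2" "0 < \<delta>"
  shows "integrable M f" "(\<integral>x. \<bar>f x\<bar> \<partial>M) \<le> \<delta>"
proof -
  have bd: "\<bar>y\<bar> \<le> (y\<^sup>2 / \<delta> + \<delta>) / 2" for y :: real
  proof -
    have "0 \<le> (\<bar>y\<bar> - \<delta>)\<^sup>2 / \<delta>" using \<delta> by simp
    also have "\<dots> = y\<^sup>2 / \<delta> + \<delta> - 2 * \<bar>y\<bar>" using \<delta> by (simp add: power2_eq_square field_simps)
    finally show ?thesis by simp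
  qed
  have i: "integrable M (\<lambda>x. ((f x)\<^sup>2 / \<delta> + \<delta>) / 2)" using f by simp
  show fi: "integrable M f"
    using i by (rule Bochner_Integration.integrable_bound) (use f bd \<delta> in \<open>auto intro: order_trans[OF bd abs_ge_self]\<close>)
  have "(\<integral>x. \<bar>f x\<bar> \<partial>M) \<le> (\<integral>x. ((f x)\<^sup>2 / \<delta> + \<delta>) / 2 \<partial>M)"
    using fi i bd by (intro integral_mono) auto
  also have "\<dots> = ((\<integral>x. (f x)\<^sup>2 \<partial>M) / \<delta> + \<delta>) / 2" using f by (simp add: prob_space)
  also have "\<dots> \<le> (\<delta>\<^sup>2 / \<delta> + \<delta>) / 2" using \<delta> by (intro divide_right_mono add_right_mono) auto
  also have "\<dots> = \<delta>" using \<delta> by (simp add: power2_eq_square)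
  finally show "(\<integral>x. \<bar>f x\<bar> \<partial>M) \<le> \<delta>" .
qed

lemma exp_le_quadratic: "exp y \<le> 1 + y + y\<^sup>2 * exp \<bar>y :: real\<bar>"
proof -
  obtain t where t: "\<bar>t\<bar> \<le> \<bar>y\<bar>" "exp y = (\<Sum>m<2. y ^ m / fact m) + exp t / fact 2 * y ^ 2"
    using Maclaurin_exp_le[of y 2] by auto
  have "exp t \<le> exp \<bar>y\<bar>" "0 \<le> exp t" using t by simp_all
  then have "exp t / fact 2 \<le> exp \<bar>y\<bar>" unfolding fact_2 by linarith
  then have "exp t / fact 2 * y\<^sup>2 \<le> exp \<bar>y\<bar> * y\<^sup>2"
    by (rule mult_right_mono) simp
  then show ?thesis using t(2) by (simp add: numeral_2_eq_2 ac_simps)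
qed

section \<open>Averages over permutations\<close>

lemma sum_permutations_compose_transpose:
  assumes "i \<in> I" "j \<in> I"
  shows "(\<Sum>\<rho> | \<rho> permutes I. F \<rho>) = (\<Sum>\<rho> | \<rho> permutes I. F (\<rho> \<circ> Transposition.transpose i j))"
proof (rule sum.reindex_bij_witness[where i = "\<lambda>\<rho>. \<rho> \<circ> Transposition.transpose i j" and j = "\<lambda>\<rho>. \<rho> \<circ> Transposition.transpose i j"])
qed (use assms in \<open>auto simp: comp_assoc intro!: permutes_compose permutes_swap_id\<close>)

lemma sum_permutations_centered:
  fixes a :: "'i \<Rightarrow> real"
  assumes I: "finite I" and a: "sum a I = 0" and i: "i \<in> I"
  shows "(\<Sum>\<rho> | \<rho> permutes I. a (\<rho> i)) = 0"
proof -
  have eq: "(\<Sum>\<rho> | \<rho> permutes I. a (\<rho> i)) = (\<Sum>\<rho> | \<rho> permutes I. a (\<rho> j))" if "j \<in> I" for j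
    using sum_permutations_compose_transpose[OF i that, of "\<lambda>\<rho>. a (\<rho> i)"] by simp
  have "real (card I) * (\<Sum>\<rho> | \<rho> permutes I. a (\<rho> i)) = (\<Sum>j\<in>I. \<Sum>\<rho> | \<rho> permutes I. a (\<rho> j))"
    unfolding sum_constant[symmetric] by (rule sum.cong[OF refl eq])
  also have "\<dots> = (\<Sum>\<rho> | \<rho> permutes I. \<Sum>j\<in>I. a (\<rho> j))" by (rule sum.swap)
  also have "\<dots> = (\<Sum>\<rho> | \<rho> permutes I. sum a I)"
  proof (rule sum.cong[OF refl])
    fix \<rho> assume "\<rho> \<in> {\<rho>. \<rho> permutes I}"
    then have "\<rho> permutes I" by simp
    from sum.permute[OF this, of a] show "(\<Sum>j\<in>I. a (\<rho> j)) = sum a I" by (simp add: o_def)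
  qed
  also have "\<dots> = 0" by (simp add: a)
  finally show ?thesis using I i by auto
qed

lemma sum_permutations_diagonal_bound:
  fixes a :: "'i \<Rightarrow> real"
  assumes I: "finite I" and ad: "\<And>i. i \<in> I \<Longrightarrow> \<bar>a i\<bar> \<le> \<delta>" and i: "i \<in> I"
  shows "\<bar>\<Sum>\<rho> | \<rho> permutes I. a (\<rho> i) * a (\<rho> i)\<bar> \<le> fact (card I) * \<delta>\<^sup>2"
proof -
  have "\<bar>\<Sum>\<rho> | \<rho> permutes I. a (\<rho> i) * a (\<rho> i)\<bar> \<le> (\<Sum>\<rho> | \<rho> permutes I. \<delta>\<^sup>2)"
  proof (rule order_trans[OF sum_abs sum_mono])
    fix \<rho> assume "\<rho> \<in> {\<rho>. \<rho> permutes I}"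
    then have "\<rho> i \<in> I" using i by (simp add: permutes_in_image)
    then show "\<bar>a (\<rho> i) * a (\<rho> i)\<bar> \<le> \<delta>\<^sup>2"
      using mult_mono'[OF ad[of "\<rho> i"] ad[of "\<rho> i"]] by (simp add: power2_eq_square)
  qed
  also have "\<dots> = fact (card I) * \<delta>\<^sup>2" using I by (simp add: card_permutations[OF refl])
  finally show ?thesis .
qed

text \<open>
  For fixed \<open>i\<close> all sums with \<open>j \<noteq> i\<close> agree, by composing with a transposition, and together with the
  diagonal sum they cancel because \<open>a\<close> sums to zero. Hence each of them is smaller than the diagonal one
  by the factor \<open>card I - 1\<close>.
\<close>
lemma sum_permutations_pair_bound:
  fixes a :: "'i \<Rightarrow> real"
  assumes I: "finite I" and a: "sum a I = 0" and ad: "\<And>i. i \<in> I \<Longrightarrow> \<bar>a i\<bar> \<le> \<delta>"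
    and i: "i \<in> I" and j: "j \<in> I - {i}"
  shows "\<bar>\<Sum>\<rho> | \<rho> permutes I. a (\<rho> i) * a (\<rho> j)\<bar> * (real (card I) - 1) \<le> fact (card I) * \<delta>\<^sup>2"
proof -
  let ?\<kappa> = "\<lambda>j. \<Sum>\<rho> | \<rho> permutes I. a (\<rho> i) * a (\<rho> j)"
  have eq: "?\<kappa> k = ?\<kappa> j" if "k \<in> I - {i}" for k
    using sum_permutations_compose_transpose[of k I j "\<lambda>\<rho>. a (\<rho> i) * a (\<rho> k)"] that j by auto
  have "(\<Sum>k\<in>I. ?\<kappa> k) = (\<Sum>\<rho> | \<rho> permutes I. a (\<rho> i) * (\<Sum>k\<in>I. a (\<rho> k)))"
    by (subst sum.swap) (simp add: sum_distrib_left)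
  also have "\<dots> = (\<Sum>\<rho> | \<rho> permutes I. a (\<rho> i) * sum a I)"
  proof (rule sum.cong[OF refl])
    fix \<rho> assume "\<rho> \<in> {\<rho>. \<rho> permutes I}"
    then have "\<rho> permutes I" by simp
    from sum.permute[OF this, of a] show "a (\<rho> i) * (\<Sum>j\<in>I. a (\<rho> j)) = a (\<rho> i) * sum a I" by (simp add: o_def)
  qed
  also have "\<dots> = 0" by (simp add: a)
  finally have "?\<kappa> i + (\<Sum>k\<in>I - {i}. ?\<kappa> k) = 0" using I i by (simp add: sum.remove)
  moreover have "(\<Sum>k\<in>I - {i}. ?\<kappa> k) = real (card (I - {i})) * ?\<kappa> j"
    using eq by (simp only: sum.cong[OF refl eq] sum_constant)
  moreover have "real (card (I - {i})) = real (card I) - 1"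
    using I i card_gt_0_iff[of I] by (subst card_Diff_singleton) (auto simp: of_nat_diff)
  ultimately have e: "(real (card I) - 1) * ?\<kappa> j = - ?\<kappa> i" by simp
  have "0 \<le> real (card I) - 1" using I i card_gt_0_iff[of I] by auto
  then have "\<bar>?\<kappa> j\<bar> * (real (card I) - 1) = \<bar>(real (card I) - 1) * ?\<kappa> j\<bar>" by (simp add: abs_mult)
  also have "\<dots> = \<bar>?\<kappa> i\<bar>" by (simp add: e)
  also have "\<dots> \<le> fact (card I) * \<delta>\<^sup>2" by (rule sum_permutations_diagonal_bound[OF I ad i])
  finally show ?thesis .
qed

text \<open>
  The second moment of the permutation statistic: \<open>card I\<close> diagonal terms of order \<open>\<delta> ^ 4\<close>, and
  off-diagonal terms that are so small that they contribute no more than the diagonal ones.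
\<close>
lemma sum_permutations_square_bound:
  fixes a b :: "'i \<Rightarrow> real"
  assumes I: "finite I" "2 \<le> card I" and a: "sum a I = 0" and ad: "\<And>i. i \<in> I \<Longrightarrow> \<bar>a i\<bar> \<le> \<delta>"
    and bd: "\<And>i. i \<in> I \<Longrightarrow> \<bar>b i\<bar> \<le> \<delta>"
  shows "(\<Sum>\<rho> | \<rho> permutes I. (\<Sum>i\<in>I. b i * a (\<rho> i))\<^sup>2) \<le> fact (card I) * (2 * real (card I) * \<delta> ^ 4)"
proof -
  let ?\<kappa> = "\<lambda>i j. \<Sum>\<rho> | \<rho> permutes I. a (\<rho> i) * a (\<rho> j)"
  let ?m = "real (card I)"
  have d0: "0 \<le> \<delta>" using ad I by (metis abs_ge_zero card.empty ex_in_conv not_numeral_le_zero order_trans)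
  have bb: "\<bar>b i * b j\<bar> \<le> \<delta>\<^sup>2" if "i \<in> I" "j \<in> I" for i j
    using bd that d0 by (simp add: abs_mult power2_eq_square mult_mono)
  note diag = sum_permutations_diagonal_bound[OF I(1) ad]
  have "(\<Sum>\<rho> | \<rho> permutes I. (\<Sum>i\<in>I. b i * a (\<rho> i))\<^sup>2)
      = (\<Sum>\<rho> | \<rho> permutes I. \<Sum>i\<in>I. \<Sum>j\<in>I. (b i * b j) * (a (\<rho> i) * a (\<rho> j)))"
    unfolding power2_eq_square sum_product by (intro sum.cong refl) (simp add: ac_simps)
  also have "\<dots> = (\<Sum>i\<in>I. \<Sum>j\<in>I. (b i * b j) * ?\<kappa> i j)"
    unfolding sum_distrib_left by (subst sum.swap, intro sum.cong refl, rule sum.swap)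
  also have "\<dots> \<le> (\<Sum>i\<in>I. 2 * (fact (card I) * \<delta> ^ 4))"
  proof (rule sum_mono)
    fix i assume i: "i \<in> I"
    have "(\<Sum>j\<in>I. (b i * b j) * ?\<kappa> i j) = (b i * b i) * ?\<kappa> i i + (\<Sum>j\<in>I - {i}. (b i * b j) * ?\<kappa> i j)"
      using I i by (simp add: sum.remove)
    also have "(b i * b i) * ?\<kappa> i i \<le> fact (card I) * \<delta> ^ 4"
    proof -
      have "(b i * b i) * ?\<kappa> i i \<le> \<bar>b i * b i\<bar> * \<bar>?\<kappa> i i\<bar>" by (rule order_trans[OF abs_ge_self]) (simp only: abs_mult order_refl)
      also have "\<dots> \<le> \<delta>\<^sup>2 * (fact (card I) * \<delta>\<^sup>2)" by (intro mult_mono bb diag i) auto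
      finally show ?thesis by (simp add: power2_eq_square power4_eq_xxxx ac_simps)
    qed
    also have "(\<Sum>j\<in>I - {i}. (b i * b j) * ?\<kappa> i j) \<le> (\<Sum>j\<in>I - {i}. fact (card I) * \<delta> ^ 4 / (?m - 1))"
    proof (rule sum_mono)
      fix j assume j: "j \<in> I - {i}"
      have "\<bar>?\<kappa> i j\<bar> \<le> fact (card I) * \<delta>\<^sup>2 / (?m - 1)"
        using sum_permutations_pair_bound[OF I(1) a ad i j] I by (simp add: pos_le_divide_eq)
      moreover have "(b i * b j) * ?\<kappa> i j \<le> \<bar>b i * b j\<bar> * \<bar>?\<kappa> i j\<bar>" by (rule order_trans[OF abs_ge_self]) (simp only: abs_mult order_refl)
      moreover have "\<bar>b i * b j\<bar> * \<bar>?\<kappa> i j\<bar> \<le> \<delta>\<^sup>2 * (fact (card I) * \<delta>\<^sup>2 / (?m - 1))"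
        using j by (intro mult_mono bb i calculation(1)) auto
      ultimately show "(b i * b j) * ?\<kappa> i j \<le> fact (card I) * \<delta> ^ 4 / (?m - 1)"
        by (simp add: power2_eq_square power4_eq_xxxx ac_simps)
    qed
    also have "\<dots> = fact (card I) * \<delta> ^ 4"
    proof -
      have "real (card (I - {i})) = ?m - 1"
        using I i by (subst card_Diff_singleton) (auto simp: of_nat_diff)
      moreover have "?m - 1 \<noteq> 0" using I by auto
      ultimately show ?thesis by simp
    qed
    finally show "(\<Sum>j\<in>I. (b i * b j) * ?\<kappa> i j) \<le> 2 * (fact (card I) * \<delta> ^ 4)" by simp
  qed
  also have "\<dots> = fact (card I) * (2 * ?m * \<delta> ^ 4)" by simp
  finally show ?thesis .
qed

abbreviation symmetrization_bound :: "real \<Rightarrow> real \<Rightarrow> real" where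
  "symmetrization_bound m \<delta> \<equiv> exp (4 * m * \<delta> ^ 3) * (1 + 2 * m * \<delta> ^ 4 * exp (m * \<delta>\<^sup>2))"

text \<open>
  Each factor is \<open>1 + x y / (1 + x + y)\<close>, so the product is close to the exponential of the permutation
  statistic \<open>\<Sum>i\<in>I. b i * a (\<rho> i)\<close>. This has mean zero over \<open>\<rho>\<close>, and \<open>exp_le_quadratic\<close> reduces the rest to
  its second moment. For weights of order \<open>1 / sqrt (card I)\<close> the average of the product tends to one.
\<close>
lemma sum_permutations_prod_bound:
  fixes a b :: "'i \<Rightarrow> real"
  assumes I: "finite I" "2 \<le> card I" and a: "sum a I = 0" and ad: "\<And>i. i \<in> I \<Longrightarrow> \<bar>a i\<bar> \<le> \<delta>"
    and bd: "\<And>i. i \<in> I \<Longrightarrow> \<bar>b i\<bar> \<le> \<delta>" and \<delta>: "\<delta> \<le> 1 / 4"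
  defines "m \<equiv> real (card I)"
  shows "(\<Sum>\<rho> | \<rho> permutes I. \<Prod>i\<in>I. (1 + b i) * (1 + a (\<rho> i)) / (1 + b i + a (\<rho> i)))
       \<le> fact (card I) * (symmetrization_bound m \<delta>)"
proof -
  have d0: "0 \<le> \<delta>" using ad I by (metis abs_ge_zero card.empty ex_in_conv not_numeral_le_zero order_trans)
  let ?y = "\<lambda>\<rho>. \<Sum>i\<in>I. b i * a (\<rho> i)"
  let ?A = "exp (4 * m * \<delta> ^ 3)"
  have one: "(1 + x) * (1 + y) / (1 + x + y) \<le> exp (x * y + 4 * \<delta> ^ 3)"
    "0 \<le> (1 + x) * (1 + y) / (1 + x + y)" if "\<bar>x\<bar> \<le> \<delta>" "\<bar>y\<bar> \<le> \<delta>" for x y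
  proof -
    have p: "1 / 2 \<le> 1 + x + y" using that \<delta> by linarith
    have "(1 + x) * (1 + y) / (1 + x + y) = 1 + x * y + (x * y) * (- (x + y)) / (1 + x + y)"
      using p by (simp add: field_simps)
    also have "(x * y) * (- (x + y)) / (1 + x + y) \<le> 4 * \<delta> ^ 3"
    proof -
      have "(x * y) * (- (x + y)) \<le> \<bar>x\<bar> * \<bar>y\<bar> * \<bar>x + y\<bar>"
        by (rule order_trans[OF abs_ge_self]) (simp only: abs_mult abs_minus_cancel order_refl)
      also have "\<dots> \<le> \<delta> * \<delta> * (2 * \<delta>)" using that d0 by (intro mult_mono) auto
      also have "\<dots> = 4 * \<delta> ^ 3 * (1 / 2)" by (simp add: power3_eq_cube)
      also have "\<dots> \<le> 4 * \<delta> ^ 3 * (1 + x + y)" using p d0 by (intro mult_left_mono) auto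
      finally show ?thesis using p by (simp add: pos_divide_le_eq)
    qed
    also have "1 + x * y + 4 * \<delta> ^ 3 \<le> exp (x * y + 4 * \<delta> ^ 3)"
      using exp_ge_add_one_self[of "x * y + 4 * \<delta> ^ 3"] by (simp only: add.assoc)
    finally show "(1 + x) * (1 + y) / (1 + x + y) \<le> exp (x * y + 4 * \<delta> ^ 3)" by simp
    show "0 \<le> (1 + x) * (1 + y) / (1 + x + y)" using p that \<delta> by (intro divide_nonneg_nonneg mult_nonneg_nonneg) auto
  qed
  have "(\<Sum>\<rho> | \<rho> permutes I. \<Prod>i\<in>I. (1 + b i) * (1 + a (\<rho> i)) / (1 + b i + a (\<rho> i)))
      \<le> (\<Sum>\<rho> | \<rho> permutes I. ?A * (1 + ?y \<rho> + (?y \<rho>)\<^sup>2 * exp (m * \<delta>\<^sup>2)))"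
  proof (rule sum_mono)
    fix \<rho> assume "\<rho> \<in> {\<rho>. \<rho> permutes I}"
    then have \<rho>: "\<rho> i \<in> I" if "i \<in> I" for i using that by (simp add: permutes_in_image)
    have "(\<Prod>i\<in>I. (1 + b i) * (1 + a (\<rho> i)) / (1 + b i + a (\<rho> i))) \<le> (\<Prod>i\<in>I. exp (b i * a (\<rho> i) + 4 * \<delta> ^ 3))"
      using one ad bd \<rho> by (intro prod_mono conjI) auto
    also have "\<dots> = exp (?y \<rho> + 4 * m * \<delta> ^ 3)"
      using I by (simp add: exp_sum[symmetric] sum.distrib m_def)
    also have "\<dots> = ?A * exp (?y \<rho>)" by (simp add: exp_add)
    also have "exp (?y \<rho>) \<le> 1 + ?y \<rho> + (?y \<rho>)\<^sup>2 * exp \<bar>?y \<rho>\<bar>" by (rule exp_le_quadratic)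
    also have "(?y \<rho>)\<^sup>2 * exp \<bar>?y \<rho>\<bar> \<le> (?y \<rho>)\<^sup>2 * exp (m * \<delta>\<^sup>2)"
    proof -
      have "\<bar>?y \<rho>\<bar> \<le> (\<Sum>i\<in>I. \<delta>\<^sup>2)"
        using ad bd \<rho> d0 by (intro order_trans[OF sum_abs sum_mono]) (simp add: abs_mult power2_eq_square mult_mono)
      then show ?thesis by (intro mult_left_mono) (auto simp: m_def)
    qed
    finally show "(\<Prod>i\<in>I. (1 + b i) * (1 + a (\<rho> i)) / (1 + b i + a (\<rho> i)))
       \<le> ?A * (1 + ?y \<rho> + (?y \<rho>)\<^sup>2 * exp (m * \<delta>\<^sup>2))" by simp
  qed
  also have "\<dots> = ?A * (fact (card I) + (\<Sum>\<rho> | \<rho> permutes I. ?y \<rho>) + (\<Sum>\<rho> | \<rho> permutes I. (?y \<rho>)\<^sup>2) * exp (m * \<delta>\<^sup>2))"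
    using I by (simp add: sum.distrib sum_distrib_left[symmetric] sum_distrib_right[symmetric] card_permutations[OF refl])
  also have "(\<Sum>\<rho> | \<rho> permutes I. ?y \<rho>) = (\<Sum>i\<in>I. b i * (\<Sum>\<rho> | \<rho> permutes I. a (\<rho> i)))"
    by (subst sum.swap) (simp add: sum_distrib_left)
  also have "\<dots> = 0" using sum_permutations_centered[OF I(1) a] by simp
  also have "?A * (fact (card I) + 0 + (\<Sum>\<rho> | \<rho> permutes I. (?y \<rho>)\<^sup>2) * exp (m * \<delta>\<^sup>2))
      \<le> ?A * (fact (card I) + 0 + (fact (card I) * (2 * m * \<delta> ^ 4)) * exp (m * \<delta>\<^sup>2))"
    unfolding m_def using sum_permutations_square_bound[OF I a ad bd]
    by (intro mult_left_mono add_left_mono mult_right_mono) auto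
  also have "\<dots> = fact (card I) * (?A * (1 + 2 * m * \<delta> ^ 4 * exp (m * \<delta>\<^sup>2)))"
    by (simp add: algebra_simps)
  finally show ?thesis .
qed

section \<open>Symmetric tests against exponential tilts\<close>

text \<open>
  The likelihood ratio of independent exponentials with rates \<open>1 + a j\<close> to those with rate one.
\<close>
definition exp_tilt :: "'i set \<Rightarrow> ('i \<Rightarrow> real) \<Rightarrow> ('i \<Rightarrow> real) \<Rightarrow> real" where
  "exp_tilt I a x = (\<Prod>j\<in>I. (1 + a j) * exp (- a j * x j))"

lemma measurable_exp_tilt: "exp_tilt I a \<in> borel_measurable (borel_PiM I)"
  unfolding exp_tilt_def[abs_def]
  by (intro borel_measurable_prod borel_measurable_times borel_measurable_const
      borel_measurable_exp[THEN measurable_compose[rotated]] measurable_component_singleton)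

lemma exp_tilt_nonneg:
  assumes "\<And>j. j \<in> I \<Longrightarrow> \<bar>a j\<bar> \<le> 1 / 4"
  shows "0 \<le> exp_tilt I a x"
  unfolding exp_tilt_def
proof (intro prod_nonneg mult_nonneg_nonneg)
  fix j assume "j \<in> I"
  then show "0 \<le> 1 + a j" using assms[of j] by linarith
qed simp

lemma integral_exp_tilt_mult:
  assumes I: "finite I" and a: "\<And>j. j \<in> I \<Longrightarrow> \<bar>a j\<bar> \<le> 1 / 4" and b: "\<And>j. j \<in> I \<Longrightarrow> \<bar>b j\<bar> \<le> 1 / 4"
  shows "integrable (exponential_PiM I) (\<lambda>x. exp_tilt I a x * exp_tilt I b x)"
    and "(\<integral>x. exp_tilt I a x * exp_tilt I b x \<partial>exponential_PiM I)
       = (\<Prod>j\<in>I. (1 + a j) * (1 + b j) / (1 + a j + b j))"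
proof -
  interpret product_sigma_finite "\<lambda>_. std_exponential" by (rule product_sigma_finite_exponential)
  define F where "F = (\<lambda>j y. ((1 + a j) * (1 + b j)) * exp (- (a j + b j) * y))"
  have e: "exp_tilt I a x * exp_tilt I b x = (\<Prod>j\<in>I. F j (x j))" for x
    unfolding exp_tilt_def F_def prod.distrib[symmetric]
    by (intro prod.cong refl) (simp add: algebra_simps exp_add[symmetric])
  have F: "integrable std_exponential (F j)" "(\<integral>y. F j y \<partial>std_exponential) = (1 + a j) * (1 + b j) / (1 + a j + b j)"
    if "j \<in> I" for j
  proof -
    have c: "-1 < a j + b j" using a[OF that] b[OF that] by linarith
    show "integrable std_exponential (F j)"
      unfolding F_def by (intro integrable_mult_right integral_exp_std_exponential(1) c)
    show "(\<integral>y. F j y \<partial>std_exponential) = (1 + a j) * (1 + b j) / (1 + a j + b j)"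
      unfolding F_def integral_mult_right_zero integral_exp_std_exponential(2)[OF c] by (simp add: add.assoc)
  qed
  show "integrable (exponential_PiM I) (\<lambda>x. exp_tilt I a x * exp_tilt I b x)"
    unfolding e by (intro product_integrable_prod I F)
  show "(\<integral>x. exp_tilt I a x * exp_tilt I b x \<partial>exponential_PiM I)
       = (\<Prod>j\<in>I. (1 + a j) * (1 + b j) / (1 + a j + b j))"
    unfolding e using product_integral_prod[OF I F(1)] F(2) by (simp cong: prod.cong)
qed

lemma integral_exp_tilt:
  assumes I: "finite I" and a: "\<And>j. j \<in> I \<Longrightarrow> \<bar>a j\<bar> \<le> 1 / 4"
  shows "integrable (exponential_PiM I) (exp_tilt I a)"
    and "(\<integral>x. exp_tilt I a x \<partial>exponential_PiM I) = 1"
proof -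
  have z: "exp_tilt I (\<lambda>_. 0) x = 1" for x by (simp add: exp_tilt_def)
  have p: "(\<Prod>j\<in>I. (1 + a j) * (1 + 0) / (1 + a j + 0)) = 1"
  proof (rule prod.neutral, intro ballI)
    fix j assume "j \<in> I"
    then have "1 + a j \<noteq> 0" using a[of j] by (auto simp: abs_le_iff)
    then show "(1 + a j) * (1 + 0) / (1 + a j + 0) = 1" by simp
  qed
  show "integrable (exponential_PiM I) (exp_tilt I a)"
    using integral_exp_tilt_mult(1)[OF I a, where b = "\<lambda>_. 0"] by (simp add: z)
  show "(\<integral>x. exp_tilt I a x \<partial>exponential_PiM I) = 1"
    using integral_exp_tilt_mult(2)[OF I a, where b = "\<lambda>_. 0"] p by (simp add: z)
qed

text \<open>
  Each factor \<open>(1 + a j)\<^sup>2 / (1 + 2 a j)\<close> is \<open>1 + (a j)\<^sup>2 / (1 + 2 a j)\<close>, with denominator at least one half.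
\<close>
lemma integral_exp_tilt_square_le:
  assumes I: "finite I" and a: "\<And>j. j \<in> I \<Longrightarrow> \<bar>a j\<bar> \<le> \<delta>" and \<delta>: "\<delta> \<le> 1 / 4"
  shows "integrable (exponential_PiM I) (\<lambda>x. (exp_tilt I a x)\<^sup>2)"
    and "(\<integral>x. (exp_tilt I a x)\<^sup>2 \<partial>exponential_PiM I) \<le> exp (2 * real (card I) * \<delta>\<^sup>2)"
proof -
  have a4: "\<bar>a j\<bar> \<le> 1 / 4" if "j \<in> I" for j using a[OF that] \<delta> by linarith
  show "integrable (exponential_PiM I) (\<lambda>x. (exp_tilt I a x)\<^sup>2)"
    using integral_exp_tilt_mult(1)[OF I a4 a4] by (simp add: power2_eq_square)
  have "(\<integral>x. (exp_tilt I a x)\<^sup>2 \<partial>exponential_PiM I) = (\<Prod>j\<in>I. (1 + a j) * (1 + a j) / (1 + a j + a j))"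
    using integral_exp_tilt_mult(2)[OF I a4 a4] by (simp add: power2_eq_square)
  also have "\<dots> \<le> (\<Prod>j\<in>I. exp (2 * \<delta>\<^sup>2))"
  proof (intro prod_mono conjI)
    fix j assume j: "j \<in> I"
    have p: "1 / 2 \<le> 1 + a j + a j" using a4[OF j] by linarith
    then show "0 \<le> (1 + a j) * (1 + a j) / (1 + a j + a j)" by (intro divide_nonneg_nonneg) auto
    have "(1 + a j) * (1 + a j) / (1 + a j + a j) = 1 + (a j * a j) / (1 + a j + a j)"
      using p by (simp add: field_simps)
    also have "(a j * a j) / (1 + a j + a j) \<le> 2 * \<delta>\<^sup>2"
    proof -
      have "a j * a j \<le> \<delta>\<^sup>2"
        using mult_mono'[OF a[OF j] a[OF j]] by (simp add: power2_eq_square)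
      also have "\<dots> \<le> (2 * \<delta>\<^sup>2) * (1 + a j + a j)"
        using mult_left_mono[OF p, of "2 * \<delta>\<^sup>2"] by simp
      finally show ?thesis using p by (simp add: pos_divide_le_eq)
    qed
    also have "1 + 2 * \<delta>\<^sup>2 \<le> exp (2 * \<delta>\<^sup>2)" by (rule exp_ge_add_one_self)
    finally show "(1 + a j) * (1 + a j) / (1 + a j + a j) \<le> exp (2 * \<delta>\<^sup>2)" by simp
  qed
  also have "\<dots> = exp (2 * real (card I) * \<delta>\<^sup>2)" by (simp add: exp_of_nat_mult[symmetric] ac_simps)
  finally show "(\<integral>x. (exp_tilt I a x)\<^sup>2 \<partial>exponential_PiM I) \<le> exp (2 * real (card I) * \<delta>\<^sup>2)" .
qed

lemma integral_PiM_permute: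
  fixes f :: "('i \<Rightarrow> 'a) \<Rightarrow> real"
  assumes N: "prob_space N" and \<rho>: "\<rho> permutes I" and f: "f \<in> borel_measurable (Pi\<^sub>M I (\<lambda>_. N))"
  shows "(\<integral>x. f (\<lambda>i\<in>I. x (\<rho> i)) \<partial>Pi\<^sub>M I (\<lambda>_. N)) = (\<integral>x. f x \<partial>Pi\<^sub>M I (\<lambda>_. N))"
proof -
  have inI: "\<rho> i \<in> I" if "i \<in> I" for i using \<rho> that by (simp add: permutes_in_image)
  have *: "distr (Pi\<^sub>M I (\<lambda>_. N)) (Pi\<^sub>M I (\<lambda>_. N)) (\<lambda>x. \<lambda>i\<in>I. x (\<rho> i)) = Pi\<^sub>M I (\<lambda>_. N)"
    using N inI by (intro distr_PiM_reindex) (auto intro: permutes_inj_on[OF \<rho>])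
  have "(\<lambda>x. \<lambda>i\<in>I. x (\<rho> i)) \<in> Pi\<^sub>M I (\<lambda>_. N) \<rightarrow>\<^sub>M Pi\<^sub>M I (\<lambda>_. N)"
    using inI by (intro measurable_restrict measurable_component_singleton)
  from integral_distr[OF this f] show ?thesis by (simp only: *)
qed

lemma exp_tilt_permute:
  assumes "\<rho> permutes I"
  shows "exp_tilt I (\<lambda>j. a (\<rho> j)) (\<lambda>i\<in>I. x (\<rho> i)) = exp_tilt I a x"
proof -
  have "exp_tilt I (\<lambda>j. a (\<rho> j)) (\<lambda>i\<in>I. x (\<rho> i)) = (\<Prod>j\<in>I. ((\<lambda>j. (1 + a j) * exp (- a j * x j)) \<circ> \<rho>) j)"
    unfolding exp_tilt_def by (intro prod.cong refl) simp
  also have "\<dots> = exp_tilt I a x"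
    unfolding exp_tilt_def by (rule prod.permute[OF assms, symmetric])
  finally show ?thesis .
qed

lemma integrable_test_mult:
  fixes \<tau> f :: "'a \<Rightarrow> real"
  assumes f: "integrable M f" and \<tau>: "\<tau> \<in> borel_measurable M" "\<And>x. 0 \<le> \<tau> x" "\<And>x. \<tau> x \<le> 1"
  shows "integrable M (\<lambda>x. \<tau> x * f x)"
    and "\<bar>\<integral>x. \<tau> x * f x \<partial>M\<bar> \<le> (\<integral>x. \<bar>f x\<bar> \<partial>M)"
proof -
  have le: "\<bar>\<tau> x * f x\<bar> \<le> \<bar>f x\<bar>" for x
    using \<tau>(2,3) by (simp add: abs_mult mult_left_le_one_le)
  show i: "integrable M (\<lambda>x. \<tau> x * f x)"
    by (rule Bochner_Integration.integrable_bound[OF f]) (use f \<tau>(1) le in auto)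
  have "\<bar>\<integral>x. \<tau> x * f x \<partial>M\<bar> \<le> (\<integral>x. \<bar>\<tau> x * f x\<bar> \<partial>M)" by (rule integral_abs_bound)
  also have "\<dots> \<le> (\<integral>x. \<bar>f x\<bar> \<partial>M)" by (intro integral_mono integrable_abs i f le)
  finally show "\<bar>\<integral>x. \<tau> x * f x \<partial>M\<bar> \<le> (\<integral>x. \<bar>f x\<bar> \<partial>M)" .
qed

text \<open>
  A symmetric test has the same expectation under every permutation of the rates, so the likelihood
  ratio may be replaced by its average \<open>S\<close> over all permutations. The second moment of \<open>S\<close> is an average of
  the products in \<open>sum_permutations_prod_bound\<close>; hence \<open>S\<close> is close to one in mean square. This is the
  step in which the first order information about the alternative disappears.
\<close>
lemma symmetric_test_exp_tilt:
  fixes \<tau> :: "('i \<Rightarrow> real) \<Rightarrow> real" and a :: "'i \<Rightarrow> real"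
  assumes I: "finite I" "2 \<le> card I" and a: "sum a I = 0" and ad: "\<And>i. i \<in> I \<Longrightarrow> \<bar>a i\<bar> \<le> \<delta>" and \<delta>: "\<delta> \<le> 1 / 4"
    and \<tau>: "\<tau> \<in> borel_measurable (borel_PiM I)" and \<tau>01: "\<And>x. 0 \<le> \<tau> x" "\<And>x. \<tau> x \<le> 1"
    and sym: "\<And>\<rho> x. \<rho> permutes I \<Longrightarrow> x \<in> extensional I \<Longrightarrow> \<tau> (\<lambda>i\<in>I. x (\<rho> i)) = \<tau> x"
    and e: "symmetrization_bound (real (card I)) \<delta> - 1 \<le> e\<^sup>2" "0 < e"
  defines "E \<equiv> exponential_PiM I"
  shows "\<bar>(\<integral>x. \<tau> x * exp_tilt I a x \<partial>E) - (\<integral>x. \<tau> x \<partial>E)\<bar> \<le> e"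
proof -
  interpret E: prob_space E unfolding E_def by (intro prob_space_PiM prob_space_std_exponential)
  define P where "P = {\<rho>. \<rho> permutes I}"
  have finP: "finite P" using I(1) by (simp add: P_def finite_permutations)
  have cardP: "real (card P) = fact (card I)" using I(1) by (simp add: P_def card_permutations[OF refl])
  define M where "M \<rho> = exp_tilt I (\<lambda>j. a (\<rho> j))" for \<rho>
  define S where "S x = (\<Sum>\<rho>\<in>P. M \<rho> x) / fact (card I)" for x
  have a4: "\<bar>a (\<rho> j)\<bar> \<le> 1 / 4" "\<bar>a (\<rho> j)\<bar> \<le> \<delta>" if "\<rho> \<in> P" "j \<in> I" for \<rho> j
  proof -
    have "\<rho> j \<in> I" using that by (simp add: P_def permutes_in_image)
    then show "\<bar>a (\<rho> j)\<bar> \<le> \<delta>" by (rule ad)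
    then show "\<bar>a (\<rho> j)\<bar> \<le> 1 / 4" using \<delta> by linarith
  qed
  have Mi: "integrable E (M \<rho>)" "(\<integral>x. M \<rho> x \<partial>E) = 1" if "\<rho> \<in> P" for \<rho>
    unfolding M_def E_def using a4(1)[OF that] by (auto intro!: integral_exp_tilt I)
  have \<tau>m [measurable]: "\<tau> \<in> borel_measurable E" using \<tau> by (simp add: E_def measurable_PiM_exponential_iff)
  have Mm [measurable]: "M \<rho> \<in> borel_measurable E" for \<rho>
    unfolding M_def E_def using measurable_exp_tilt by (simp only: measurable_PiM_exponential_iff)
  have \<tau>i: "integrable E \<tau>" using \<tau>01 by (intro E.integrable_const_bound[where B = 1]) auto
  note \<tau>fi = integrable_test_mult(1)[OF _ \<tau>m \<tau>01]
  have same: "(\<integral>x. \<tau> x * M \<rho> x \<partial>E) = (\<integral>x. \<tau> x * exp_tilt I a x \<partial>E)" if \<rho>: "\<rho> \<in> P" for \<rho>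
  proof -
    have \<rho>': "\<rho> permutes I" using \<rho> by (simp add: P_def)
    have "(\<lambda>x. \<tau> x * M \<rho> x) \<in> borel_measurable E" by measurable
    from integral_PiM_permute[OF prob_space_std_exponential \<rho>' this[unfolded E_def]]
    have "(\<integral>x. \<tau> x * M \<rho> x \<partial>E) = (\<integral>x. \<tau> (\<lambda>i\<in>I. x (\<rho> i)) * M \<rho> (\<lambda>i\<in>I. x (\<rho> i)) \<partial>E)"
      by (simp add: E_def)
    also have "\<dots> = (\<integral>x. \<tau> x * exp_tilt I a x \<partial>E)"
    proof (rule Bochner_Integration.integral_cong[OF refl])
      fix x assume "x \<in> space E"
      then have "x \<in> extensional I" by (auto simp: E_def space_PiM PiE_def)
      then show "\<tau> (\<lambda>i\<in>I. x (\<rho> i)) * M \<rho> (\<lambda>i\<in>I. x (\<rho> i)) = \<tau> x * exp_tilt I a x"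
        by (simp only: sym[OF \<rho>'] M_def exp_tilt_permute[OF \<rho>'])
    qed
    finally show ?thesis .
  qed
  have Si: "integrable E S" unfolding S_def using Mi by (intro integrable_divide_zero Bochner_Integration.integrable_sum) auto
  have SI: "(\<integral>x. S x \<partial>E) = 1"
    unfolding S_def using Mi cardP by (simp add: Bochner_Integration.integral_sum)
  have "(\<integral>x. \<tau> x * S x \<partial>E) = (\<Sum>\<rho>\<in>P. \<integral>x. \<tau> x * M \<rho> x \<partial>E) / fact (card I)"
    unfolding S_def times_divide_eq_right sum_distrib_left
    using \<tau>fi[OF Mi(1)] by (simp add: Bochner_Integration.integral_sum)
  also have "\<dots> = (\<integral>x. \<tau> x * exp_tilt I a x \<partial>E)" using cardP by (simp add: same)
  finally have \<tau>S: "(\<integral>x. \<tau> x * exp_tilt I a x \<partial>E) = (\<integral>x. \<tau> x * S x \<partial>E)" by simp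
  have pair: "integrable E (\<lambda>x. M \<pi> x * M \<rho> x)"
    "(\<integral>x. M \<pi> x * M \<rho> x \<partial>E) = (\<Prod>i\<in>I. (1 + a (\<pi> i)) * (1 + a (\<rho> i)) / (1 + a (\<pi> i) + a (\<rho> i)))"
    if "\<pi> \<in> P" "\<rho> \<in> P" for \<pi> \<rho>
    unfolding M_def E_def using a4(1)[OF that(1)] a4(1)[OF that(2)] by (intro integral_exp_tilt_mult I; simp)+
  have S2: "(S x)\<^sup>2 = (\<Sum>\<pi>\<in>P. \<Sum>\<rho>\<in>P. M \<pi> x * M \<rho> x) / (fact (card I))\<^sup>2" for x
    unfolding S_def power_divide power2_eq_square[of "sum _ _"] sum_product ..
  have S2i: "integrable E (\<lambda>x. (S x)\<^sup>2)"
    unfolding S2 by (intro integrable_divide_zero impI Bochner_Integration.integrable_sum pair)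
  have "(\<integral>x. (S x)\<^sup>2 \<partial>E) = (\<Sum>\<pi>\<in>P. \<Sum>\<rho>\<in>P. \<integral>x. M \<pi> x * M \<rho> x \<partial>E) / (fact (card I))\<^sup>2"
  proof -
    have "(\<integral>x. (\<Sum>\<pi>\<in>P. \<Sum>\<rho>\<in>P. M \<pi> x * M \<rho> x) \<partial>E) = (\<Sum>\<pi>\<in>P. \<integral>x. (\<Sum>\<rho>\<in>P. M \<pi> x * M \<rho> x) \<partial>E)"
      by (intro Bochner_Integration.integral_sum Bochner_Integration.integrable_sum pair)
    also have "\<dots> = (\<Sum>\<pi>\<in>P. \<Sum>\<rho>\<in>P. \<integral>x. M \<pi> x * M \<rho> x \<partial>E)"
      by (intro sum.cong refl Bochner_Integration.integral_sum pair)
    finally show ?thesis unfolding S2 by simp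
  qed
  also have "\<dots> \<le> (\<Sum>\<pi>\<in>P. fact (card I) * (1 + e\<^sup>2)) / (fact (card I))\<^sup>2"
  proof (intro divide_right_mono sum_mono)
    fix \<pi> assume \<pi>: "\<pi> \<in> P"
    have "(\<Sum>\<rho>\<in>P. \<integral>x. M \<pi> x * M \<rho> x \<partial>E)
        = (\<Sum>\<rho> | \<rho> permutes I. \<Prod>i\<in>I. (1 + a (\<pi> i)) * (1 + a (\<rho> i)) / (1 + a (\<pi> i) + a (\<rho> i)))"
      using pair(2)[OF \<pi>] by (intro sum.cong) (auto simp: P_def)
    also have "\<dots> \<le> fact (card I) * (symmetrization_bound (real (card I)) \<delta>)"
      by (rule sum_permutations_prod_bound[OF I a ad a4(2)[OF \<pi>] \<delta>])
    also have "\<dots> \<le> fact (card I) * (1 + e\<^sup>2)" using e(1) by (intro mult_left_mono) auto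
    finally show "(\<Sum>\<rho>\<in>P. \<integral>x. M \<pi> x * M \<rho> x \<partial>E) \<le> fact (card I) * (1 + e\<^sup>2)" .
  qed simp
  also have "\<dots> = 1 + e\<^sup>2" using cardP by (simp add: power2_eq_square[of "fact _"])
  finally have S2I: "(\<integral>x. (S x)\<^sup>2 \<partial>E) \<le> 1 + e\<^sup>2" .
  have sq: "(S x - 1)\<^sup>2 = (S x)\<^sup>2 - 2 * S x + 1" for x by (simp add: power2_eq_square algebra_simps)
  have sqi: "integrable E (\<lambda>x. (S x - 1)\<^sup>2)" unfolding sq using S2i Si by simp
  have sqI: "(\<integral>x. (S x - 1)\<^sup>2 \<partial>E) \<le> e\<^sup>2"
    unfolding sq using S2i Si SI S2I by (simp add: E.prob_space)
  have sm: "(\<lambda>x. S x - 1) \<in> borel_measurable E" using Si by measurable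
  note L1 = E.integral_abs_le_of_square[OF sm sqi sqI e(2)]
  have "(\<integral>x. \<tau> x * exp_tilt I a x \<partial>E) - (\<integral>x. \<tau> x \<partial>E) = (\<integral>x. \<tau> x * S x - \<tau> x \<partial>E)"
    using \<tau>S \<tau>fi[OF Si] \<tau>i by simp
  also have "\<dots> = (\<integral>x. \<tau> x * (S x - 1) \<partial>E)" by (simp add: right_diff_distrib)
  also have "\<bar>\<dots>\<bar> \<le> (\<integral>x. \<bar>S x - 1\<bar> \<partial>E)"
    by (rule integrable_test_mult(2)[OF L1(1) \<tau>m \<tau>01])
  also have "\<dots> \<le> e" by (rule L1(2))
  finally show ?thesis .
qed

section \<open>Nearly proportional likelihood ratios\<close>

text \<open>
  Both functions have integral one, so their distance is twice the integral of the positive part of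
  \<open>M' - L\<close>, and a one-sided bound suffices. On the exceptional set \<open>M'\<close> is at most \<open>(M')\<^sup>2 / K + K\<close>.
\<close>
lemma (in prob_space) integral_abs_diff_le_of_lower_bound:
  fixes L M' :: "'a \<Rightarrow> real"
  assumes L: "integrable M L" "(\<integral>x. L x \<partial>M) = 1" "AE x in M. 0 \<le> L x"
    and M': "integrable M M'" "(\<integral>x. M' x \<partial>M) = 1" "AE x in M. 0 \<le> M' x" "integrable M (\<lambda>x. (M' x)\<^sup>2)" "(\<integral>x. (M' x)\<^sup>2 \<partial>M) \<le> C"
    and B: "B \<in> sets M" "prob B \<le> \<delta>" and low: "AE x in M. x \<notin> B \<longrightarrow> exp (- \<epsilon>) * M' x \<le> L x"
    and K: "0 < K" and \<epsilon>: "0 \<le> \<epsilon>"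
  shows "(\<integral>x. \<bar>L x - M' x\<bar> \<partial>M) \<le> 2 * (\<epsilon> + C / K + K * \<delta>)"
proof -
  have Bi: "integrable M (indicat_real B)"
    using B by (intro integrable_const_bound[where B = 1]) (auto simp: indicator_def)
  have "(\<integral>x. \<bar>L x - M' x\<bar> \<partial>M) \<le> (\<integral>x. (L x - M' x) + 2 * (\<epsilon> * M' x + (M' x)\<^sup>2 / K + K * indicat_real B x) \<partial>M)"
  proof (rule integral_mono_AE)
    show "integrable M (\<lambda>x. \<bar>L x - M' x\<bar>)" using L M' by simp
    show "integrable M (\<lambda>x. (L x - M' x) + 2 * (\<epsilon> * M' x + (M' x)\<^sup>2 / K + K * indicat_real B x))"
      using L M' Bi by simp
    show "AE x in M. \<bar>L x - M' x\<bar> \<le> (L x - M' x) + 2 * (\<epsilon> * M' x + (M' x)\<^sup>2 / K + K * indicat_real B x)"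
      using L(3) M'(3) low
    proof eventually_elim
      case (elim x)
      have nn: "0 \<le> \<epsilon> * M' x" "0 \<le> (M' x)\<^sup>2 / K" "0 \<le> K * indicat_real B x"
        using elim \<epsilon> K by auto
      have "M' x - L x \<le> \<epsilon> * M' x + (M' x)\<^sup>2 / K + K * indicat_real B x"
      proof (cases "x \<in> B")
        case True
        have "0 \<le> (M' x - K)\<^sup>2 / K" using K by simp
        also have "\<dots> = (M' x)\<^sup>2 / K + K - 2 * M' x" using K by (simp add: power2_eq_square field_simps)
        finally have "M' x \<le> (M' x)\<^sup>2 / K + K" using elim by simp
        then show ?thesis using elim nn True by simp
      next
        case False
        have "(1 - \<epsilon>) * M' x \<le> exp (- \<epsilon>) * M' x"
          using elim exp_ge_add_one_self[of "- \<epsilon>"] by (intro mult_right_mono) auto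
        also have "\<dots> \<le> L x" using elim False by simp
        finally show ?thesis using nn by (simp add: algebra_simps)
      qed
      then show ?case using nn by (cases "M' x \<le> L x") auto
    qed
  qed
  also have "\<dots> = 2 * (\<epsilon> + (\<integral>x. (M' x)\<^sup>2 \<partial>M) / K + K * prob B)"
    using L M' Bi B by (simp add: Int_absorb2 sets.sets_into_space)
  also have "\<dots> \<le> 2 * (\<epsilon> + C / K + K * \<delta>)"
    using M'(5) B(2) K by (intro mult_left_mono add_mono divide_right_mono order_refl) auto
  finally show ?thesis .
qed

text \<open>
  The proportionality factor \<open>\<kappa>\<close> is arbitrary. Whichever side of one it lies on, one of the two functions
  dominates \<open>exp (- \<epsilon>)\<close> times the other, which is all that the preceding lemma asks for. So normalizing
  constants of likelihood ratios never have to be computed.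
\<close>
lemma (in prob_space) integral_abs_diff_le_of_proportional:
  fixes L M' :: "'a \<Rightarrow> real"
  assumes L: "integrable M L" "(\<integral>x. L x \<partial>M) = 1" "AE x in M. 0 \<le> L x" "integrable M (\<lambda>x. (L x)\<^sup>2)" "(\<integral>x. (L x)\<^sup>2 \<partial>M) \<le> C"
    and M': "integrable M M'" "(\<integral>x. M' x \<partial>M) = 1" "AE x in M. 0 \<le> M' x" "integrable M (\<lambda>x. (M' x)\<^sup>2)" "(\<integral>x. (M' x)\<^sup>2 \<partial>M) \<le> C"
    and B: "B \<in> sets M" "prob B \<le> \<delta>" and K: "0 < K" and \<epsilon>: "0 \<le> \<epsilon>" and \<kappa>: "0 < \<kappa>"
    and ratio: "AE x in M. x \<notin> B \<longrightarrow> (\<exists>\<rho>. \<bar>\<rho>\<bar> \<le> \<epsilon> \<and> L x = \<kappa> * exp \<rho> * M' x)"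
  shows "(\<integral>x. \<bar>L x - M' x\<bar> \<partial>M) \<le> 2 * (\<epsilon> + C / K + K * \<delta>)"
proof (cases "1 \<le> \<kappa>")
  case True
  have "AE x in M. x \<notin> B \<longrightarrow> exp (- \<epsilon>) * M' x \<le> L x"
    using ratio M'(3)
  proof eventually_elim
    case (elim x)
    show ?case
    proof
      assume "x \<notin> B"
      then obtain \<rho> where \<rho>: "\<bar>\<rho>\<bar> \<le> \<epsilon>" "L x = \<kappa> * exp \<rho> * M' x" using elim by auto
      have "1 * exp (- \<epsilon>) \<le> \<kappa> * exp \<rho>" using True \<rho>(1) by (intro mult_mono) auto
      then show "exp (- \<epsilon>) * M' x \<le> L x" using elim unfolding \<rho>(2) by (intro mult_right_mono) auto
    qed
  qed
  from integral_abs_diff_le_of_lower_bound[OF L(1-3) M' B this K \<epsilon>] show ?thesis .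
next
  case False
  have "AE x in M. x \<notin> B \<longrightarrow> exp (- \<epsilon>) * L x \<le> M' x"
    using ratio M'(3)
  proof eventually_elim
    case (elim x)
    show ?case
    proof
      assume "x \<notin> B"
      then obtain \<rho> where \<rho>: "\<bar>\<rho>\<bar> \<le> \<epsilon>" "L x = \<kappa> * exp \<rho> * M' x" using elim by auto
      have "exp (- \<epsilon>) * (\<kappa> * exp \<rho>) \<le> exp (- \<epsilon>) * (1 * exp \<epsilon>)"
        using False \<rho>(1) \<kappa> by (intro mult_mono) auto
      also have "\<dots> = 1" by (simp add: exp_add[symmetric])
      finally have "(exp (- \<epsilon>) * (\<kappa> * exp \<rho>)) * M' x \<le> 1 * M' x" using elim by (intro mult_right_mono) auto
      then show "exp (- \<epsilon>) * L x \<le> M' x" unfolding \<rho>(2) by (simp add: mult.assoc)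
    qed
  qed
  from integral_abs_diff_le_of_lower_bound[OF M'(1-3) L B this K \<epsilon>] show ?thesis
    by (simp add: abs_minus_commute)
qed

section \<open>Tilted densities\<close>

text \<open>
  In place of \<open>1 + r * g x\<close>: with the exponential form the log-likelihood of a sample is the sum of the
  \<open>r * g\<close> over the observations up to a constant, without quadratic terms.
\<close>
definition tilted_density :: "(real \<Rightarrow> real) \<Rightarrow> real \<Rightarrow> real \<Rightarrow> real" where
  "tilted_density g r x = exp (r * g x) / (\<integral>y. exp (r * g y) \<partial>unit_lborel)"

lemma abs_exp_minus_linear_le:
  assumes "\<bar>y :: real\<bar> \<le> 1 / 2"
  shows "\<bar>exp y - 1 - y\<bar> \<le> y\<^sup>2"
proof -
  obtain t where t: "\<bar>t\<bar> \<le> \<bar>y\<bar>" "exp y = (\<Sum>m<2. y ^ m / fact m) + exp t / fact 2 * y ^ 2"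
    using Maclaurin_exp_le[of y 2] by auto
  have e: "exp y - 1 - y = exp t / 2 * y\<^sup>2" using t(2) by (simp add: numeral_2_eq_2)
  have "exp t \<le> exp (1 / 2)" using t(1) assms by simp
  also note exp_half_le2
  finally have "exp t / 2 * y\<^sup>2 \<le> 1 * y\<^sup>2" by (intro mult_right_mono) auto
  then show ?thesis unfolding e by simp
qed

context
  fixes g :: "real \<Rightarrow> real" and K r :: real
  assumes g [measurable]: "g \<in> borel_measurable borel" and gK: "\<And>x. x \<in> {0..1} \<Longrightarrow> \<bar>g x\<bar> \<le> K"
    and g0: "(\<integral>x. g x \<partial>unit_lborel) = 0" and r: "0 \<le> r" "r * K \<le> 1 / 4"
begin

lemma tilted_density_measurable [measurable]: "tilted_density g r \<in> borel_measurable borel"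
  unfolding tilted_density_def[abs_def] by measurable

lemma tilted_density_normalizer:
  "integrable unit_lborel (\<lambda>x. exp (r * g x))"
  "\<bar>(\<integral>x. exp (r * g x) \<partial>unit_lborel) - 1\<bar> \<le> (r * K)\<^sup>2"
proof -
  interpret prob_space unit_lborel by (rule prob_space_unit_lborel)
  have rg: "\<bar>r * g x\<bar> \<le> r * K" if "x \<in> {0..1}" for x
    using gK[OF that] r by (simp add: abs_mult mult_left_mono)
  have gi: "integrable unit_lborel g" using gK by (intro integrable_unit_lborel_bounded[where B = K]) auto
  show ei: "integrable unit_lborel (\<lambda>x. exp (r * g x))"
    using rg by (intro integrable_unit_lborel_bounded[where B = "exp (r * K)"]) (auto simp: abs_le_iff)
  have "(\<integral>x. exp (r * g x) \<partial>unit_lborel) - 1 = (\<integral>x. exp (r * g x) - 1 - r * g x \<partial>unit_lborel)"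
    using ei gi g0 by (simp add: prob_space)
  also have "\<bar>\<dots>\<bar> \<le> (\<integral>x. \<bar>exp (r * g x) - 1 - r * g x\<bar> \<partial>unit_lborel)" by (rule integral_abs_bound)
  also have "\<dots> \<le> (\<integral>x. (r * K)\<^sup>2 \<partial>unit_lborel)"
  proof (rule integral_mono_AE)
    show "integrable unit_lborel (\<lambda>x. \<bar>exp (r * g x) - 1 - r * g x\<bar>)" using ei gi by simp
    show "AE x in unit_lborel. \<bar>exp (r * g x) - 1 - r * g x\<bar> \<le> (r * K)\<^sup>2"
    proof (rule AE_I2)
      fix x assume "x \<in> space unit_lborel"
      then have x: "x \<in> {0..1}" by (simp add: space_unit_lborel)
      have "\<bar>exp (r * g x) - 1 - r * g x\<bar> \<le> (r * g x)\<^sup>2"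
        using rg[OF x] r by (intro abs_exp_minus_linear_le) linarith
      also have "\<dots> \<le> (r * K)\<^sup>2" using power_mono[OF rg[OF x] abs_ge_zero, of 2] by simp
      finally show "\<bar>exp (r * g x) - 1 - r * g x\<bar> \<le> (r * K)\<^sup>2" .
    qed
  qed simp
  also have "\<dots> = (r * K)\<^sup>2" by (simp add: prob_space)
  finally show "\<bar>(\<integral>x. exp (r * g x) \<partial>unit_lborel) - 1\<bar> \<le> (r * K)\<^sup>2" .
qed

lemma tilted_density_normalizer_pos: "0 < (\<integral>x. exp (r * g x) \<partial>unit_lborel)"
proof -
  have "0 \<le> \<bar>g 0\<bar>" "\<bar>g 0\<bar> \<le> K" using gK[of 0] by auto
  then have "0 \<le> r * K" using r by simp
  then have "(r * K)\<^sup>2 \<le> (1 / 4)\<^sup>2" using r by (intro power_mono)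
  then have "(r * K)\<^sup>2 \<le> 1 / 16" by (simp add: power2_eq_square)
  then show ?thesis using tilted_density_normalizer(2) by linarith
qed

lemma tilted_density_expansion:
  assumes x: "x \<in> {0..1}"
  shows "\<bar>tilted_density g r x - 1 - r * g x\<bar> \<le> 3 * (r * K)\<^sup>2"
    and "\<bar>tilted_density g r x - 1\<bar> \<le> 2 * (r * K)"
    and "1 / 2 \<le> tilted_density g r x"
proof -
  define Z where "Z = (\<integral>x. exp (r * g x) \<partial>unit_lborel)"
  define q where "q = r * K"
  have "0 \<le> \<bar>g x\<bar>" "\<bar>g x\<bar> \<le> K" using gK[OF x] by auto
  then have q: "0 \<le> q" "q \<le> 1 / 4" using r by (auto simp: q_def)
  have rg: "\<bar>r * g x\<bar> \<le> q"
    using gK[OF x] r by (simp add: abs_mult mult_left_mono q_def)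
  have qq: "q\<^sup>2 \<le> q * (1 / 4)" using mult_left_mono[OF q(2) q(1)] by (simp add: power2_eq_square)
  have Z: "\<bar>Z - 1\<bar> \<le> q\<^sup>2" using tilted_density_normalizer(2) by (simp add: Z_def q_def)
  then have Z1: "15 / 16 \<le> Z" using qq q by linarith
  have ex: "\<bar>exp (r * g x) - 1 - r * g x\<bar> \<le> q\<^sup>2"
  proof -
    have "\<bar>exp (r * g x) - 1 - r * g x\<bar> \<le> (r * g x)\<^sup>2"
      using rg q by (intro abs_exp_minus_linear_le) linarith
    also have "\<dots> \<le> q\<^sup>2" using power_mono[OF rg abs_ge_zero, of 2] by simp
    finally show ?thesis .
  qed
  have rgZ: "\<bar>r * g x * (Z - 1)\<bar> \<le> (1 / 4) * q\<^sup>2"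
    unfolding abs_mult[of "r * g x"] using rg q Z by (intro mult_mono) auto
  \<comment> \<open>the errors of the exponential and of its normalizer contribute \<open>q\<^sup>2\<close> each, the product \<open>q\<^sup>2 / 4\<close>\<close>
  have "tilted_density g r x - 1 - r * g x = ((exp (r * g x) - 1 - r * g x) - (Z - 1) - r * g x * (Z - 1)) / Z"
    using Z1 by (simp add: tilted_density_def Z_def[symmetric] field_simps)
  also have "\<bar>\<dots>\<bar> = \<bar>(exp (r * g x) - 1 - r * g x) - (Z - 1) - r * g x * (Z - 1)\<bar> / Z"
    using Z1 by (simp add: abs_divide)
  also have "\<dots> \<le> (9 / 4 * q\<^sup>2) / Z"
    using ex Z rgZ Z1 by (intro divide_right_mono) linarith+
  also have "\<dots> \<le> (9 / 4 * q\<^sup>2) / (15 / 16)"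
    using Z1 by (intro divide_left_mono) auto
  also have "\<dots> \<le> 3 * q\<^sup>2" by simp
  finally show 1: "\<bar>tilted_density g r x - 1 - r * g x\<bar> \<le> 3 * (r * K)\<^sup>2" by (simp add: q_def)
  show 2: "\<bar>tilted_density g r x - 1\<bar> \<le> 2 * (r * K)"
    using 1 rg qq q unfolding q_def[symmetric] by linarith
  show "1 / 2 \<le> tilted_density g r x"
    using 2 q unfolding q_def[symmetric] by linarith
qed

lemma tilted_density_nonneg: "0 \<le> tilted_density g r x"
  unfolding tilted_density_def using tilted_density_normalizer_pos by simp

lemma tilted_density_square_integrable: "square_integrable (tilted_density g r)"
proof (rule square_integrable_bounded)
  fix x :: real assume "x \<in> {0..1}"
  then show "\<bar>tilted_density g r x\<bar> \<le> 1 + 2 * (r * K)" using tilted_density_expansion(2)[of x] by linarith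
qed measurable

lemma tilted_density_integral:
  "integrable unit_lborel (tilted_density g r)" "(\<integral>x. tilted_density g r x \<partial>unit_lborel) = 1"
  using square_integrable_integrable[OF tilted_density_square_integrable] tilted_density_normalizer_pos
  by (auto simp: tilted_density_def)

lemma tilted_density_square_integral:
  "(\<integral>x. (tilted_density g r x)\<^sup>2 \<partial>unit_lborel) \<le> 1 + 4 * (r * K)\<^sup>2"
proof -
  interpret prob_space unit_lborel by (rule prob_space_unit_lborel)
  let ?b = "tilted_density g r"
  have i: "integrable unit_lborel (\<lambda>x. (?b x)\<^sup>2)"
    using tilted_density_square_integrable by (simp add: square_integrable_def)
  have e: "(?b x - 1)\<^sup>2 = (?b x)\<^sup>2 - 2 * ?b x + 1" for x by (simp add: power2_eq_square algebra_simps)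
  have "(\<integral>x. (?b x)\<^sup>2 \<partial>unit_lborel) - 1 = (\<integral>x. (?b x - 1)\<^sup>2 \<partial>unit_lborel)"
    unfolding e using i tilted_density_integral by (simp add: prob_space)
  also have "\<dots> \<le> (\<integral>x. 4 * (r * K)\<^sup>2 \<partial>unit_lborel)"
  proof (rule integral_mono_AE)
    show "integrable unit_lborel (\<lambda>x. (?b x - 1)\<^sup>2)" unfolding e using i tilted_density_integral by simp
    show "AE x in unit_lborel. (?b x - 1)\<^sup>2 \<le> 4 * (r * K)\<^sup>2"
    proof (rule AE_I2)
      fix x assume "x \<in> space unit_lborel"
      then have "\<bar>?b x - 1\<bar> \<le> 2 * (r * K)" using tilted_density_expansion(2)[of x] by (simp add: space_unit_lborel)
      from power_mono[OF this abs_ge_zero, of 2] show "(?b x - 1)\<^sup>2 \<le> 4 * (r * K)\<^sup>2" by (simp add: power2_eq_square)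
    qed
  qed simp
  also have "\<dots> = 4 * (r * K)\<^sup>2" by (simp add: prob_space)
  finally show ?thesis by simp
qed

end

section \<open>The likelihood as a function of the spacings\<close>

lemma prod_order_stat:
  fixes f :: "real \<Rightarrow> 'b :: comm_monoid_mult"
  shows "(\<Prod>i\<in>{1..n}. f (order_stat n X i)) = (\<Prod>i\<in>{1..n}. f (X i))"
proof -
  let ?xs = "map X [1..<n + 1]"
  have len: "length (sort ?xs) = n" by simp
  have "(\<Prod>i\<in>{1..n}. f (order_stat n X i)) = (\<Prod>i\<in>{1..n}. f (sort ?xs ! (i - 1)))"
    by (intro prod.cong refl) (auto simp: order_stat_def simp del: upt_Suc)
  also have "\<dots> = (\<Prod>k\<in>{0..<n}. f (sort ?xs ! k))"
    by (rule prod.reindex_bij_witness[where i = Suc and j = "\<lambda>i. i - 1"]) auto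
  also have "\<dots> = prod_list (map f (sort ?xs))"
    unfolding prod.list_conv_set_nth using len by (intro prod.cong) (auto simp del: upt_Suc)
  also have "\<dots> = prod_mset (image_mset f (mset ?xs))"
    by (simp only: prod_mset_prod_list[symmetric] mset_map mset_sort)
  also have "\<dots> = prod_list (map (\<lambda>i. f (X i)) [1..<n + 1])"
    by (simp only: prod_mset_prod_list[symmetric] mset_map[symmetric] map_map o_def)
  also have "\<dots> = (\<Prod>i\<in>set [1..<n + 1]. f (X i))"
    by (rule prod.distinct_set_conv_list[symmetric]) simp
  also have "set [1..<n + 1] = {1..n}" by auto
  finally show ?thesis .
qed

lemma integral_spacings_normalize:
  fixes F :: "(nat \<Rightarrow> real) \<Rightarrow> real"
  assumes F: "F \<in> borel_measurable (borel_PiM {1..n + 1})"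
  shows "(\<integral>X. F (spacings n X) \<partial>uniform_PiM {1..n})
       = (\<integral>x. F (normalize_sum n x) \<partial>exponential_PiM {1..n + 1})"
    and "integrable (uniform_PiM {1..n}) (\<lambda>X. F (spacings n X))
       \<longleftrightarrow> integrable (exponential_PiM {1..n + 1}) (\<lambda>x. F (normalize_sum n x))"
proof -
  have nm: "normalize_sum n \<in> exponential_PiM {1..n + 1} \<rightarrow>\<^sub>M borel_PiM {1..n + 1}"
    using measurable_normalize_sum by (simp only: measurable_PiM_exponential_iff)
  show "(\<integral>X. F (spacings n X) \<partial>uniform_PiM {1..n})
       = (\<integral>x. F (normalize_sum n x) \<partial>exponential_PiM {1..n + 1})"
    unfolding integral_distr[OF measurable_spacings_unit F, symmetric] integral_distr[OF nm F, symmetric]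
      distr_spacings_eq_distr_normalize ..
  show "integrable (uniform_PiM {1..n}) (\<lambda>X. F (spacings n X))
       \<longleftrightarrow> integrable (exponential_PiM {1..n + 1}) (\<lambda>x. F (normalize_sum n x))"
    unfolding integrable_distr_eq[OF measurable_spacings_unit F, symmetric] integrable_distr_eq[OF nm F, symmetric]
      distr_spacings_eq_distr_normalize ..
qed

text \<open>
  The partial sums of the spacings are the order statistics, and a product over the sample is a product
  over the order statistics. So the likelihood of a sample from the density \<open>b\<close> is a function of its
  spacings.
\<close>
definition gap_likelihood :: "(real \<Rightarrow> real) \<Rightarrow> nat \<Rightarrow> (nat \<Rightarrow> real) \<Rightarrow> real" where
  "gap_likelihood b n d = (\<Prod>i\<in>{1..n}. b (\<Sum>j\<in>{1..i}. d j))"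

lemma gap_likelihood_spacings: "gap_likelihood b n (spacings n X) = (\<Prod>i\<in>{1..n}. b (X i))"
proof -
  have "gap_likelihood b n (spacings n X) = (\<Prod>i\<in>{1..n}. b (order_stat n X i))"
    unfolding gap_likelihood_def by (intro prod.cong refl arg_cong[where f = b] sum_spacings) auto
  then show ?thesis by (simp only: prod_order_stat)
qed

lemma measurable_gap_likelihood:
  assumes [measurable]: "b \<in> borel_measurable borel"
  shows "gap_likelihood b n \<in> borel_measurable (borel_PiM {1..n + 1})"
  unfolding gap_likelihood_def[abs_def]
proof (intro borel_measurable_prod measurable_compose[OF borel_measurable_sum assms])
  fix i j assume "i \<in> {1..n}" "j \<in> {1..i}"
  then show "(\<lambda>d. d j) \<in> borel_measurable (borel_PiM {1..n + 1})"
    by (intro measurable_component_singleton) auto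
qed

lemma integral_gap_likelihood:
  assumes b: "b \<in> borel_measurable borel" and bi: "integrable unit_lborel b"
  shows "integrable (exponential_PiM {1..n + 1}) (\<lambda>x. gap_likelihood b n (normalize_sum n x))"
    and "(\<integral>x. gap_likelihood b n (normalize_sum n x) \<partial>exponential_PiM {1..n + 1})
       = (\<integral>x. b x \<partial>unit_lborel) ^ n"
proof -
  interpret product_sigma_finite "\<lambda>_. unit_lborel" by (rule product_sigma_finite_unit)
  note m = measurable_gap_likelihood[OF b, of n]
  have "integrable (uniform_PiM {1..n}) (\<lambda>X. gap_likelihood b n (spacings n X))"
    unfolding gap_likelihood_spacings by (intro product_integrable_prod bi) simp
  then show "integrable (exponential_PiM {1..n + 1}) (\<lambda>x. gap_likelihood b n (normalize_sum n x))"
    by (simp only: integral_spacings_normalize(2)[OF m])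
  have "(\<integral>X. gap_likelihood b n (spacings n X) \<partial>uniform_PiM {1..n}) = (\<Prod>i\<in>{1..n}. \<integral>x. b x \<partial>unit_lborel)"
    unfolding gap_likelihood_spacings by (intro product_integral_prod bi) simp
  then show "(\<integral>x. gap_likelihood b n (normalize_sum n x) \<partial>exponential_PiM {1..n + 1})
       = (\<integral>x. b x \<partial>unit_lborel) ^ n"
    by (simp only: integral_spacings_normalize(1)[OF m] prod_constant card_atLeastAtMost diff_Suc_1)
qed

text \<open>
  With the exponentials \<open>x\<close> normalized to spacings, the \<open>i\<close>-th order statistic deviates from \<open>i / (n + 1)\<close>
  by about \<open>\<Sum>j. (of_bool (j \<le> i) - i / (n + 1)) * x j / (n + 1)\<close>. The weight is minus the coefficient of
  \<open>x j\<close> after multiplying by \<open>g' (i / (n + 1)) / sqrt n\<close> and summing over \<open>i\<close>. If \<open>g'\<close> is the derivative of a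
  function \<open>g\<close> with mean zero, this is roughly \<open>g (j / (n + 1)) / sqrt n\<close>: spacings in a region of higher
  density behave like exponentials of a higher rate.
\<close>
definition gap_weight :: "(real \<Rightarrow> real) \<Rightarrow> nat \<Rightarrow> nat \<Rightarrow> real" where
  "gap_weight g' n j = - (\<Sum>i\<in>{1..n}. g' (real i / real (n + 1)) * (of_bool (j \<le> i) - real i / real (n + 1)))
      / (real (n + 1) * sqrt (real n))"

lemma sum_bridge_coefficients:
  assumes "i \<le> n"
  shows "(\<Sum>j\<in>{1..n + 1}. of_bool (j \<le> i) - real i / real (n + 1)) = 0"
proof -
  have "(\<Sum>j\<in>{1..n + 1}. of_bool (j \<le> i) :: real) = real (card ({1..n + 1} \<inter> {j. j \<le> i}))"
    by (simp add: of_bool_def sum.If_cases del: sum.cl_ivl_Suc)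
  also have "{1..n + 1} \<inter> {j. j \<le> i} = {1..i}" using assms by auto
  finally show ?thesis by (simp add: sum_subtractf del: sum.cl_ivl_Suc)
qed

lemma sum_gap_weight: "sum (gap_weight g' n) {1..n + 1} = 0"
proof -
  have "(\<Sum>j\<in>{1..n + 1}. \<Sum>i\<in>{1..n}. g' (real i / real (n + 1)) * (of_bool (j \<le> i) - real i / real (n + 1)))
      = (\<Sum>i\<in>{1..n}. g' (real i / real (n + 1)) * (\<Sum>j\<in>{1..n + 1}. of_bool (j \<le> i) - real i / real (n + 1)))"
    unfolding sum_distrib_left by (rule sum.swap)
  also have "\<dots> = 0" by (intro sum.neutral ballI) (simp only: sum_bridge_coefficients atLeastAtMost_iff mult_zero_right)
  finally show ?thesis
    unfolding gap_weight_def sum_divide_distrib[symmetric] sum_negf by simp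
qed

lemma abs_bridge_coefficient_le: "i \<le> n \<Longrightarrow> \<bar>of_bool P - real i / real (n + 1)\<bar> \<le> 1"
  by (cases P) (auto simp: abs_le_iff divide_simps)

lemma abs_gap_weight_le:
  assumes n: "0 < n" and K: "\<And>x. x \<in> {0..1} \<Longrightarrow> \<bar>g' x\<bar> \<le> K"
  shows "\<bar>gap_weight g' n j\<bar> \<le> K / sqrt (real n)"
proof -
  have "0 \<le> \<bar>g' 0\<bar>" "\<bar>g' 0\<bar> \<le> K" using K[of 0] by auto
  then have K0: "0 \<le> K" by linarith
  have "\<bar>\<Sum>i\<in>{1..n}. g' (real i / real (n + 1)) * (of_bool (j \<le> i) - real i / real (n + 1))\<bar> \<le> (\<Sum>i\<in>{1..n}. K * 1)"
  proof (rule order_trans[OF sum_abs sum_mono])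
    fix i assume i: "i \<in> {1..n}"
    have "real i / real (n + 1) \<in> {0..1}" using i by (auto simp: divide_simps)
    then show "\<bar>g' (real i / real (n + 1)) * (of_bool (j \<le> i) - real i / real (n + 1))\<bar> \<le> K * 1"
      unfolding abs_mult using i K0 by (intro mult_mono K abs_bridge_coefficient_le) auto
  qed
  also have "\<dots> \<le> K * real (n + 1)" using K0 by (simp add: algebra_simps)
  finally have "\<bar>gap_weight g' n j\<bar> \<le> (K * real (n + 1)) / (real (n + 1) * sqrt (real n))"
    unfolding gap_weight_def abs_divide abs_minus_cancel by (intro frac_le) (use n K0 in auto)
  then show ?thesis using n by (simp add: divide_simps split: if_splits)
qed


text \<open>
  In both cases the coefficients allow \<open>x j\<close> to be replaced by the centered \<open>x j - 1\<close>; for the second one because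
  they sum to zero.
\<close>
lemma exponential_quadratic_moments:
  fixes n :: nat
  defines "E \<equiv> exponential_PiM {1..n + 1}" and "m \<equiv> real (n + 1)"
  shows "integrable E (\<lambda>x. ((\<Sum>j\<in>{1..n + 1}. x j) - m)\<^sup>2)" "(\<integral>x. ((\<Sum>j\<in>{1..n + 1}. x j) - m)\<^sup>2 \<partial>E) = m"
    and "i \<le> n \<Longrightarrow> integrable E (\<lambda>x. (\<Sum>j\<in>{1..n + 1}. (of_bool (j \<le> i) - real i / m) * x j)\<^sup>2)"
      "i \<le> n \<Longrightarrow> (\<integral>x. (\<Sum>j\<in>{1..n + 1}. (of_bool (j \<le> i) - real i / m) * x j)\<^sup>2 \<partial>E) \<le> m"
proof -
  have fin: "finite {1..n + 1}" by simp
  note sm = second_moment_sum_centered[OF prob_space_std_exponential fin std_exponential_centered]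
  have 1: "(\<Sum>j\<in>{1..n + 1}. x j) - m = (\<Sum>j\<in>{1..n + 1}. 1 * (x j - 1))" for x :: "nat \<Rightarrow> real"
    by (simp add: sum_subtractf m_def del: sum.cl_ivl_Suc)
  show "integrable E (\<lambda>x. ((\<Sum>j\<in>{1..n + 1}. x j) - m)\<^sup>2)" "(\<integral>x. ((\<Sum>j\<in>{1..n + 1}. x j) - m)\<^sup>2 \<partial>E) = m"
    unfolding 1 E_def using sm[of "\<lambda>_. 1"] by (simp_all add: m_def del: sum.cl_ivl_Suc)
  assume i: "i \<le> n"
  have 2: "(\<lambda>x :: nat \<Rightarrow> real. (\<Sum>j\<in>{1..n + 1}. (of_bool (j \<le> i) - real i / m) * x j)\<^sup>2)
      = (\<lambda>x. (\<Sum>j\<in>{1..n + 1}. (of_bool (j \<le> i) - real i / m) * (x j - 1))\<^sup>2)"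
    unfolding right_diff_distrib mult_1_right sum_subtractf m_def
    using sum_bridge_coefficients[OF i] by (simp only: sum_subtractf diff_zero)
  show "integrable E (\<lambda>x. (\<Sum>j\<in>{1..n + 1}. (of_bool (j \<le> i) - real i / m) * x j)\<^sup>2)"
    unfolding 2 E_def by (rule sm(1))
  have "(\<integral>x. (\<Sum>j\<in>{1..n + 1}. (of_bool (j \<le> i) - real i / m) * x j)\<^sup>2 \<partial>E)
      = (\<Sum>j\<in>{1..n + 1}. (of_bool (j \<le> i) - real i / m)\<^sup>2)"
    unfolding 2 E_def by (rule sm(2))
  also have "\<dots> \<le> (\<Sum>j\<in>{1..n + 1}. 1)"
  proof (rule sum_mono)
    fix j
    show "(of_bool (j \<le> i) - real i / m)\<^sup>2 \<le> 1"
      using power_mono[OF abs_bridge_coefficient_le[OF i] abs_ge_zero, of "j \<le> i" 2] by (simp add: m_def)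
  qed
  also have "\<dots> = m" by (simp add: m_def)
  finally show "(\<integral>x. (\<Sum>j\<in>{1..n + 1}. (of_bool (j \<le> i) - real i / m) * x j)\<^sup>2 \<partial>E) \<le> m" .
qed

section \<open>Linearization of the log-likelihood\<close>

text \<open>
  Besides the Taylor remainder there is the error of dividing \<open>W\<close> by the constant \<open>m\<close> instead of the random
  total \<open>S\<close>. Both are quadratic in the fluctuations \<open>W\<close> and \<open>S - m\<close>.
\<close>
lemma C11_bound_rescaled_increment:
  assumes C: "C11_bound K g g'" and u: "u \<in> {0..1}" and t: "t \<in> {0..1}" and m: "0 < m" and S: "\<bar>S - m\<bar> \<le> m / 2"
  defines "W \<equiv> S * (u - t)"
  shows "\<bar>g u - g t - g' t * W / m\<bar> \<le> 5 * K / m\<^sup>2 * (W\<^sup>2 + (S - m)\<^sup>2)"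
proof -
  have K: "0 \<le> K" using C by (rule C11_bound_nonneg)
  have S2: "m / 2 \<le> S" "0 < S" using S m by linarith+
  have u_t: "u - t = W / S" using S2 by (simp add: W_def)
  have "\<bar>g u - g t - g' t * (u - t)\<bar> \<le> K * (W / S)\<^sup>2"
    using C u t unfolding C11_bound_def u_t[symmetric] by auto
  also have "(W / S)\<^sup>2 \<le> (W / (m / 2))\<^sup>2"
  proof -
    have "\<bar>W\<bar> / S \<le> \<bar>W\<bar> / (m / 2)" using S2 m by (intro divide_left_mono) auto
    then show ?thesis using S2 m by (intro abs_le_square_iff[THEN iffD1]) (simp add: abs_divide)
  qed
  also have "\<dots> = 4 * W\<^sup>2 / m\<^sup>2" by (simp add: power2_eq_square)
  finally have 1: "\<bar>g u - g t - g' t * (u - t)\<bar> \<le> K * (4 * W\<^sup>2 / m\<^sup>2)"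
    using K by (simp add: mult_left_mono)
  have "g' t * (u - t) - g' t * W / m = g' t * (W * (m - S)) / (S * m)"
    unfolding u_t using S2 m by (simp add: field_simps)
  also have "\<bar>\<dots>\<bar> = \<bar>g' t\<bar> * \<bar>W * (m - S)\<bar> / (S * m)"
    using S2 m by (simp add: abs_mult abs_divide)
  also have "\<dots> \<le> K * ((W\<^sup>2 + (S - m)\<^sup>2) / 2) / (m / 2 * m)"
  proof (intro frac_le mult_mono mult_nonneg_nonneg)
    show "\<bar>g' t\<bar> \<le> K" using C t by (simp add: C11_bound_def)
    have "0 \<le> (\<bar>W\<bar> - \<bar>S - m\<bar>)\<^sup>2" by simp
    also have "\<dots> = W\<^sup>2 + (S - m)\<^sup>2 - 2 * (\<bar>W\<bar> * \<bar>S - m\<bar>)"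
      unfolding power2_diff power2_abs by simp
    finally show "\<bar>W * (m - S)\<bar> \<le> (W\<^sup>2 + (S - m)\<^sup>2) / 2"
      by (simp add: abs_mult abs_minus_commute)
  qed (use K S2 m in auto)
  also have "\<dots> = K * ((W\<^sup>2 + (S - m)\<^sup>2) / m\<^sup>2)" using m by (simp add: power2_eq_square)
  finally have 2: "\<bar>g' t * (u - t) - g' t * W / m\<bar> \<le> K * ((W\<^sup>2 + (S - m)\<^sup>2) / m\<^sup>2)" .
  have split: "g u - g t - g' t * W / m = (g u - g t - g' t * (u - t)) + (g' t * (u - t) - g' t * W / m)"
    by simp
  have "\<bar>g u - g t - g' t * W / m\<bar> \<le> \<bar>g u - g t - g' t * (u - t)\<bar> + \<bar>g' t * (u - t) - g' t * W / m\<bar>"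
    unfolding split by (rule abs_triangle_ineq)
  also have "\<dots> \<le> K * (4 * W\<^sup>2 / m\<^sup>2) + K * ((W\<^sup>2 + (S - m)\<^sup>2) / m\<^sup>2)" by (rule add_mono[OF 1 2])
  also have "\<dots> = K / m\<^sup>2 * (5 * W\<^sup>2 + (S - m)\<^sup>2)" using m by (simp add: field_simps)
  also have "\<dots> \<le> K / m\<^sup>2 * (5 * (W\<^sup>2 + (S - m)\<^sup>2))" using K by (intro mult_left_mono) auto
  finally show ?thesis by (simp add: ac_simps)
qed

text \<open>
  The fluctuation of a partial sum around its share of the total. Divided by the total, it is the deviation
  of the \<open>i\<close>-th order statistic from \<open>i / (n + 1)\<close>.
\<close>
definition bridge :: "nat \<Rightarrow> nat \<Rightarrow> (nat \<Rightarrow> real) \<Rightarrow> real" where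
  "bridge n i x = (\<Sum>j\<in>{1..n + 1}. (of_bool (j \<le> i) - real i / real (n + 1)) * x j)"

lemma bridge_eq:
  assumes i: "i \<le> n" and S: "(\<Sum>j\<in>{1..n + 1}. x j) \<noteq> 0"
  shows "bridge n i x = (\<Sum>j\<in>{1..n + 1}. x j) * ((\<Sum>j\<in>{1..i}. normalize_sum n x j) - real i / real (n + 1))"
proof -
  let ?S = "\<Sum>j\<in>{1..n + 1}. x j"
  have "(\<Sum>j\<in>{1..n + 1}. of_bool (j \<le> i) * x j) = (\<Sum>j\<in>{1..n + 1}. if j \<in> {1..i} then x j else 0)"
    by (intro sum.cong refl) auto
  also have "\<dots> = (\<Sum>j\<in>{1..n + 1} \<inter> {1..i}. x j)" by (rule sum.inter_restrict[symmetric]) simp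
  also have "{1..n + 1} \<inter> {1..i} = {1..i}" using i by auto
  finally have 1: "(\<Sum>j\<in>{1..n + 1}. of_bool (j \<le> i) * x j) = (\<Sum>j\<in>{1..i}. x j)" .
  have "(\<Sum>j\<in>{1..i}. normalize_sum n x j) = (\<Sum>j\<in>{1..i}. x j / ?S)"
    using i by (intro sum.cong refl) (simp add: normalize_sum_def)
  then have "(\<Sum>j\<in>{1..i}. normalize_sum n x j) = (\<Sum>j\<in>{1..i}. x j) / ?S"
    by (simp only: sum_divide_distrib)
  then have 2: "?S * (\<Sum>j\<in>{1..i}. normalize_sum n x j) = (\<Sum>j\<in>{1..i}. x j)" using S by simp
  have "bridge n i x = (\<Sum>j\<in>{1..n + 1}. of_bool (j \<le> i) * x j) - real i / real (n + 1) * ?S"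
    unfolding bridge_def left_diff_distrib sum_subtractf sum_distrib_left ..
  then show ?thesis unfolding 1 right_diff_distrib 2 by simp
qed

lemma exp_tilt_gap_weight:
  "exp_tilt {1..n + 1} (gap_weight g' n) x = (\<Prod>j\<in>{1..n + 1}. 1 + gap_weight g' n j) *
     exp ((\<Sum>i\<in>{1..n}. g' (real i / real (n + 1)) * bridge n i x / real (n + 1)) / sqrt (real n))"
proof -
  let ?c = "\<lambda>i j. of_bool (j \<le> i) - real i / real (n + 1)"
  have "(\<Sum>j\<in>{1..n + 1}. - gap_weight g' n j * x j)
      = (\<Sum>j\<in>{1..n + 1}. \<Sum>i\<in>{1..n}. g' (real i / real (n + 1)) * ?c i j * x j / (real (n + 1) * sqrt (real n)))"
    unfolding gap_weight_def minus_divide_left minus_minus times_divide_eq_left sum_divide_distrib sum_distrib_right ..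
  also have "\<dots> = (\<Sum>i\<in>{1..n}. \<Sum>j\<in>{1..n + 1}. g' (real i / real (n + 1)) * ?c i j * x j / (real (n + 1) * sqrt (real n)))"
    by (rule sum.swap)
  also have "\<dots> = (\<Sum>i\<in>{1..n}. g' (real i / real (n + 1)) * bridge n i x / real (n + 1)) / sqrt (real n)"
    unfolding bridge_def sum_divide_distrib sum_distrib_left divide_divide_eq_left mult.assoc ..
  finally have e: "(\<Sum>j\<in>{1..n + 1}. - gap_weight g' n j * x j)
     = (\<Sum>i\<in>{1..n}. g' (real i / real (n + 1)) * bridge n i x / real (n + 1)) / sqrt (real n)" .
  show ?thesis
    unfolding exp_tilt_def prod.distrib e[symmetric] by (simp only: exp_sum finite_atLeastAtMost)
qed

text \<open>
  Up to the error \<open>\<rho>\<close>, the log-likelihood is an affine function of the exponentials, hence the logarithm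
  of an exponential tilt plus a constant. The constant is gathered in the fraction in front.
\<close>
lemma gap_likelihood_linearization:
  fixes x :: "nat \<Rightarrow> real"
  assumes C: "C11_bound K g g'" and n: "0 < n" and x: "\<And>j. j \<in> {1..n + 1} \<Longrightarrow> 0 \<le> x j"
    and S: "\<bar>(\<Sum>j\<in>{1..n + 1}. x j) - real (n + 1)\<bar> \<le> real (n + 1) / 2"
    and a: "\<And>j. 1 + gap_weight g' n j > 0"
  shows "\<exists>\<rho>. \<bar>\<rho>\<bar> \<le> 5 * K / (real (n + 1))\<^sup>2 / sqrt (real n) *
            (\<Sum>i\<in>{1..n}. (bridge n i x)\<^sup>2 + ((\<Sum>j\<in>{1..n + 1}. x j) - real (n + 1))\<^sup>2)
     \<and> gap_likelihood (tilted_density g (1 / sqrt (real n))) n (normalize_sum n x)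
       = (exp ((\<Sum>i\<in>{1..n}. g (real i / real (n + 1))) / sqrt (real n))
            / (\<integral>y. exp (1 / sqrt (real n) * g y) \<partial>unit_lborel) ^ n / (\<Prod>j\<in>{1..n + 1}. 1 + gap_weight g' n j))
         * exp \<rho> * exp_tilt {1..n + 1} (gap_weight g' n) x"
proof -
  define m where "m = real (n + 1)"
  define Sx where "Sx = (\<Sum>j\<in>{1..n + 1}. x j)"
  define U where "U i = (\<Sum>j\<in>{1..i}. normalize_sum n x j)" for i
  define t where "t i = real i / m" for i
  define W where "W i = bridge n i x" for i
  define s where "s = sqrt (real n)"
  define \<rho> where "\<rho> = (\<Sum>i\<in>{1..n}. g (U i) - g (t i) - g' (t i) * W i / m) / s"
  have s: "0 < s" using n by (simp add: s_def)
  have m: "0 < m" by (simp add: m_def)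
  have S': "\<bar>Sx - m\<bar> \<le> m / 2" using S by (simp add: Sx_def m_def)
  then have Sx: "0 < Sx" using m by linarith
  have nn: "0 \<le> normalize_sum n x j" if "j \<in> {1..n + 1}" for j
    using x[OF that] that Sx by (simp add: normalize_sum_def Sx_def)
  have total: "(\<Sum>j\<in>{1..n + 1}. normalize_sum n x j) = 1"
  proof -
    have "(\<Sum>j\<in>{1..n + 1}. normalize_sum n x j) = (\<Sum>j\<in>{1..n + 1}. x j / Sx)"
      by (intro sum.cong refl) (simp add: normalize_sum_def Sx_def)
    also have "\<dots> = Sx / Sx" by (simp only: Sx_def sum_divide_distrib)
    finally show ?thesis using Sx by simp
  qed
  have U: "U i \<in> {0..1}" if "i \<in> {1..n}" for i
  proof -
    have "U i \<le> (\<Sum>j\<in>{1..n + 1}. normalize_sum n x j)"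
      unfolding U_def using that nn by (intro sum_mono2) auto
    moreover have "0 \<le> U i" unfolding U_def using that nn by (intro sum_nonneg) auto
    ultimately show ?thesis using total by simp
  qed
  have t: "t i \<in> {0..1}" if "i \<in> {1..n}" for i using that by (auto simp: t_def m_def divide_simps)
  have W: "W i = Sx * (U i - t i)" if "i \<in> {1..n}" for i
    using that Sx bridge_eq[of i n x] by (simp add: W_def U_def t_def m_def Sx_def)
  have "\<bar>\<rho>\<bar> = \<bar>\<Sum>i\<in>{1..n}. g (U i) - g (t i) - g' (t i) * W i / m\<bar> / s"
    using s by (simp add: \<rho>_def abs_divide)
  also have "\<dots> \<le> (\<Sum>i\<in>{1..n}. 5 * K / m\<^sup>2 * ((W i)\<^sup>2 + (Sx - m)\<^sup>2)) / s"
  proof (intro divide_right_mono order_trans[OF sum_abs sum_mono])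
    fix i assume i: "i \<in> {1..n}"
    show "\<bar>g (U i) - g (t i) - g' (t i) * W i / m\<bar> \<le> 5 * K / m\<^sup>2 * ((W i)\<^sup>2 + (Sx - m)\<^sup>2)"
      unfolding W[OF i] by (rule C11_bound_rescaled_increment[OF C U[OF i] t[OF i] m S'])
  qed (use s in simp)
  also have "\<dots> = 5 * K / m\<^sup>2 / s * (\<Sum>i\<in>{1..n}. (W i)\<^sup>2 + (Sx - m)\<^sup>2)"
    unfolding sum_distrib_left[symmetric] by (simp only: times_divide_eq_left)
  finally have \<rho>: "\<bar>\<rho>\<bar> \<le> 5 * K / m\<^sup>2 / s * (\<Sum>i\<in>{1..n}. (W i)\<^sup>2 + (Sx - m)\<^sup>2)" .
  define Z where "Z = (\<integral>y. exp (1 / s * g y) \<partial>unit_lborel)"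
  define Q where "Q = (\<Prod>j\<in>{1..n + 1}. 1 + gap_weight g' n j)"
  have Q: "Q \<noteq> 0" unfolding Q_def using a by (intro prod_pos[THEN less_imp_neq[THEN not_sym]]) auto
  have "gap_likelihood (tilted_density g (1 / s)) n (normalize_sum n x) = (\<Prod>i\<in>{1..n}. exp (1 / s * g (U i)) / Z)"
    by (simp add: gap_likelihood_def tilted_density_def U_def Z_def)
  also have "\<dots> = exp (\<Sum>i\<in>{1..n}. 1 / s * g (U i)) / Z ^ n"
    unfolding prod_dividef exp_sum[OF finite_atLeastAtMost] prod_constant card_atLeastAtMost diff_Suc_1 ..
  also have "(\<Sum>i\<in>{1..n}. 1 / s * g (U i))
     = (\<Sum>i\<in>{1..n}. g (t i)) / s + \<rho> + (\<Sum>i\<in>{1..n}. g' (t i) * W i / m) / s"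
    unfolding \<rho>_def sum_subtractf by (simp add: sum_divide_distrib[symmetric] diff_divide_distrib)
  also have "exp ((\<Sum>i\<in>{1..n}. g (t i)) / s + \<rho> + (\<Sum>i\<in>{1..n}. g' (t i) * W i / m) / s) / Z ^ n
     = (exp ((\<Sum>i\<in>{1..n}. g (t i)) / s) / Z ^ n / Q) * exp \<rho> * (Q * exp ((\<Sum>i\<in>{1..n}. g' (t i) * W i / m) / s))"
    using Q by (simp add: exp_add)
  also have "Q * exp ((\<Sum>i\<in>{1..n}. g' (t i) * W i / m) / s) = exp_tilt {1..n + 1} (gap_weight g' n) x"
    by (simp only: exp_tilt_gap_weight Q_def t_def W_def m_def s_def)
  finally have "gap_likelihood (tilted_density g (1 / s)) n (normalize_sum n x)
     = (exp ((\<Sum>i\<in>{1..n}. g (t i)) / s) / Z ^ n / Q) * exp \<rho> * exp_tilt {1..n + 1} (gap_weight g' n) x" .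
  with \<rho> show ?thesis
    unfolding m_def[symmetric] s_def[symmetric] Sx_def[symmetric] W_def[symmetric] Z_def[symmetric] Q_def[symmetric] t_def[symmetric]
    by blast
qed

lemma measurable_bridge: "bridge n i \<in> borel_measurable (borel_PiM {1..n + 1})"
  unfolding bridge_def[abs_def]
  by (intro borel_measurable_sum borel_measurable_times borel_measurable_const measurable_component_singleton)

abbreviation uniform_expect :: "nat \<Rightarrow> ((nat \<Rightarrow> real) \<Rightarrow> real) \<Rightarrow> real" where
  "uniform_expect n T \<equiv> \<integral>X. T (spacings n X) \<partial>uniform_PiM {1..n}"

abbreviation tilted_expect :: "nat \<Rightarrow> (real \<Rightarrow> real) \<Rightarrow> ((nat \<Rightarrow> real) \<Rightarrow> real) \<Rightarrow> real" where
  "tilted_expect n g T \<equiv> \<integral>X. T (spacings n X) *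
     (\<Prod>i\<in>{1..n}. tilted_density g (1 / sqrt (real n)) (X i)) \<partial>uniform_PiM {1..n}"

text \<open>
  On the space of the exponentials, \<open>L\<close> is the likelihood ratio of the tilted density and \<open>M'\<close> that of the
  approximating model of independent exponentials. They are nearly proportional outside a set \<open>B\<close> of small
  probability, hence close in mean, and against \<open>M'\<close> symmetric tests are powerless.
\<close>
lemma symmetric_test_tilted_bound:
  fixes T :: "(nat \<Rightarrow> real) \<Rightarrow> real"
  assumes g: "g \<in> borel_measurable borel" and C: "C11_bound K g g'" and g0: "(\<integral>x. g x \<partial>unit_lborel) = 0"
    and n: "0 < n" and small: "K / sqrt (real n) \<le> 1 / 4"
    and T: "T \<in> borel_measurable (borel_PiM {1..n + 1})" "\<And>d. 0 \<le> T d" "\<And>d. T d \<le> 1"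
    and sym: "\<And>\<pi> d. \<pi> permutes {1..n + 1} \<Longrightarrow> d \<in> extensional {1..n + 1} \<Longrightarrow> T (\<lambda>i\<in>{1..n + 1}. d (\<pi> i)) = T d"
    and \<epsilon>: "0 < \<epsilon>" and A: "0 < A" and e: "0 < e"
      "symmetrization_bound (real (n + 1)) (K / sqrt (real n)) - 1 \<le> e\<^sup>2"
  shows "\<bar>tilted_expect n g T
          - uniform_expect n T\<bar>
       \<le> 2 * (\<epsilon> + exp (4 * K\<^sup>2) / A + A * (4 / real (n + 1) + 10 * K / sqrt (real n) / \<epsilon>)) + e"
proof -
  define m where "m = real (n + 1)"
  define s where "s = sqrt (real n)"
  define \<delta> where "\<delta> = K / s"
  define b where "b = tilted_density g (1 / s)"
  define a where "a = gap_weight g' n"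
  define E where "E = exponential_PiM {1..n + 1}"
  define L where "L x = gap_likelihood b n (normalize_sum n x)" for x
  define M' where "M' = exp_tilt {1..n + 1} a"
  define \<tau> where "\<tau> x = T (normalize_sum n x)" for x
  define S where "S x = (\<Sum>j\<in>{1..n + 1}. x j)" for x :: "nat \<Rightarrow> real"
  define Q where "Q x = 5 * K / m\<^sup>2 / s * (\<Sum>i\<in>{1..n}. (bridge n i x)\<^sup>2 + (S x - m)\<^sup>2)" for x
  interpret E: prob_space E unfolding E_def by (intro prob_space_PiM prob_space_std_exponential)
  have K: "0 \<le> K" using C by (rule C11_bound_nonneg)
  have s: "0 < s" "s\<^sup>2 = real n" using n by (auto simp: s_def)
  have m: "0 < m" by (simp add: m_def)
  have \<delta>: "0 \<le> \<delta>" "\<delta> \<le> 1 / 4" using K s small by (auto simp: \<delta>_def s_def)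
  have cardI: "card {1..n + 1} = n + 1" by simp
  have gK: "\<bar>g x\<bar> \<le> K" if "x \<in> {0..1}" for x using C that by (simp add: C11_bound_def)
  have g'K: "\<bar>g' x\<bar> \<le> K" if "x \<in> {0..1}" for x using C that by (simp add: C11_bound_def)
  have r: "0 \<le> 1 / s" "1 / s * K \<le> 1 / 4" using s \<delta> by (auto simp: \<delta>_def)
  note tilt = g gK g0 r
  have rK: "1 / s * K = \<delta>" by (simp add: \<delta>_def)
  have bm [measurable]: "b \<in> borel_measurable borel" unfolding b_def by (rule tilted_density_measurable[OF tilt])
  have ad: "\<bar>a j\<bar> \<le> \<delta>" for j unfolding a_def \<delta>_def s_def by (rule abs_gap_weight_le[OF n g'K])
  have a4: "\<bar>a j\<bar> \<le> 1 / 4" for j using ad[of j] \<delta> by linarith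
  have m\<delta>: "2 * m * \<delta>\<^sup>2 \<le> 4 * K\<^sup>2"
  proof -
    have "m \<le> 2 * real n" using n by (simp add: m_def)
    then have "2 * m * \<delta>\<^sup>2 \<le> 2 * (2 * real n) * \<delta>\<^sup>2" by (intro mult_right_mono mult_left_mono) auto
    also have "\<dots> = 4 * K\<^sup>2" using s n by (simp add: \<delta>_def power_divide)
    finally show ?thesis .
  qed
  \<comment> \<open>second moments bounded independently of \<open>n\<close> control both ratios on the exceptional event\<close>
  have fin: "finite {1..n + 1}" by simp
  have Mi: "integrable E M'" "(\<integral>x. M' x \<partial>E) = 1"
    unfolding M'_def E_def using a4 by (intro integral_exp_tilt fin; simp)+
  have M2: "integrable E (\<lambda>x. (M' x)\<^sup>2)" "(\<integral>x. (M' x)\<^sup>2 \<partial>E) \<le> exp (4 * K\<^sup>2)"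
  proof -
    show "integrable E (\<lambda>x. (M' x)\<^sup>2)" unfolding M'_def E_def by (rule integral_exp_tilt_square_le(1)[OF fin ad \<delta>(2)])
    have "(\<integral>x. (M' x)\<^sup>2 \<partial>E) \<le> exp (2 * real (card {1..n + 1}) * \<delta>\<^sup>2)"
      unfolding M'_def E_def by (rule integral_exp_tilt_square_le(2)[OF fin ad \<delta>(2)])
    also have "\<dots> \<le> exp (4 * K\<^sup>2)" using m\<delta> by (simp add: cardI m_def)
    finally show "(\<integral>x. (M' x)\<^sup>2 \<partial>E) \<le> exp (4 * K\<^sup>2)" .
  qed
  have M0: "0 \<le> M' x" for x unfolding M'_def using a4 by (rule exp_tilt_nonneg)
  have Li: "integrable E L" "(\<integral>x. L x \<partial>E) = 1"
    using integral_gap_likelihood[OF bm, of n] tilted_density_integral[OF tilt]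
    unfolding L_def[abs_def] E_def b_def[symmetric] by simp_all
  have Lsq: "(L x)\<^sup>2 = gap_likelihood (\<lambda>u. (b u)\<^sup>2) n (normalize_sum n x)" for x
    by (simp add: L_def gap_likelihood_def prod_power_distrib)
  have b2m: "(\<lambda>u. (b u)\<^sup>2) \<in> borel_measurable borel" by measurable
  have b2i: "integrable unit_lborel (\<lambda>u. (b u)\<^sup>2)"
    using tilted_density_square_integrable[OF tilt] by (simp add: square_integrable_def b_def)
  have L2: "integrable E (\<lambda>x. (L x)\<^sup>2)" "(\<integral>x. (L x)\<^sup>2 \<partial>E) \<le> exp (4 * K\<^sup>2)"
  proof -
    show "integrable E (\<lambda>x. (L x)\<^sup>2)" unfolding Lsq E_def by (rule integral_gap_likelihood(1)[OF b2m b2i])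
    have "(\<integral>x. (L x)\<^sup>2 \<partial>E) = (\<integral>u. (b u)\<^sup>2 \<partial>unit_lborel) ^ n"
      unfolding Lsq E_def by (rule integral_gap_likelihood(2)[OF b2m b2i])
    also have "\<dots> \<le> (1 + 4 * \<delta>\<^sup>2) ^ n"
      using tilted_density_square_integral[OF tilt] unfolding rK b_def[symmetric]
      by (intro power_mono) simp_all
    also have "\<dots> \<le> exp (4 * \<delta>\<^sup>2) ^ n" by (intro power_mono exp_ge_add_one_self) simp
    also have "\<dots> = exp (4 * K\<^sup>2)" using s n by (simp add: exp_of_nat_mult[symmetric] \<delta>_def power_divide)
    finally show "(\<integral>x. (L x)\<^sup>2 \<partial>E) \<le> exp (4 * K\<^sup>2)" .
  qed
  have L0: "0 \<le> L x" for x
    unfolding L_def gap_likelihood_def b_def by (intro prod_nonneg ballI tilted_density_nonneg[OF tilt])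
  \<comment> \<open>the linearization error is at most \<open>Q\<close>, whose mean is of order \<open>1 / s\<close>\<close>
  have Sm [measurable]: "S \<in> borel_measurable E"
    unfolding S_def[abs_def] E_def by measurable
  have brm [measurable]: "bridge n i \<in> borel_measurable E" for i
    using measurable_bridge unfolding E_def by (simp only: measurable_PiM_exponential_iff)
  have Qm [measurable]: "Q \<in> borel_measurable E" unfolding Q_def[abs_def] by measurable
  note mom = exponential_quadratic_moments(1,2)[where n = n, folded E_def S_def m_def]
  note mom_bridge = exponential_quadratic_moments(3,4)[where n = n, folded E_def m_def]
  have br: "bridge n i = (\<lambda>x. \<Sum>j\<in>{1..n + 1}. (of_bool (j \<le> i) - real i / m) * x j)" for i
    by (simp add: bridge_def[abs_def] m_def)
  have bri: "integrable E (\<lambda>x. (bridge n i x)\<^sup>2)" "(\<integral>x. (bridge n i x)\<^sup>2 \<partial>E) \<le> m" if "i \<in> {1..n}" for i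
    using that mom_bridge[where i = i] unfolding br by (auto simp del: sum.cl_ivl_Suc)
  have Qi: "integrable E Q"
    unfolding Q_def[abs_def] using bri(1) mom(1) by (intro integrable_mult_right Bochner_Integration.integrable_sum Bochner_Integration.integrable_add)
  have QI: "(\<integral>x. Q x \<partial>E) \<le> 10 * K / s"
  proof -
    have "(\<integral>x. (\<Sum>i\<in>{1..n}. (bridge n i x)\<^sup>2 + (S x - m)\<^sup>2) \<partial>E)
        = (\<Sum>i\<in>{1..n}. \<integral>x. (bridge n i x)\<^sup>2 + (S x - m)\<^sup>2 \<partial>E)"
      using bri(1) mom(1) by (intro Bochner_Integration.integral_sum Bochner_Integration.integrable_add)
    also have "\<dots> \<le> (\<Sum>i\<in>{1..n}. 2 * m)"
      using bri mom(1,2) by (intro sum_mono) (simp add: Bochner_Integration.integral_add)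
    also have "\<dots> \<le> 2 * m * m" using m by (simp add: m_def)
    finally have "5 * K / m\<^sup>2 / s * (\<integral>x. (\<Sum>i\<in>{1..n}. (bridge n i x)\<^sup>2 + (S x - m)\<^sup>2) \<partial>E)
        \<le> 5 * K / m\<^sup>2 / s * (2 * m * m)"
      using K s by (intro mult_left_mono) auto
    also have "\<dots> = 10 * K / s" using m by (simp add: power2_eq_square)
    finally show ?thesis unfolding Q_def[abs_def] integral_mult_right_zero .
  qed
  define B where "B = {x \<in> space E. \<not> (\<bar>S x - m\<bar> \<le> m / 2 \<and> Q x \<le> \<epsilon>)}"
  have B: "B \<in> sets E" unfolding B_def by measurable
  have Q0: "0 \<le> Q x" for x
    unfolding Q_def using K s by (intro mult_nonneg_nonneg sum_nonneg) auto
  have PB: "E.prob B \<le> 4 / m + 10 * K / s / \<epsilon>"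
  proof -
    have "E.prob B = (\<integral>x. indicat_real B x \<partial>E)" using B by (simp add: Int_absorb2 sets.sets_into_space)
    also have "\<dots> \<le> (\<integral>x. 4 / m\<^sup>2 * (S x - m)\<^sup>2 + Q x / \<epsilon> \<partial>E)"
    proof (rule integral_mono)
      show "integrable E (indicat_real B)"
        using B by (intro E.integrable_const_bound[where B = 1]) (auto simp: indicator_def)
      show "integrable E (\<lambda>x. 4 / m\<^sup>2 * (S x - m)\<^sup>2 + Q x / \<epsilon>)" using mom(1) Qi by simp
      fix x
      have nn: "0 \<le> 4 / m\<^sup>2 * (S x - m)\<^sup>2" "0 \<le> Q x / \<epsilon>" using Q0 \<epsilon> by auto
      show "indicat_real B x \<le> 4 / m\<^sup>2 * (S x - m)\<^sup>2 + Q x / \<epsilon>"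
      proof (cases "x \<in> B")
        case True
        then consider "m / 2 < \<bar>S x - m\<bar>" | "\<epsilon> < Q x" by (auto simp: B_def)
        then show ?thesis
        proof cases
          case 1
          have "(m / 2)\<^sup>2 \<le> (S x - m)\<^sup>2" using power_mono[of "m / 2" "\<bar>S x - m\<bar>" 2] 1 m by simp
          then have "1 \<le> 4 / m\<^sup>2 * (S x - m)\<^sup>2" using m by (simp add: field_simps power2_eq_square)
          then show ?thesis using nn True by simp
        next
          case 2
          then have "1 \<le> Q x / \<epsilon>" using \<epsilon> by simp
          then have "1 \<le> 4 / m\<^sup>2 * (S x - m)\<^sup>2 + Q x / \<epsilon>" using nn(1) by linarith
          then show ?thesis using True by simp
        qed
      qed (use nn in simp)
    qed
    also have "\<dots> = 4 / m\<^sup>2 * m + (\<integral>x. Q x \<partial>E) / \<epsilon>" using mom(1,2) Qi by simp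
    also have "\<dots> \<le> 4 / m + 10 * K / s / \<epsilon>"
      using QI \<epsilon> m by (intro add_mono divide_right_mono) (auto simp: power2_eq_square)
    finally show ?thesis .
  qed
  define \<kappa> where "\<kappa> = exp ((\<Sum>i\<in>{1..n}. g (real i / real (n + 1))) / sqrt (real n))
            / (\<integral>y. exp (1 / sqrt (real n) * g y) \<partial>unit_lborel) ^ n / (\<Prod>j\<in>{1..n + 1}. 1 + gap_weight g' n j)"
  have a1: "0 < 1 + gap_weight g' n j" for j using a4[of j] unfolding a_def abs_le_iff by linarith
  have \<kappa>: "0 < \<kappa>"
    unfolding \<kappa>_def using tilted_density_normalizer_pos[OF tilt] a1
    by (intro divide_pos_pos zero_less_power prod_pos) (auto simp: s_def)
  have pos: "AE x in E. \<forall>j\<in>{1..n + 1}. 0 \<le> x j"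
  proof (intro AE_finite_allI fin)
    fix j assume j: "j \<in> {1..n + 1}"
    have "AE y in std_exponential. 0 \<le> y"
      unfolding std_exponential_def by (subst AE_density) (auto simp: erlang_density_def)
    with j show "AE x in E. 0 \<le> x j"
      unfolding E_def by (intro AE_PiM_component prob_space_std_exponential)
  qed
  have ratio: "AE x in E. x \<notin> B \<longrightarrow> (\<exists>\<rho>. \<bar>\<rho>\<bar> \<le> \<epsilon> \<and> L x = \<kappa> * exp \<rho> * M' x)"
    using pos AE_space
  proof eventually_elim
    case (elim x)
    show ?case
    proof
      assume "x \<notin> B"
      then have xB: "\<bar>S x - m\<bar> \<le> m / 2" "Q x \<le> \<epsilon>" using elim by (auto simp: B_def)
      from gap_likelihood_linearization[OF C n _ xB(1)[unfolded S_def m_def] a1] elim(1)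
      obtain \<rho> where "\<bar>\<rho>\<bar> \<le> Q x" "L x = \<kappa> * exp \<rho> * M' x"
        unfolding Q_def L_def M'_def \<kappa>_def S_def m_def s_def b_def a_def by blast
      then show "\<exists>\<rho>. \<bar>\<rho>\<bar> \<le> \<epsilon> \<and> L x = \<kappa> * exp \<rho> * M' x" using xB(2) by (meson order_trans)
    qed
  qed
  have LM: "(\<integral>x. \<bar>L x - M' x\<bar> \<partial>E) \<le> 2 * (\<epsilon> + exp (4 * K\<^sup>2) / A + A * (4 / m + 10 * K / s / \<epsilon>))"
    using L0 M0 \<epsilon>
    by (intro E.integral_abs_diff_le_of_proportional[OF Li _ L2 Mi _ M2 B PB A _ \<kappa> ratio]) auto
  \<comment> \<open>normalization commutes with permutations, so the test is symmetric in the exponentials too\<close>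
  have nm: "normalize_sum n \<in> borel_PiM {1..n + 1} \<rightarrow>\<^sub>M borel_PiM {1..n + 1}"
    by (rule measurable_normalize_sum)
  have \<tau>m: "\<tau> \<in> borel_measurable (borel_PiM {1..n + 1})"
    using measurable_comp[OF nm T(1)] by (simp add: \<tau>_def[abs_def] o_def)
  have \<tau>E [measurable]: "\<tau> \<in> borel_measurable E" using \<tau>m by (simp only: E_def measurable_PiM_exponential_iff)
  have \<tau>sym: "\<tau> (\<lambda>i\<in>{1..n + 1}. x (\<pi> i)) = \<tau> x" if "\<pi> permutes {1..n + 1}" for \<pi> x
  proof -
    have in_I: "\<pi> i \<in> {1..n + 1}" if "i \<in> {1..n + 1}" for i
      using permutes_in_image[OF \<open>\<pi> permutes _\<close>] that by blast
    have "(\<Sum>j\<in>{1..n + 1}. (\<lambda>i\<in>{1..n + 1}. x (\<pi> i)) j) = (\<Sum>j\<in>{1..n + 1}. (x \<circ> \<pi>) j)"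
      by (intro sum.cong refl) simp
    also have "\<dots> = (\<Sum>j\<in>{1..n + 1}. x j)" by (rule sum.permute[OF that, symmetric])
    finally have ns: "normalize_sum n (\<lambda>i\<in>{1..n + 1}. x (\<pi> i)) = (\<lambda>i\<in>{1..n + 1}. normalize_sum n x (\<pi> i))"
      using in_I unfolding normalize_sum_def by (auto simp: fun_eq_iff)
    have "normalize_sum n x \<in> extensional {1..n + 1}"
      unfolding normalize_sum_def by (rule restrict_extensional)
    then show ?thesis unfolding \<tau>_def ns by (rule sym[OF that])
  qed
  have \<tau>01: "0 \<le> \<tau> x" "\<tau> x \<le> 1" for x using T by (auto simp: \<tau>_def)
  have \<tau>M: "\<bar>(\<integral>x. \<tau> x * M' x \<partial>E) - (\<integral>x. \<tau> x \<partial>E)\<bar> \<le> e"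
    unfolding M'_def E_def
  proof (rule symmetric_test_exp_tilt[OF fin _ _ ad \<delta>(2) \<tau>m \<tau>01])
    show "2 \<le> card {1..n + 1}" using n by simp
    show "sum a {1..n + 1} = 0" unfolding a_def by (rule sum_gap_weight)
    show "symmetrization_bound (real (card {1..n + 1})) \<delta> - 1 \<le> e\<^sup>2"
      using e(2) unfolding cardI \<delta>_def s_def .
  qed (use \<tau>sym e in auto)
  note \<tau>fi = integrable_test_mult(1)[OF _ \<tau>E \<tau>01]
  have "\<bar>(\<integral>x. \<tau> x * L x \<partial>E) - (\<integral>x. \<tau> x * M' x \<partial>E)\<bar> = \<bar>\<integral>x. \<tau> x * (L x - M' x) \<partial>E\<bar>"
    using \<tau>fi[OF Li(1)] \<tau>fi[OF Mi(1)] by (simp add: right_diff_distrib)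
  also have "\<dots> \<le> (\<integral>x. \<bar>L x - M' x\<bar> \<partial>E)"
    by (intro integrable_test_mult(2)[OF _ \<tau>E \<tau>01] Bochner_Integration.integrable_diff Li Mi)
  finally have "\<bar>(\<integral>x. \<tau> x * L x \<partial>E) - (\<integral>x. \<tau> x \<partial>E)\<bar>
      \<le> 2 * (\<epsilon> + exp (4 * K\<^sup>2) / A + A * (4 / m + 10 * K / s / \<epsilon>)) + e"
    using LM \<tau>M by linarith
  moreover have "(\<integral>X. T (spacings n X) * (\<Prod>i\<in>{1..n}. b (X i)) \<partial>uniform_PiM {1..n}) = (\<integral>x. \<tau> x * L x \<partial>E)"
  proof -
    have "(\<lambda>d. T d * gap_likelihood b n d) \<in> borel_measurable (borel_PiM {1..n + 1})"
      by (intro borel_measurable_times T(1) measurable_gap_likelihood bm)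
    from integral_spacings_normalize(1)[OF this] show ?thesis
      by (simp only: gap_likelihood_spacings \<tau>_def L_def E_def)
  qed
  moreover have "uniform_expect n T = (\<integral>x. \<tau> x \<partial>E)"
    unfolding \<tau>_def E_def by (rule integral_spacings_normalize(1)[OF T(1)])
  ultimately show ?thesis unfolding m_def s_def b_def by simp
qed

lemma inverse_sqrt_tendsto_0: "(\<lambda>n. 1 / sqrt (real n)) \<longlonglongrightarrow> 0"
  by (intro tendsto_divide_0[OF tendsto_const] filterlim_at_top_imp_at_infinity
      filterlim_compose[OF sqrt_at_top filterlim_real_sequentially])

text \<open>
  With \<open>s = 1 / sqrt n\<close> the expression is a continuous function of \<open>s\<close> that vanishes at zero.
\<close>
lemma eventually_symmetrization_error_small:
  assumes "0 < c"
  shows "\<forall>\<^sub>F n in sequentially. symmetrization_bound (real (n + 1)) (K / sqrt (real n)) - 1 < c"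
proof -
  let ?s = "\<lambda>n. 1 / sqrt (real n)"
  have "(\<lambda>n. exp (4 * K ^ 3 * (1 + (?s n)\<^sup>2) * ?s n) * (1 + 2 * K ^ 4 * (1 + (?s n)\<^sup>2) * (?s n)\<^sup>2 *
      exp (K\<^sup>2 * (1 + (?s n)\<^sup>2))) - 1) \<longlonglongrightarrow>
      exp (4 * K ^ 3 * (1 + 0\<^sup>2) * 0) * (1 + 2 * K ^ 4 * (1 + 0\<^sup>2) * 0\<^sup>2 * exp (K\<^sup>2 * (1 + 0\<^sup>2))) - 1"
    by (intro tendsto_intros inverse_sqrt_tendsto_0)
  then have "\<forall>\<^sub>F n in sequentially. exp (4 * K ^ 3 * (1 + (?s n)\<^sup>2) * ?s n) * (1 + 2 * K ^ 4 * (1 + (?s n)\<^sup>2) * (?s n)\<^sup>2 *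
      exp (K\<^sup>2 * (1 + (?s n)\<^sup>2))) - 1 < c"
    using assms by (intro order_tendstoD(2)) auto
  then show ?thesis
    using eventually_gt_at_top[of 0]
  proof eventually_elim
    case (elim n)
    define s where "s = ?s n"
    have ns: "real n * s\<^sup>2 = 1" using elim by (simp add: s_def power_divide)
    have n1: "real (n + 1) * s\<^sup>2 = 1 + s\<^sup>2" using ns by (simp add: algebra_simps)
    have Ks: "K / sqrt (real n) = K * s" by (simp add: s_def)
    have "4 * real (n + 1) * (K * s) ^ 3 = 4 * K ^ 3 * (real (n + 1) * s\<^sup>2) * s"
      by (simp add: power_mult_distrib power3_eq_cube power2_eq_square)
    moreover have "2 * real (n + 1) * (K * s) ^ 4 = 2 * K ^ 4 * (real (n + 1) * s\<^sup>2) * s\<^sup>2"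
      by (simp add: power_mult_distrib power4_eq_xxxx power2_eq_square)
    moreover have "real (n + 1) * (K * s)\<^sup>2 = K\<^sup>2 * (real (n + 1) * s\<^sup>2)"
      by (simp add: power_mult_distrib)
    ultimately show ?case using elim(1) unfolding Ks s_def[symmetric] by (simp only: n1)
  qed
qed

lemma symmetric_test_tilted_eventually:
  assumes g: "g \<in> borel_measurable borel" and C: "C11_bound K g g'" and g0: "(\<integral>x. g x \<partial>unit_lborel) = 0"
    and \<eta>: "0 < \<eta>"
  shows "\<forall>\<^sub>F n in sequentially. \<forall>T. T \<in> borel_measurable (borel_PiM {1..n + 1}) \<longrightarrow> (\<forall>d. 0 \<le> T d \<and> T d \<le> 1) \<longrightarrow>
     (\<forall>\<pi> d. \<pi> permutes {1..n + 1} \<longrightarrow> d \<in> extensional {1..n + 1} \<longrightarrow> T (\<lambda>i\<in>{1..n + 1}. d (\<pi> i)) = T d) \<longrightarrow>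
     \<bar>tilted_expect n g T
          - uniform_expect n T\<bar> \<le> \<eta>"
proof -
  define \<epsilon> where "\<epsilon> = \<eta> / 16"
  define A where "A = 16 * exp (4 * K\<^sup>2) / \<eta>"
  define e where "e = \<eta> / 4"
  have pos: "0 < \<epsilon>" "0 < A" "0 < e" using \<eta> by (auto simp: \<epsilon>_def A_def e_def)
  have 1: "\<forall>\<^sub>F n in sequentially. symmetrization_bound (real (n + 1)) (K / sqrt (real n)) - 1 < e\<^sup>2"
    using pos by (intro eventually_symmetrization_error_small) simp
  have "(\<lambda>n. K * (1 / sqrt (real n))) \<longlonglongrightarrow> K * 0" by (intro tendsto_intros inverse_sqrt_tendsto_0)
  then have 2: "\<forall>\<^sub>F n in sequentially. K * (1 / sqrt (real n)) < 1 / 4" by (intro order_tendstoD(2)) auto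
  have "(\<lambda>n. A * (4 / real (Suc n) + 10 * K * (1 / sqrt (real n)) / \<epsilon>)) \<longlonglongrightarrow> A * (0 + 10 * K * 0 / \<epsilon>)"
    using pos by (intro tendsto_intros inverse_sqrt_tendsto_0 LIMSEQ_Suc[OF lim_const_over_n]) simp
  then have 3: "\<forall>\<^sub>F n in sequentially. A * (4 / real (Suc n) + 10 * K * (1 / sqrt (real n)) / \<epsilon>) < \<eta> / 16"
    using \<eta> by (intro order_tendstoD(2)) auto
  show ?thesis
    using 1 2 3 eventually_gt_at_top[of 0]
  proof eventually_elim
    case (elim n)
    show ?case
    proof (intro allI impI)
      fix T :: "(nat \<Rightarrow> real) \<Rightarrow> real"
      assume T: "T \<in> borel_measurable (borel_PiM {1..n + 1})" "\<forall>d. 0 \<le> T d \<and> T d \<le> 1"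
        and sym: "\<forall>\<pi> d. \<pi> permutes {1..n + 1} \<longrightarrow> d \<in> extensional {1..n + 1} \<longrightarrow> T (\<lambda>i\<in>{1..n + 1}. d (\<pi> i)) = T d"
      have "\<bar>tilted_expect n g T
          - uniform_expect n T\<bar>
       \<le> 2 * (\<epsilon> + exp (4 * K\<^sup>2) / A + A * (4 / real (n + 1) + 10 * K / sqrt (real n) / \<epsilon>)) + e"
        using elim T(2) sym by (intro symmetric_test_tilted_bound[OF g C g0 _ _ T(1)] pos) auto
      also have "exp (4 * K\<^sup>2) / A = \<eta> / 16" using \<eta> by (simp add: A_def)
      also have "A * (4 / real (n + 1) + 10 * K / sqrt (real n) / \<epsilon>) \<le> \<eta> / 16" using elim(3) by simp
      also have "2 * (\<epsilon> + \<eta> / 16 + \<eta> / 16) + e \<le> \<eta>" using \<eta> by (simp add: \<epsilon>_def e_def)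
      finally show "\<bar>tilted_expect n g T
          - uniform_expect n T\<bar> \<le> \<eta>" by simp
    qed
  qed
qed

section \<open>Replacing a perturbed density by a tilted one\<close>

text \<open>
  The integral exceeds one by the chi-square distance \<open>\<integral>(a - b)\<^sup>2 / b\<close>, where \<open>b\<close> is the tilted density,
  at least one half. The difference \<open>a - b\<close> is \<open>r (h - g)\<close> up to the second order remainder of \<open>b\<close>. For
  \<open>r\<^sup>2 = 1 / n\<close> the \<open>n\<close>-th power of the integral stays bounded.
\<close>
lemma chi_square_tilted_density:
  fixes h :: "real \<Rightarrow> real"
  assumes g: "g \<in> borel_measurable borel" and gK: "\<And>x. x \<in> {0..1} \<Longrightarrow> \<bar>g x\<bar> \<le> K"
    and g0: "(\<integral>x. g x \<partial>unit_lborel) = 0" and r: "0 \<le> r" "r * K \<le> 1 / 4"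
    and h: "square_integrable h" and a: "square_integrable a" "AE x in unit_lborel. a x = 1 + r * h x" "(\<integral>x. a x \<partial>unit_lborel) = 1"
  shows "integrable unit_lborel (\<lambda>x. (a x)\<^sup>2 / tilted_density g r x)"
    and "(\<integral>x. (a x)\<^sup>2 / tilted_density g r x \<partial>unit_lborel)
       \<le> 1 + r\<^sup>2 * (4 * (\<integral>x. (h x - g x)\<^sup>2 \<partial>unit_lborel) + 36 * r\<^sup>2 * K ^ 4)"
proof -
  interpret prob_space unit_lborel by (rule prob_space_unit_lborel)
  let ?b = "tilted_density g r"
  note tilt = g gK g0 r
  have [measurable]: "a \<in> borel_measurable unit_lborel" "h \<in> borel_measurable unit_lborel" using a h by measurable
  have bm: "?b \<in> borel_measurable borel" by (rule tilted_density_measurable[OF tilt])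
  have bU [measurable]: "?b \<in> borel_measurable unit_lborel" using bm by (rule borel_imp_measurable_unit_lborel)
  have b2: "1 / 2 \<le> ?b x" if "x \<in> space unit_lborel" for x
    using tilted_density_expansion(3)[OF tilt, of x] that by (simp add: space_unit_lborel)
  have sg: "square_integrable g" using g gK by (intro square_integrable_bounded[where B = K]) auto
  have a2: "integrable unit_lborel (\<lambda>x. (a x)\<^sup>2)" using a(1) by (simp add: square_integrable_def)
  show i: "integrable unit_lborel (\<lambda>x. (a x)\<^sup>2 / ?b x)"
  proof (rule Bochner_Integration.integrable_bound)
    show "integrable unit_lborel (\<lambda>x. 2 * (a x)\<^sup>2)" using a2 by simp
    show "AE x in unit_lborel. norm ((a x)\<^sup>2 / ?b x) \<le> norm (2 * (a x)\<^sup>2)"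
    proof (rule AE_I2)
      fix x assume x: "x \<in> space unit_lborel"
      have "(a x)\<^sup>2 / ?b x \<le> (a x)\<^sup>2 / (1 / 2)" using b2[OF x] by (intro divide_left_mono) auto
      then show "norm ((a x)\<^sup>2 / ?b x) \<le> norm (2 * (a x)\<^sup>2)" using b2[OF x] by simp
    qed
  qed measurable
  have hg: "integrable unit_lborel (\<lambda>x. (h x - g x)\<^sup>2)"
    using square_integrable_diff[OF h sg] by (simp add: square_integrable_def)
  have ai: "integrable unit_lborel a" using square_integrable_integrable[OF a(1)] .
  note bi = tilted_density_integral[OF tilt]
  have sq: "(u - v)\<^sup>2 / (1 / 2) \<le> 4 * u\<^sup>2 + 4 * v\<^sup>2" for u v :: real
    using zero_le_power2[of "u + v"] by (simp add: power2_eq_square algebra_simps)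
  have "(\<integral>x. (a x)\<^sup>2 / ?b x \<partial>unit_lborel) - 1 = (\<integral>x. (a x)\<^sup>2 / ?b x - 2 * a x + ?b x \<partial>unit_lborel)"
    using i ai bi a(3) by simp
  also have "\<dots> \<le> (\<integral>x. r\<^sup>2 * (4 * (h x - g x)\<^sup>2 + 36 * r\<^sup>2 * K ^ 4) \<partial>unit_lborel)"
  proof (rule integral_mono_AE)
    show "integrable unit_lborel (\<lambda>x. (a x)\<^sup>2 / ?b x - 2 * a x + ?b x)" using i ai bi by simp
    show "integrable unit_lborel (\<lambda>x. r\<^sup>2 * (4 * (h x - g x)\<^sup>2 + 36 * r\<^sup>2 * K ^ 4))" using hg by simp
    show "AE x in unit_lborel. (a x)\<^sup>2 / ?b x - 2 * a x + ?b x \<le> r\<^sup>2 * (4 * (h x - g x)\<^sup>2 + 36 * r\<^sup>2 * K ^ 4)"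
      using a(2) AE_space
    proof eventually_elim
      case (elim x)
      let ?u = "r * (h x - g x)" and ?v = "?b x - 1 - r * g x"
      have v: "\<bar>?v\<bar> \<le> 3 * (r * K)\<^sup>2"
        using tilted_density_expansion(1)[OF tilt, of x] elim by (simp add: space_unit_lborel)
      have "(a x)\<^sup>2 / ?b x - 2 * a x + ?b x = (a x - ?b x)\<^sup>2 / ?b x"
        using b2[OF elim(2)] by (simp add: field_simps power2_eq_square)
      also have "\<dots> \<le> (a x - ?b x)\<^sup>2 / (1 / 2)" using b2[OF elim(2)] by (intro divide_left_mono) auto
      also have "a x - ?b x = ?u - ?v" using elim(1) by (simp add: algebra_simps)
      also have "(?u - ?v)\<^sup>2 / (1 / 2) \<le> 4 * ?u\<^sup>2 + 4 * ?v\<^sup>2"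
        by (rule sq)
      also have "?v\<^sup>2 \<le> (3 * (r * K)\<^sup>2)\<^sup>2" using power_mono[OF v abs_ge_zero, of 2] by simp
      also have "4 * ?u\<^sup>2 + 4 * (3 * (r * K)\<^sup>2)\<^sup>2 = r\<^sup>2 * (4 * (h x - g x)\<^sup>2 + 36 * r\<^sup>2 * K ^ 4)"
        by (simp add: power_mult_distrib power2_eq_square power4_eq_xxxx algebra_simps)
      finally show ?case by simp
    qed
  qed
  also have "\<dots> = r\<^sup>2 * (4 * (\<integral>x. (h x - g x)\<^sup>2 \<partial>unit_lborel) + 36 * r\<^sup>2 * K ^ 4)"
    using hg by (simp add: prob_space)
  finally show "(\<integral>x. (a x)\<^sup>2 / ?b x \<partial>unit_lborel)
       \<le> 1 + r\<^sup>2 * (4 * (\<integral>x. (h x - g x)\<^sup>2 \<partial>unit_lborel) + 36 * r\<^sup>2 * K ^ 4)" by simp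
qed

text \<open>
  The second moment of a likelihood ratio is multiplicative over independent observations; the
  passage to the mean is the Cauchy-Schwarz inequality in its arithmetic-geometric form.
\<close>
lemma integral_abs_diff_prod_le_chi_square:
  fixes a b :: "'a \<Rightarrow> real"
  assumes N: "prob_space N" and I: "finite I"
    and a: "integrable N a" "(\<integral>x. a x \<partial>N) = 1" and b: "integrable N b" "(\<integral>x. b x \<partial>N) = 1" "\<And>x. x \<in> space N \<Longrightarrow> 0 < b x"
    and ab: "integrable N (\<lambda>x. (a x)\<^sup>2 / b x)" and \<delta>: "(\<integral>x. (a x)\<^sup>2 / b x \<partial>N) ^ card I - 1 \<le> \<delta>\<^sup>2" "0 < \<delta>"
  shows "integrable (Pi\<^sub>M I (\<lambda>_. N)) (\<lambda>X. (\<Prod>i\<in>I. a (X i)) - (\<Prod>i\<in>I. b (X i)))"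
    and "(\<integral>X. \<bar>(\<Prod>i\<in>I. a (X i)) - (\<Prod>i\<in>I. b (X i))\<bar> \<partial>Pi\<^sub>M I (\<lambda>_. N)) \<le> \<delta>"
proof -
  interpret product_sigma_finite "\<lambda>_. N"
    using N by (simp add: product_sigma_finite_def prob_space_imp_sigma_finite)
  let ?A = "\<lambda>X. \<Prod>i\<in>I. a (X i)" and ?B = "\<lambda>X. \<Prod>i\<in>I. b (X i)" and ?C = "\<lambda>X. \<Prod>i\<in>I. (a (X i))\<^sup>2 / b (X i)"
  have A: "integrable (Pi\<^sub>M I (\<lambda>_. N)) ?A" "(\<integral>X. ?A X \<partial>Pi\<^sub>M I (\<lambda>_. N)) = 1"
    using product_integrable_prod[OF I, of "\<lambda>_. a"] product_integral_prod[OF I, of "\<lambda>_. a"] a by simp_all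
  have B: "integrable (Pi\<^sub>M I (\<lambda>_. N)) ?B" "(\<integral>X. ?B X \<partial>Pi\<^sub>M I (\<lambda>_. N)) = 1"
    using product_integrable_prod[OF I, of "\<lambda>_. b"] product_integral_prod[OF I, of "\<lambda>_. b"] b by simp_all
  have C: "integrable (Pi\<^sub>M I (\<lambda>_. N)) ?C" "(\<integral>X. ?C X \<partial>Pi\<^sub>M I (\<lambda>_. N)) = (\<integral>x. (a x)\<^sup>2 / b x \<partial>N) ^ card I"
    using product_integrable_prod[OF I, of "\<lambda>_ x. (a x)\<^sup>2 / b x"] product_integral_prod[OF I, of "\<lambda>_ x. (a x)\<^sup>2 / b x"] ab by simp_all
  have sq: "(d - \<delta> * y)\<^sup>2 / (\<delta> * y) = d\<^sup>2 / y / \<delta> + \<delta> * y - 2 * d" if "0 < y" "0 < \<delta>" for d y :: real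
    using that by (simp add: power2_eq_square field_simps)
  show "integrable (Pi\<^sub>M I (\<lambda>_. N)) (\<lambda>X. ?A X - ?B X)" using A B by simp
  have "(\<integral>X. \<bar>?A X - ?B X\<bar> \<partial>Pi\<^sub>M I (\<lambda>_. N)) \<le> (\<integral>X. ((?C X - 2 * ?A X + ?B X) / \<delta> + \<delta> * ?B X) / 2 \<partial>Pi\<^sub>M I (\<lambda>_. N))"
  proof (rule integral_mono)
    show "integrable (Pi\<^sub>M I (\<lambda>_. N)) (\<lambda>X. \<bar>?A X - ?B X\<bar>)" using A B by simp
    show "integrable (Pi\<^sub>M I (\<lambda>_. N)) (\<lambda>X. ((?C X - 2 * ?A X + ?B X) / \<delta> + \<delta> * ?B X) / 2)" using A B C by simp
    fix X assume "X \<in> space (Pi\<^sub>M I (\<lambda>_. N))"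
    then have pos: "0 < ?B X" using b(3) by (intro prod_pos) (auto simp: space_PiM)
    have CB: "?C X = (?A X)\<^sup>2 / ?B X" by (simp add: prod_dividef prod_power_distrib)
    let ?d = "\<bar>?A X - ?B X\<bar>"
    \<comment> \<open>arithmetic-geometric mean inequality for \<open>?d\<^sup>2 / (\<delta> * ?B X)\<close> and \<open>\<delta> * ?B X\<close>\<close>
    have "0 \<le> (?d - \<delta> * ?B X)\<^sup>2 / (\<delta> * ?B X)" using pos \<delta> by simp
    also have "\<dots> = ?d\<^sup>2 / ?B X / \<delta> + \<delta> * ?B X - 2 * ?d"
      by (rule sq[OF pos \<delta>(2)])
    also have "?d\<^sup>2 / ?B X = ?C X - 2 * ?A X + ?B X"
      unfolding CB power2_abs power2_diff using pos by (simp add: add_divide_distrib diff_divide_distrib power2_eq_square)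
    finally show "?d \<le> ((?C X - 2 * ?A X + ?B X) / \<delta> + \<delta> * ?B X) / 2" by simp
  qed
  also have "\<dots> = (((\<integral>x. (a x)\<^sup>2 / b x \<partial>N) ^ card I - 1) / \<delta> + \<delta>) / 2" using A B C by simp
  also have "\<dots> \<le> (\<delta>\<^sup>2 / \<delta> + \<delta>) / 2" using \<delta> by (intro divide_right_mono add_right_mono) auto
  also have "\<dots> = \<delta>" using \<delta> by (simp add: power2_eq_square)
  finally show "(\<integral>X. \<bar>?A X - ?B X\<bar> \<partial>Pi\<^sub>M I (\<lambda>_. N)) \<le> \<delta>" .
qed

lemma PiM_density_unit:
  fixes a :: "real \<Rightarrow> real"
  assumes I: "finite I" and a [measurable]: "a \<in> borel_measurable unit_lborel" and a0: "\<And>x. 0 \<le> a x"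
    and a1: "integrable unit_lborel a" 
  shows "Pi\<^sub>M I (\<lambda>_. density unit_lborel (\<lambda>x. ennreal (a x)))
       = density (uniform_PiM I) (\<lambda>X. ennreal (\<Prod>i\<in>I. a (X i)))"
proof (rule sym)
  let ?D = "density unit_lborel (\<lambda>x. ennreal (a x))"
  interpret U: product_sigma_finite "\<lambda>_. unit_lborel" by (rule product_sigma_finite_unit)
  have "emeasure ?D (space ?D) = (\<integral>\<^sup>+x. ennreal (a x) \<partial>unit_lborel)"
    by (simp add: emeasure_density nn_set_integral_space)
  also have "\<dots> < \<infinity>" using a1 a0 by (simp add: nn_integral_eq_integral)
  finally have "finite_measure ?D" by (intro finite_measureI) simp
  then interpret D: product_sigma_finite "\<lambda>_. ?D"
    by (simp add: product_sigma_finite_def finite_measure.axioms)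
  have fm: "(\<lambda>X. ennreal (\<Prod>i\<in>I. a (X i))) \<in> borel_measurable (uniform_PiM I)" by measurable
  show "density (uniform_PiM I) (\<lambda>X. ennreal (\<Prod>i\<in>I. a (X i))) = Pi\<^sub>M I (\<lambda>_. ?D)"
  proof (rule D.PiM_eqI[OF I])
    show "sets (density (uniform_PiM I) (\<lambda>X. ennreal (\<Prod>i\<in>I. a (X i)))) = sets (Pi\<^sub>M I (\<lambda>_. ?D))"
      by (simp cong: sets_PiM_cong)
    fix A assume A: "\<And>i. i \<in> I \<Longrightarrow> A i \<in> sets ?D"
    then have A': "A i \<in> sets unit_lborel" if "i \<in> I" for i using that by simp
    have "emeasure (density (uniform_PiM I) (\<lambda>X. ennreal (\<Prod>i\<in>I. a (X i)))) (Pi\<^sub>E I A)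
        = (\<integral>\<^sup>+X. ennreal (\<Prod>i\<in>I. a (X i)) * indicator (Pi\<^sub>E I A) X \<partial>uniform_PiM I)"
      using A' by (intro emeasure_density fm sets_PiM_I_finite I) auto
    also have "\<dots> = (\<integral>\<^sup>+X. (\<Prod>i\<in>I. ennreal (a (X i)) * indicator (A i) (X i)) \<partial>uniform_PiM I)"
    proof (rule nn_integral_cong)
      fix X assume "X \<in> space (uniform_PiM I)"
      then have X: "X \<in> extensional I" by (auto simp: space_PiM PiE_def)
      have "indicator (Pi\<^sub>E I A) X = (\<Prod>i\<in>I. indicator (A i) (X i) :: ennreal)"
      proof (cases "X \<in> Pi\<^sub>E I A")
        case True
        then show ?thesis by (simp add: PiE_mem)
      next
        case False
        then obtain i where "i \<in> I" "X i \<notin> A i" using X by (auto simp: PiE_def)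
        then show ?thesis using I False by (simp add: prod_zero_iff) (auto simp: indicator_def)
      qed
      then show "ennreal (\<Prod>i\<in>I. a (X i)) * indicator (Pi\<^sub>E I A) X = (\<Prod>i\<in>I. ennreal (a (X i)) * indicator (A i) (X i))"
        using a0 by (simp add: prod.distrib prod_ennreal)
    qed
    also have "\<dots> = (\<Prod>i\<in>I. \<integral>\<^sup>+x. ennreal (a x) * indicator (A i) x \<partial>unit_lborel)"
      using A' by (intro U.product_nn_integral_prod[OF I]) auto
    also have "\<dots> = (\<Prod>i\<in>I. emeasure ?D (A i))"
      using A' by (intro prod.cong refl) (simp add: emeasure_density)
    finally show "emeasure (density (uniform_PiM I) (\<lambda>X. ennreal (\<Prod>i\<in>I. a (X i)))) (Pi\<^sub>E I A)
      = (\<Prod>i\<in>I. emeasure ?D (A i))" .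
  qed
qed

section \<open>Invariant tests and the expectations under comparison\<close>

text \<open>
  Tests are constrained only on the simplex of spacings. Their extension by zero is measurable, bounded and
  symmetric on all vectors.
\<close>
definition extend_test :: "nat \<Rightarrow> ((nat \<Rightarrow> real) \<Rightarrow> real) \<Rightarrow> (nat \<Rightarrow> real) \<Rightarrow> real" where
  "extend_test n T d = (if d \<in> space (spacing_space n) then T d else 0)"

lemma space_spacing_space:
  "space (spacing_space n) = {d \<in> extensional {1..n + 1}. (\<forall>i\<in>{1..n + 1}. 0 \<le> d i) \<and> (\<Sum>i\<in>{1..n + 1}. d i) = 1}"
  by (auto simp: spacing_space_def space_restrict_space space_PiM PiE_def)

lemma spacings_in_spacing_space:
  assumes "X \<in> {1..n} \<rightarrow> {0..1}"
  shows "spacings n X \<in> space (spacing_space n)"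
  unfolding space_spacing_space
proof (intro CollectI conjI ballI)
  show "spacings n X \<in> extensional {1..n + 1}" unfolding spacings_def by (rule restrict_extensional)
  show "0 \<le> spacings n X i" if "i \<in> {1..n + 1}" for i by (rule spacings_nonneg[OF assms that])
  show "(\<Sum>i\<in>{1..n + 1}. spacings n X i) = 1" by (rule sum_all_spacings)
qed

lemma extend_test:
  assumes T: "T \<in> invariant_tests n"
  shows "extend_test n T \<in> borel_measurable (borel_PiM {1..n + 1})"
    and "0 \<le> extend_test n T d" "extend_test n T d \<le> 1"
    and "\<pi> permutes {1..n + 1} \<Longrightarrow> d \<in> extensional {1..n + 1} \<Longrightarrow>
      extend_test n T (\<lambda>i\<in>{1..n + 1}. d (\<pi> i)) = extend_test n T d"
proof -
  let ?P = "Pi\<^sub>M {1..n + 1} (\<lambda>_. borel :: real measure)"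
  let ?\<Omega> = "{d. (\<forall>i\<in>{1..n + 1}. 0 \<le> d i) \<and> (\<Sum>i\<in>{1..n + 1}. d i) = (1::real)}"
  have Tm: "T \<in> borel_measurable (restrict_space ?P ?\<Omega>)"
    and T01: "\<And>d. d \<in> space (spacing_space n) \<Longrightarrow> 0 \<le> T d \<and> T d \<le> 1"
    and Ts: "\<And>d \<pi>. d \<in> space (spacing_space n) \<Longrightarrow> \<pi> permutes {1..n + 1} \<Longrightarrow> T (d \<circ> \<pi>) = T d"
    using T by (auto simp: invariant_tests_def spacing_space_def)
  have cm [measurable]: "(\<lambda>d. d i) \<in> borel_measurable ?P" if "i \<in> {1..n + 1}" for i
    using that by (rule measurable_component_singleton)
  have "{d \<in> space ?P. (\<forall>i\<in>{1..n + 1}. 0 \<le> d i) \<and> (\<Sum>i\<in>{1..n + 1}. d i) = 1} \<in> sets ?P"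
  proof (intro sets.sets_Collect_conj sets.sets_Collect_finite_All)
    show "{d \<in> space ?P. 0 \<le> d i} \<in> sets ?P" if "i \<in> {1..n + 1}" for i
      using cm[OF that] by (intro borel_measurable_le borel_measurable_const)
    have "(\<lambda>d. \<Sum>i\<in>{1..n + 1}. d i) \<in> borel_measurable ?P"
      by (intro borel_measurable_sum cm)
    then show "{d \<in> space ?P. (\<Sum>i\<in>{1..n + 1}. d i) = 1} \<in> sets ?P"
      by (intro borel_measurable_eq borel_measurable_const)
  qed simp
  also have "{d \<in> space ?P. (\<forall>i\<in>{1..n + 1}. 0 \<le> d i) \<and> (\<Sum>i\<in>{1..n + 1}. d i) = 1} = ?\<Omega> \<inter> space ?P"
    by auto
  finally have \<Omega>: "?\<Omega> \<inter> space ?P \<in> sets ?P" .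
  have ind: "(\<lambda>d. indicat_real ?\<Omega> d *\<^sub>R T d) \<in> borel_measurable ?P"
    using Tm by (subst (asm) borel_measurable_restrict_space_iff[OF \<Omega>])
  have ind_eq: "indicat_real ?\<Omega> d *\<^sub>R T d = extend_test n T d" if "d \<in> space ?P" for d
    using that by (auto simp: extend_test_def space_spacing_space space_PiM PiE_def indicator_def)
  show "extend_test n T \<in> borel_measurable ?P"
    by (rule iffD1[OF measurable_cong[OF ind_eq] ind])
  show "0 \<le> extend_test n T d" "extend_test n T d \<le> 1"
    using T01[of d] by (auto simp: extend_test_def)
  assume \<pi>: "\<pi> permutes {1..n + 1}" and d: "d \<in> extensional {1..n + 1}"
  have comp: "(\<lambda>i\<in>{1..n + 1}. d (\<pi> i)) = d \<circ> \<pi>"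
  proof
    fix i
    show "(\<lambda>i\<in>{1..n + 1}. d (\<pi> i)) i = (d \<circ> \<pi>) i"
    proof (cases "i \<in> {1..n + 1}")
      case False
      then have "\<pi> i = i" using \<pi> by (rule permutes_not_in[rotated])
      then show ?thesis
        using False extensional_arb[OF d False] by (simp only: restrict_apply if_False comp_def)
    qed (simp only: restrict_apply if_True comp_def)
  qed
  have "d \<circ> \<pi> \<in> extensional {1..n + 1}" unfolding comp[symmetric] by (rule restrict_extensional)
  moreover have "(\<Sum>i\<in>{1..n + 1}. (d \<circ> \<pi>) i) = (\<Sum>i\<in>{1..n + 1}. d i)" by (rule sum.permute[OF \<pi>, symmetric])
  moreover have "(\<forall>i\<in>{1..n + 1}. 0 \<le> (d \<circ> \<pi>) i) \<longleftrightarrow> (\<forall>i\<in>\<pi> ` {1..n + 1}. 0 \<le> d i)"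
    unfolding comp_def by blast
  moreover have "\<pi> ` {1..n + 1} = {1..n + 1}" by (rule permutes_image[OF \<pi>])
  ultimately have "d \<circ> \<pi> \<in> space (spacing_space n) \<longleftrightarrow> d \<in> space (spacing_space n)"
    using d by (simp only: space_spacing_space mem_Collect_eq)
  then show "extend_test n T (\<lambda>i\<in>{1..n + 1}. d (\<pi> i)) = extend_test n T d"
    unfolding comp extend_test_def using Ts[OF _ \<pi>] by simp
qed

lemma square_integrable_rep_l2: "square_integrable (rep_l2 f)"
  using Quotient_rep_reflp[OF Quotient_l2, of f] by simp

lemma abs_rep_l2: "abs_l2 (rep_l2 f) = f"
  by (rule Quotient_abs_rep[OF Quotient_l2])

lemma dist_l2_square: "(dist f h)\<^sup>2 = (\<integral>x. (rep_l2 f x - rep_l2 h x)\<^sup>2 \<partial>unit_lborel)"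
proof -
  let ?u = "\<lambda>x. rep_l2 f x + (-1) * rep_l2 h x"
  note sf = square_integrable_rep_l2[of f] and sh = square_integrable_rep_l2[of h]
  have sh': "square_integrable (\<lambda>x. (-1) * rep_l2 h x)" by (rule square_integrable_scale[OF sh])
  have su: "square_integrable ?u" by (rule square_integrable_add[OF sf sh'])
  have "f - h = abs_l2 (rep_l2 f) + (-1) *\<^sub>R abs_l2 (rep_l2 h)"
    by (simp add: abs_rep_l2)
  also have "(-1) *\<^sub>R abs_l2 (rep_l2 h) = abs_l2 (\<lambda>x. (-1) * rep_l2 h x)"
    by (rule scaleR_l2.abs_eq) (intro conjI sh AE_I2 refl)
  also have "abs_l2 (rep_l2 f) + \<dots> = abs_l2 ?u"
    by (rule plus_l2.abs_eq) (intro conjI sf sh' AE_I2 refl)+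
  finally have d: "f - h = abs_l2 ?u" .
  have "(dist f h)\<^sup>2 = (f - h) \<bullet> (f - h)" by (simp add: dist_norm power2_norm_eq_inner)
  also have "\<dots> = (\<integral>x. ?u x * ?u x \<partial>unit_lborel)"
    unfolding d by (rule inner_l2.abs_eq) (intro conjI su AE_I2 refl)+
  finally show ?thesis by (simp add: power2_eq_square)
qed

lemma is_perturbed_density_rep:
  "is_perturbed_density n h \<longleftrightarrow> (AE x in unit_lborel. 0 \<le> 1 + rep_l2 h x / sqrt (real n)) \<and>
     (\<integral>x. 1 + rep_l2 h x / sqrt (real n) \<partial>unit_lborel) = 1"
  using is_perturbed_density.abs_eq[of "rep_l2 h" n] by (simp add: abs_rep_l2 square_integrable_rep_l2)

lemma perturbed_dist_rep:
  "perturbed_dist n h = density unit_lborel (\<lambda>x. ennreal (1 + rep_l2 h x / sqrt (real n)))"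
  using perturbed_dist.abs_eq[of "rep_l2 h" n] by (simp add: abs_rep_l2 square_integrable_rep_l2)

lemma perturbed_dist_0: "perturbed_dist n 0 = unit_lborel"
  unfolding zero_l2.abs_eq by (subst perturbed_dist.abs_eq) (simp_all add: square_integrable_0 density_1)

lemma expect_0_eq:
  "expect n 0 T = (\<integral>X. extend_test n T (spacings n X) \<partial>uniform_PiM {1..n})"
  unfolding expect_def perturbed_dist_0
proof (rule Bochner_Integration.integral_cong[OF refl])
  fix X assume "X \<in> space (uniform_PiM {1..n})"
  then have "X \<in> {1..n} \<rightarrow> {0..1}" by (auto simp: space_PiM space_unit_lborel)
  from spacings_in_spacing_space[OF this]
  show "T (spacings n X) = extend_test n T (spacings n X)" by (simp add: extend_test_def)
qed

lemma expect_eq_likelihood: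
  fixes a :: "real \<Rightarrow> real"
  assumes T: "T \<in> invariant_tests n" and a: "a \<in> borel_measurable unit_lborel" "integrable unit_lborel a" "\<And>x. 0 \<le> a x"
    and h: "perturbed_dist n h = density unit_lborel (\<lambda>x. ennreal (a x))"
  shows "expect n h T = (\<integral>X. extend_test n T (spacings n X) * (\<Prod>i\<in>{1..n}. a (X i)) \<partial>uniform_PiM {1..n})"
proof -
  let ?U = "uniform_PiM {1..n}" and ?A = "\<lambda>X. \<Prod>i\<in>{1..n}. a (X i)"
  have P: "Pi\<^sub>M {1..n} (\<lambda>_. perturbed_dist n h) = density ?U (\<lambda>X. ennreal (?A X))"
    unfolding h using a by (intro PiM_density_unit) auto
  have m1: "(\<lambda>X. extend_test n T (spacings n X)) \<in> borel_measurable ?U"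
    by (rule measurable_compose[OF measurable_spacings_unit extend_test(1)[OF T]])
  have m2: "?A \<in> borel_measurable ?U" using a(1) by measurable
  have "expect n h T = (\<integral>X. T (spacings n X) \<partial>density ?U (\<lambda>X. ennreal (?A X)))"
    unfolding expect_def P ..
  also have "\<dots> = (\<integral>X. extend_test n T (spacings n X) \<partial>density ?U (\<lambda>X. ennreal (?A X)))"
  proof (rule Bochner_Integration.integral_cong[OF refl])
    fix X assume "X \<in> space (density ?U (\<lambda>X. ennreal (?A X)))"
    then have "X \<in> {1..n} \<rightarrow> {0..1}" by (auto simp: space_PiM space_unit_lborel)
    from spacings_in_spacing_space[OF this]
    show "T (spacings n X) = extend_test n T (spacings n X)" by (simp add: extend_test_def)
  qed
  also have "\<dots> = (\<integral>X. ?A X *\<^sub>R extend_test n T (spacings n X) \<partial>?U)"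
    using a(3) by (intro integral_density m1 m2 AE_I2 prod_nonneg) auto
  finally show ?thesis by (simp add: mult.commute)
qed

text \<open>
  The chi-square bound for one observation, raised to the \<open>n\<close>-th power. The density is cut off at zero
  before the comparison, since it is nonnegative only almost everywhere.
\<close>
lemma expect_close_to_tilted:
  assumes T: "T \<in> invariant_tests n" and n: "0 < n" and h: "is_perturbed_density n h"
    and g: "g \<in> borel_measurable borel" and gK: "\<And>x. x \<in> {0..1} \<Longrightarrow> \<bar>g x\<bar> \<le> K"
    and g0: "(\<integral>x. g x \<partial>unit_lborel) = 0" and small: "K / sqrt (real n) \<le> 1 / 4"
    and \<delta>: "exp (4 * (\<integral>x. (rep_l2 h x - g x)\<^sup>2 \<partial>unit_lborel) + 36 * K ^ 4 / real n) - 1 \<le> \<delta>\<^sup>2" "0 < \<delta>"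
  shows "\<bar>expect n h T - tilted_expect n g (extend_test n T)\<bar> \<le> \<delta>"
proof -
  define r where "r = 1 / sqrt (real n)"
  define a where "a x = max 0 (1 + r * rep_l2 h x)" for x
  define b where "b = tilted_density g r"
  define D where "D = (\<integral>x. (rep_l2 h x - g x)\<^sup>2 \<partial>unit_lborel)"
  let ?U = "uniform_PiM {1..n}"
  let ?T = "extend_test n T"
  have r: "0 \<le> r" "r * K \<le> 1 / 4" "r\<^sup>2 = 1 / real n" using small n by (auto simp: r_def power_divide)
  note tilt = g gK g0 r(1,2)
  interpret U1: prob_space unit_lborel by (rule prob_space_unit_lborel)
  note sh = square_integrable_rep_l2[of h]
  have [measurable]: "rep_l2 h \<in> borel_measurable unit_lborel" using sh by measurable
  have am [measurable]: "a \<in> borel_measurable unit_lborel" unfolding a_def[abs_def] by measurable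
  have aeq: "AE x in unit_lborel. a x = 1 + r * rep_l2 h x"
    using h by (auto simp: is_perturbed_density_rep a_def r_def elim!: eventually_mono)
  have i1: "square_integrable (\<lambda>x. 1 + r * rep_l2 h x)"
    by (intro square_integrable_add square_integrable_scale sh square_integrable_bounded[where B = 1]) auto
  have sa: "square_integrable a"
    unfolding square_integrable_def
  proof
    have "integrable unit_lborel (\<lambda>x. (1 + r * rep_l2 h x)\<^sup>2)" using i1 by (simp add: square_integrable_def)
    then show "integrable unit_lborel (\<lambda>x. (a x)\<^sup>2)"
      by (rule Bochner_Integration.integrable_bound) (auto simp: a_def max_def intro!: AE_I2)
  qed measurable
  have ai: "integrable unit_lborel a" by (rule square_integrable_integrable[OF sa])
  have a1: "(\<integral>x. a x \<partial>unit_lborel) = 1"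
  proof -
    have "(\<integral>x. a x \<partial>unit_lborel) = (\<integral>x. 1 + r * rep_l2 h x \<partial>unit_lborel)"
      using aeq by (intro integral_cong_AE) auto
    also have "\<dots> = 1" using h by (simp add: is_perturbed_density_rep r_def)
    finally show ?thesis .
  qed
  have pd: "perturbed_dist n h = density unit_lborel (\<lambda>x. ennreal (a x))"
    unfolding perturbed_dist_rep a_def r_def by (simp add: ennreal_max_0)
  note chi = chi_square_tilted_density[OF tilt sh sa aeq a1, folded b_def D_def]
  have bpos: "0 < b x" if "x \<in> space unit_lborel" for x
    using tilted_density_expansion(3)[OF tilt, of x] that unfolding b_def space_unit_lborel by linarith
  have "(\<integral>x. (a x)\<^sup>2 / b x \<partial>unit_lborel) ^ card {1..n} - 1 \<le> \<delta>\<^sup>2"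
  proof -
    have nn: "0 \<le> (\<integral>x. (a x)\<^sup>2 / b x \<partial>unit_lborel)"
      using bpos by (intro integral_nonneg_AE AE_I2) (simp add: less_imp_le)
    define c where "c = (4 * D + 36 * K ^ 4 / real n) / real n"
    have "(\<integral>x. (a x)\<^sup>2 / b x \<partial>unit_lborel) \<le> 1 + c"
      using chi(2) n unfolding r(3) c_def by simp
    also have "\<dots> \<le> exp c" by (rule exp_ge_add_one_self)
    finally have "(\<integral>x. (a x)\<^sup>2 / b x \<partial>unit_lborel) ^ n \<le> exp c ^ n" using nn by (rule power_mono)
    also have "\<dots> = exp (4 * D + 36 * K ^ 4 / real n)"
      using n by (simp add: exp_of_nat_mult[symmetric] c_def)
    finally show ?thesis using \<delta>(1) by (simp add: D_def)
  qed
  note AB = integral_abs_diff_prod_le_chi_square[OF prob_space_unit_lborel finite_atLeastAtMost ai a1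
      tilted_density_integral[OF tilt, folded b_def] bpos chi(1) this \<delta>(2)]
  have Tm: "(\<lambda>X. ?T (spacings n X)) \<in> borel_measurable ?U"
    by (rule measurable_compose[OF measurable_spacings_unit extend_test(1)[OF T]])
  note T01 = extend_test(2,3)[OF T]
  note Ti = integrable_test_mult(1)[OF _ Tm T01]
  interpret product_sigma_finite "\<lambda>_. unit_lborel" by (rule product_sigma_finite_unit)
  have Ai: "integrable ?U (\<lambda>X. \<Prod>i\<in>{1..n}. a (X i))"
    by (intro product_integrable_prod ai) simp
  have Bi: "integrable ?U (\<lambda>X. \<Prod>i\<in>{1..n}. b (X i))"
    unfolding b_def by (intro product_integrable_prod tilted_density_integral(1)[OF tilt]) simp
  have "expect n h T - (\<integral>X. ?T (spacings n X) * (\<Prod>i\<in>{1..n}. b (X i)) \<partial>?U)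
      = (\<integral>X. ?T (spacings n X) * ((\<Prod>i\<in>{1..n}. a (X i)) - (\<Prod>i\<in>{1..n}. b (X i))) \<partial>?U)"
    using expect_eq_likelihood[OF T am ai _ pd] Ti[OF Ai] Ti[OF Bi] by (simp add: a_def right_diff_distrib)
  also have "\<bar>\<dots>\<bar> \<le> (\<integral>X. \<bar>(\<Prod>i\<in>{1..n}. a (X i)) - (\<Prod>i\<in>{1..n}. b (X i))\<bar> \<partial>?U)"
    by (rule integrable_test_mult(2)[OF AB(1) Tm T01])
  also have "\<dots> \<le> \<delta>" by (rule AB(2))
  finally show ?thesis by (simp add: b_def r_def)
qed

section \<open>Uniformity over a compact set\<close>

text \<open>
  Every function in question has mean zero, and centering \<open>g\<close> brings it no farther from a function of mean
  zero, because \<open>\<integral>u\<^sup>2 - (\<integral>u)\<^sup>2 \<le> \<integral>u\<^sup>2\<close>. The statement quantifies over \<open>h\<close> so that one \<open>g\<close> serves a whole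
  ball around \<open>f\<close>.
\<close>
lemma centered_C11_approximation:
  assumes f: "square_integrable f" and e: "0 < e"
  shows "\<exists>g g' K. g \<in> borel_measurable borel \<and> C11_bound K g g' \<and> (\<integral>x. g x \<partial>unit_lborel) = 0 \<and>
     (\<forall>h. square_integrable h \<longrightarrow> (\<integral>x. h x \<partial>unit_lborel) = 0 \<longrightarrow>
        (\<integral>x. (h x - g x)\<^sup>2 \<partial>unit_lborel) \<le> 2 * (\<integral>x. (h x - f x)\<^sup>2 \<partial>unit_lborel) + e)"
proof -
  interpret prob_space unit_lborel by (rule prob_space_unit_lborel)
  obtain g g' K where g [measurable]: "g \<in> borel_measurable borel" and C: "C11_bound K g g'"
    and fg: "(\<integral>x. (f x - g x)\<^sup>2 \<partial>unit_lborel) < e / 2"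
    using C11_dense_L2[OF f, of "e / 2"] e by auto
  define c where "c = (\<integral>x. g x \<partial>unit_lborel)"
  have sg: "square_integrable g" using C by (intro square_integrable_bounded[where B = K]) (auto simp: C11_bound_def)
  have gi: "integrable unit_lborel g" by (rule square_integrable_integrable[OF sg])
  have "C11_bound \<bar>c\<bar> (\<lambda>_. - c) (\<lambda>_. 0)" by (auto simp: C11_bound_def)
  from C11_bound_add[OF C this] have C': "C11_bound (K + \<bar>c\<bar>) (\<lambda>x. g x + - c) (\<lambda>x. g' x + 0)" .
  have "(\<integral>x. g x + - c \<partial>unit_lborel) = 0" using gi by (simp add: prob_space c_def)
  moreover have "(\<integral>x. (h x - (g x + - c))\<^sup>2 \<partial>unit_lborel) \<le> 2 * (\<integral>x. (h x - f x)\<^sup>2 \<partial>unit_lborel) + e"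
    if h: "square_integrable h" and h0: "(\<integral>x. h x \<partial>unit_lborel) = 0" for h
  proof -
    note sd = square_integrable_diff[OF h sg]
    have u: "integrable unit_lborel (\<lambda>x. (h x - g x)\<^sup>2)" "integrable unit_lborel (\<lambda>x. h x - g x)"
      using sd square_integrable_integrable[OF sd] by (simp_all add: square_integrable_def)
    have uc: "(\<integral>x. h x - g x \<partial>unit_lborel) = - c"
      using square_integrable_integrable[OF h] gi h0 by (simp add: c_def)
    have "(h x - (g x + - c))\<^sup>2 = (h x - g x)\<^sup>2 + 2 * c * (h x - g x) + c\<^sup>2" for x
      by (simp add: power2_eq_square algebra_simps)
    then have "(\<integral>x. (h x - (g x + - c))\<^sup>2 \<partial>unit_lborel) = (\<integral>x. (h x - g x)\<^sup>2 + 2 * c * (h x - g x) + c\<^sup>2 \<partial>unit_lborel)"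
      by simp
    also have "\<dots> = (\<integral>x. (h x - g x)\<^sup>2 \<partial>unit_lborel) + 2 * c * (\<integral>x. h x - g x \<partial>unit_lborel) + c\<^sup>2"
    proof -
      have "integrable unit_lborel (\<lambda>x. 2 * c * (h x - g x))" by (intro integrable_mult_right u)
      moreover have "(\<integral>x. 2 * c * (h x - g x) \<partial>unit_lborel) = 2 * c * (\<integral>x. h x - g x \<partial>unit_lborel)"
        by (rule integral_mult_right_zero)
      ultimately show ?thesis
        using Bochner_Integration.integral_add[OF Bochner_Integration.integrable_add[OF u(1)] integrable_const, of _ "c\<^sup>2"]
          Bochner_Integration.integral_add[OF u(1)] by (simp add: prob_space)
    qed
    also have "\<dots> = (\<integral>x. (h x - g x)\<^sup>2 \<partial>unit_lborel) - c\<^sup>2" unfolding uc by (simp add: power2_eq_square)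
    also have "\<dots> \<le> (\<integral>x. ((h x - f x) + (f x - g x))\<^sup>2 \<partial>unit_lborel)" by simp
    also have "\<dots> \<le> 2 * (\<integral>x. (h x - f x)\<^sup>2 \<partial>unit_lborel) + 2 * (\<integral>x. (f x - g x)\<^sup>2 \<partial>unit_lborel)"
      by (intro integral_square_add_le square_integrable_diff h f sg)
    also have "\<dots> \<le> 2 * (\<integral>x. (h x - f x)\<^sup>2 \<partial>unit_lborel) + e" using fg by simp
    finally show ?thesis .
  qed
  moreover have "(\<lambda>x. g x + - c) \<in> borel_measurable borel" by measurable
  ultimately show ?thesis using C' by blast
qed

lemma perturbed_density_integral_zero:
  assumes "is_perturbed_density n h" "0 < n"
  shows "(\<integral>x. rep_l2 h x \<partial>unit_lborel) = 0"
proof -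
  interpret prob_space unit_lborel by (rule prob_space_unit_lborel)
  have "integrable unit_lborel (rep_l2 h)" by (rule square_integrable_integrable[OF square_integrable_rep_l2])
  then show ?thesis using assms by (simp add: is_perturbed_density_rep prob_space)
qed

text \<open>
  A compact set is covered by finitely many small balls, and a single smooth function serves each ball;
  so uniformity over the set costs only a finite intersection of eventualities. Uniformity over tests is
  already contained in the bounds.
\<close>
lemma expect_uniformly_close:
  assumes "compact \<Delta>" and \<epsilon>: "0 < \<epsilon>"
  shows "\<forall>\<^sub>F n in sequentially. \<forall>T\<in>invariant_tests n. \<forall>h\<in>\<Delta>. is_perturbed_density n h \<longrightarrow>
           \<bar>expect n h T - expect n 0 T\<bar> \<le> \<epsilon>"
proof -
  define \<delta> where "\<delta> = \<epsilon> / 2"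
  \<comment> \<open>the exponent in the chi-square bound is at most \<open>4 * D\<close> from the squared distance and \<open>D\<close> from the remainder\<close>
  define D where "D = ln (1 + \<delta>\<^sup>2) / 5"
  have \<delta>: "0 < \<delta>" using \<epsilon> by (simp add: \<delta>_def)
  have "0 < ln (1 + \<delta>\<^sup>2)" using \<delta> by (intro ln_gt_zero) simp
  then have D: "0 < D" by (simp add: D_def)
  have D5: "exp (5 * D) - 1 = \<delta>\<^sup>2"
    using \<delta> zero_less_power[of \<delta> 2] by (simp add: D_def add_pos_pos)
  define \<rho> where "\<rho> = sqrt (D / 4)"
  have \<rho>: "0 < \<rho>" "\<rho>\<^sup>2 = D / 4" using D by (auto simp: \<rho>_def)
  obtain N where N: "finite N" "\<Delta> \<subseteq> (\<Union>f\<in>N. ball f \<rho>)"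
    using assms(1) \<rho>(1) unfolding compact_eq_totally_bounded by blast
  have ev: "\<forall>\<^sub>F n in sequentially. \<forall>T\<in>invariant_tests n. \<forall>h\<in>ball f \<rho>. is_perturbed_density n h \<longrightarrow>
           \<bar>expect n h T - expect n 0 T\<bar> \<le> \<epsilon>" for f
  proof -
    obtain g g' K where g: "g \<in> borel_measurable borel" and C: "C11_bound K g g'" and g0: "(\<integral>x. g x \<partial>unit_lborel) = 0"
      and app: "\<And>h. square_integrable h \<Longrightarrow> (\<integral>x. h x \<partial>unit_lborel) = 0 \<Longrightarrow>
        (\<integral>x. (h x - g x)\<^sup>2 \<partial>unit_lborel) \<le> 2 * (\<integral>x. (h x - rep_l2 f x)\<^sup>2 \<partial>unit_lborel) + D / 2"
      using centered_C11_approximation[OF square_integrable_rep_l2[of f], of "D / 2"] D by auto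
    have gK: "\<bar>g x\<bar> \<le> K" if "x \<in> {0..1}" for x using C that by (simp add: C11_bound_def)
    have 1: "\<forall>\<^sub>F n in sequentially. 36 * K ^ 4 / real n < D"
      using D lim_const_over_n[of "36 * K ^ 4"] by (intro order_tendstoD(2)) auto
    have "(\<lambda>n. K * (1 / sqrt (real n))) \<longlonglongrightarrow> K * 0" by (intro tendsto_intros inverse_sqrt_tendsto_0)
    then have 2: "\<forall>\<^sub>F n in sequentially. K * (1 / sqrt (real n)) < 1 / 4" by (intro order_tendstoD(2)) auto
    show ?thesis
      using 1 2 symmetric_test_tilted_eventually[OF g C g0 \<delta>] eventually_gt_at_top[of 0]
    proof eventually_elim
      case (elim n)
      show ?case
      proof (intro ballI impI)
        fix T h assume T: "T \<in> invariant_tests n" and h: "h \<in> ball f \<rho>" and pd: "is_perturbed_density n h"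
        have "(\<integral>x. (rep_l2 h x - rep_l2 f x)\<^sup>2 \<partial>unit_lborel) = (dist f h)\<^sup>2"
          by (simp only: dist_l2_square dist_commute[of f h])
        also have "\<dots> \<le> \<rho>\<^sup>2" using h by (intro power_mono) auto
        finally have "(\<integral>x. (rep_l2 h x - g x)\<^sup>2 \<partial>unit_lborel) \<le> D"
          using app[OF square_integrable_rep_l2 perturbed_density_integral_zero[OF pd elim(4)]] \<rho>(2) by linarith
        then have "exp (4 * (\<integral>x. (rep_l2 h x - g x)\<^sup>2 \<partial>unit_lborel) + 36 * K ^ 4 / real n) \<le> exp (5 * D)"
          using elim(1) by simp
        then have chi: "exp (4 * (\<integral>x. (rep_l2 h x - g x)\<^sup>2 \<partial>unit_lborel) + 36 * K ^ 4 / real n) - 1 \<le> \<delta>\<^sup>2"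
          using D5 by linarith
        let ?I = "\<integral>X. extend_test n T (spacings n X) *
          (\<Prod>i\<in>{1..n}. tilted_density g (1 / sqrt (real n)) (X i)) \<partial>uniform_PiM {1..n}"
        have "\<bar>expect n h T - ?I\<bar> \<le> \<delta>"
          using elim(2) by (intro expect_close_to_tilted[OF T elim(4) pd g gK g0 _ chi \<delta>]) auto
        moreover have "\<bar>?I - expect n 0 T\<bar> \<le> \<delta>"
          unfolding expect_0_eq using elim(3) extend_test[OF T] by blast
        ultimately show "\<bar>expect n h T - expect n 0 T\<bar> \<le> \<epsilon>" unfolding \<delta>_def by linarith
      qed
    qed
  qed
  have "\<forall>\<^sub>F n in sequentially. \<forall>f\<in>N. \<forall>T\<in>invariant_tests n. \<forall>h\<in>ball f \<rho>. is_perturbed_density n h \<longrightarrow>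
           \<bar>expect n h T - expect n 0 T\<bar> \<le> \<epsilon>"
    using N(1) ev by (intro eventually_ball_finite) auto
  then show ?thesis
    by (rule eventually_mono) (use N(2) in blast)
qed

theorem theorem9:
  fixes \<Delta>\<^sub>0 :: "l2 set"
  assumes "compact \<Delta>\<^sub>0"
  shows "(\<lambda>n. SUP (T, h) \<in> invariant_tests n \<times> {h \<in> \<Delta>\<^sub>0. is_perturbed_density n h}.
            ennreal \<bar>expect n h T - expect n 0 T\<bar>) \<longlonglongrightarrow> 0"
proof (rule order_tendstoI)
  fix c :: ennreal assume "0 < c"
  then obtain c' where c': "0 < c'" "c' < c" using dense by blast
  then obtain \<epsilon> where \<epsilon>: "c' = ennreal \<epsilon>" "0 \<le> \<epsilon>" by (cases c') auto
  with c' have "0 < \<epsilon>" by auto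
  from expect_uniformly_close[OF assms this]
  show "\<forall>\<^sub>F n in sequentially. (SUP (T, h) \<in> invariant_tests n \<times> {h \<in> \<Delta>\<^sub>0. is_perturbed_density n h}.
            ennreal \<bar>expect n h T - expect n 0 T\<bar>) < c"
  proof eventually_elim
    case (elim n)
    have "(SUP (T, h) \<in> invariant_tests n \<times> {h \<in> \<Delta>\<^sub>0. is_perturbed_density n h}.
            ennreal \<bar>expect n h T - expect n 0 T\<bar>) \<le> ennreal \<epsilon>"
      using elim by (auto intro!: SUP_least ennreal_leI)
    then show ?case using c'(2) \<epsilon>(1) by simp
  qed
qed simp

end
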